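(* Let $G$ be a countable amenable group and let $(\Gamma,\lambda)\in\mathcal{H}_G$ be such that the Gibbs $(\Gamma,\lambda)$-specification satisfies strong spatial mixing; let $\mathbb{P}$ be the unique Gibbs measure for $(\Gamma,\lambda)$. Then $$f_G(\Gamma,\lambda)=\int\left(\mathbb{E}_{\tilde\Phi}I_{\mathbb{P}}(x,\tilde\Phi)+\phi_\lambda(x)\right)d\mathbb{Q}(x)$$ for every $G$-invariant Borel probability measure $\mathbb{Q}$ on $X(\Gamma)$ and every invariant random past $\tilde\Phi$ of $G$. In particular, $$f_G(\Gamma,\lambda)=\mathbb{E}_{\tilde\Phi}I_{\mathbb{P}}(0^\Gamma,\tilde\Phi),$$ where $0^\Gamma\in X(\Gamma)$ is the empty independent set.
   Context: A graph $\Gamma=(V,E)$ has a countable vertex set $V$ and a symmetric edge relation $E$; graphs are loopless. $X(\Gamma)\subseteq\{0,1\}^V$ is the set of (indicator functions of) independent sets with the product topology. For $W\subseteq V$, $[x_W]=\{x'\in X(\Gamma):x'|_W=x|_W\}$; $[0^v]$ is the event that $v$ takes value $0$. An activity function is $\lambda:V\to\mathbb{R}_{>0}$; $(\Gamma,\lambda)$ is a hardcore model. For finite $U\subseteq V$, $Z_\Gamma(U,\lambda)=\sum_x\prod_{v\in U}\lambda(v)^{x(v)}$ over $x\in X(\Gamma)$ with $x=0$ off $U$. $\mathcal{H}_G$ is the set of hardcore models $(\Gamma,\lambda)$ such that $\Gamma$ is countable and locally finite, $G$ is (isomorphic to) a subgroup of $\mathrm{Aut}(\Gamma)$ acting (from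 the left, $gv=g(v)$) freely and almost transitively (finitely many orbits) on $V$, and $\lambda$ is $G$-invariant. $\Gamma/G$ is the set of orbits; a fundamental domain $U_0$, containing exactly one vertex of each orbit, is fixed, so $|U_0|=|\Gamma/G|<\infty$. $FU_0=\{gv:g\in F,v\in U_0\}$. $G$ acts on $X(\Gamma)$ by $g\cdot x=x\circ g^{-1}$. The free energy is $f_G(\Gamma,\lambda)=\inf_F\frac{\log Z_\Gamma(FU_0,\lambda)}{|FU_0|}$ over finite nonempty $F\subseteq G$ (independent of $U_0$). $\phi_\lambda(x)=\frac{1}{|\Gamma/G|}\sum_{v\in U_0}x(v)\log\lambda(v)$. Specification: for finite $U\subseteq V$, $y\in X(\Gamma)$, $\pi^y_U$ is the probability measure on $\{x\in X(\Gamma):x=y\text{ off }U\}$ with $\pi^y_U(x)\propto\prod_{v\in U}\lambda(v)^{x(v)}$. A Borel probability measure $\mathbb{P}$ on $X(\Gamma)$ is a Gibbs measure if $\mathbb{P}([x_{U'}]\mid\mathcal{B}_{U^c})(y)=\pi^y_U([x_{U'}])$ for $\mathbb{P}$-a.e. $y$, for all finite $U$, $U'\subseteq U$, $x\in X(\Gamma)$, with $\mathcal{B}_{U^c}$ the $\sigma$-algebra of coordinates outside $U$. Strong spatial mixing (SSM): there is $\delta:\mathbb{N}\to\mathbb{R}_{\ge0}$ with $\delta(\ell)\to0$ such that for all finite $U\subseteq V$, $v\in U$, $y,z\in X(\Gamma)$, $|\pi^y_U([0^v])-\pi^z_U([0^v])|\le\delta(\mathrm{dist}_\Gamma(v,D_U(y,z)))$,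 where $D_U(y,z)=\{v'\in U^c:y(v')\neq z(v')\}$ and $\delta(+\infty)$ is read as $0$. SSM implies uniqueness of the Gibbs measure; every Gibbs measure gives positive mass to every cylinder $[x_W]$ with $x\in X(\Gamma)$ and $W$ finite. Information function: let $\{E_n\}_n$ be any exhaustion of $G$ (an increasing sequence of finite subsets of $G$ with union $G$). For $x\in X(\Gamma)$ and $\Phi\in(\{0,1\}^G)^G$ (viewed as a map $g\mapsto\Phi(g)\subseteq G$), $I_{\mathbb{P}}(x,\Phi)=\limsup_{n}\left(-\frac{1}{|\Gamma/G|}\log\mathbb{P}([x_{U_0}]\mid[x_{(\Phi(1_G)\cap E_n)U_0}])\right)$. An invariant random past on $G$ is a random element $\tilde\Phi$ of $(\{0,1\}^G)^G$ (a Borel probability measure $\tilde\nu$ on this space) such that almost surely: (1) $g\notin\tilde\Phi(g)$ for all $g$; (2) if $g\in\tilde\Phi(h)$ then $\tilde\Phi(g)\subseteq\tilde\Phi(h)$; (3) if $g\ne h$ then either $g\in\tilde\Phi(h)$ or $h\in\tilde\Phi(g)$; and moreover (4) for all $g\in G$, the random sets $\tilde\Phi(g)$ and $\tilde\Phi(1_G)g$ have the same distribution. $\mathbb{E}_{\tilde\Phi}$ denotes integration with respect to the law $\tilde\nu$.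
   Formalization: In the definition of invariant random past, clause (4) is taken as: Φ(g) and gΦ(1) have the same distribution, instead of Φ(g) and Φ(1)g. With G acting from the left the latter makes the formula false for some non-abelian G (e.g. S_3 on a hexagon); for abelian G they agree. *)

theory Defs
  imports "HOL-Probability.Probability" "HOL-Algebra.Algebra"
begin

section \<open>Product topologies and Borel sets\<close>

definition borel_of :: "'a topology \<Rightarrow> 'a measure" where
  "borel_of T = sigma (topspace T) {U. openin T U}"

text \<open>The space of 0-1 valued functions on an index set. Following the convention of
  \<^const>\<open>product_topology\<close>, its points are functions that are \<^const>\<open>undefined\<close> off the
  index set.\<close>

definition cube_topology :: "'i set \<Rightarrow> ('i \<Rightarrow> nat) topology" where
  "cube_topology I = product_topology (\<lambda>_. discrete_topology {0, 1}) I"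


section \<open>Graphs, independent sets, hardcore models\<close>

definition graph :: "'v set \<Rightarrow> 'v rel \<Rightarrow> bool" where
  "graph V E \<longleftrightarrow> countable V \<and> E \<subseteq> V \<times> V \<and> sym E \<and> irrefl E"

definition locally_finite_graph :: "'v set \<Rightarrow> 'v rel \<Rightarrow> bool" where
  "locally_finite_graph V E \<longleftrightarrow> (\<forall>v\<in>V. finite {w. (v, w) \<in> E})"

text \<open>Distance from a vertex to a set of vertices; it is \<open>\<infinity>\<close> if the set cannot be reached, in
  particular if it is empty.\<close>

definition graph_dist :: "'v rel \<Rightarrow> 'v \<Rightarrow> 'v set \<Rightarrow> enat" where
  "graph_dist E v D = Inf {enat n | n. \<exists>w\<in>D. (v, w) \<in> E ^^ n}"

definition indep_configs :: "'v set \<Rightarrow> 'v rel \<Rightarrow> ('v \<Rightarrow> nat) set" where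
  "indep_configs V E =
     {x \<in> V \<rightarrow>\<^sub>E {0, 1}. \<forall>(u, v)\<in>E. \<not> (x u = 1 \<and> x v = 1)}"

definition config_space :: "'v set \<Rightarrow> 'v rel \<Rightarrow> ('v \<Rightarrow> nat) measure" where
  "config_space V E = borel_of (subtopology (cube_topology V) (indep_configs V E))"

definition empty_config :: "'v set \<Rightarrow> 'v \<Rightarrow> nat" where
  "empty_config V = (\<lambda>v\<in>V. 0)"

definition cylinder :: "'v set \<Rightarrow> 'v rel \<Rightarrow> ('v \<Rightarrow> nat) \<Rightarrow> 'v set \<Rightarrow> ('v \<Rightarrow> nat) set" where
  "cylinder V E x W = {x' \<in> indep_configs V E. \<forall>w\<in>W. x' w = x w}"

definition zero_event :: "'v set \<Rightarrow> 'v rel \<Rightarrow> 'v \<Rightarrow> ('v \<Rightarrow> nat) set" where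
  "zero_event V E v = {x \<in> indep_configs V E. x v = 0}"

definition hardcore_model :: "'v set \<Rightarrow> 'v rel \<Rightarrow> ('v \<Rightarrow> real) \<Rightarrow> bool" where
  "hardcore_model V E lam \<longleftrightarrow> graph V E \<and> (\<forall>v\<in>V. lam v > 0)"

definition partition_fun :: "'v set \<Rightarrow> 'v rel \<Rightarrow> ('v \<Rightarrow> real) \<Rightarrow> 'v set \<Rightarrow> real" where
  "partition_fun V E lam U =
     (\<Sum>x\<in>{x \<in> indep_configs V E. \<forall>v\<in>V - U. x v = 0}. \<Prod>v\<in>U. lam v ^ x v)"


section \<open>Group actions on hardcore models\<close>

text \<open>Faithfulness of the action expresses that \<open>G\<close> is isomorphic to a subgroup of the
  automorphism group of the graph.\<close>

definition hardcore_class ::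
  "('g, 'm) monoid_scheme \<Rightarrow> 'v set \<Rightarrow> 'v rel \<Rightarrow> ('v \<Rightarrow> real) \<Rightarrow> ('g \<Rightarrow> 'v \<Rightarrow> 'v) \<Rightarrow> bool" where
  "hardcore_class G V E lam act \<longleftrightarrow>
     hardcore_model V E lam \<and> locally_finite_graph V E \<and>
     faithful_action G V act \<and>
     (\<forall>g\<in>carrier G. \<forall>u\<in>V. \<forall>v\<in>V. (act g u, act g v) \<in> E \<longleftrightarrow> (u, v) \<in> E) \<and>
     (\<forall>g\<in>carrier G. \<forall>v\<in>V. act g v = v \<longrightarrow> g = \<one>\<^bsub>G\<^esub>) \<and>
     finite (orbits G V act) \<and>
     (\<forall>g\<in>carrier G. \<forall>v\<in>V. lam (act g v) = lam v)"

definition fundamental_domain ::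
  "('g, 'm) monoid_scheme \<Rightarrow> 'v set \<Rightarrow> ('g \<Rightarrow> 'v \<Rightarrow> 'v) \<Rightarrow> 'v set \<Rightarrow> bool" where
  "fundamental_domain G V act U\<^sub>0 \<longleftrightarrow>
     U\<^sub>0 \<subseteq> V \<and> (\<forall>B\<in>orbits G V act. \<exists>!v. v \<in> U\<^sub>0 \<and> v \<in> B)"

definition translates :: "('g \<Rightarrow> 'v \<Rightarrow> 'v) \<Rightarrow> 'g set \<Rightarrow> 'v set \<Rightarrow> 'v set" where
  "translates act F U = {act g v | g v. g \<in> F \<and> v \<in> U}"

definition config_act ::
  "('g, 'm) monoid_scheme \<Rightarrow> 'v set \<Rightarrow> ('g \<Rightarrow> 'v \<Rightarrow> 'v) \<Rightarrow> 'g \<Rightarrow> ('v \<Rightarrow> nat) \<Rightarrow> 'v \<Rightarrow> nat" where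
  "config_act G V act g x = (\<lambda>v\<in>V. x (act (inv\<^bsub>G\<^esub> g) v))"

definition invariant_config_measure ::
  "('g, 'm) monoid_scheme \<Rightarrow> 'v set \<Rightarrow> 'v rel \<Rightarrow> ('g \<Rightarrow> 'v \<Rightarrow> 'v) \<Rightarrow> ('v \<Rightarrow> nat) measure \<Rightarrow> bool" where
  "invariant_config_measure G V E act Q \<longleftrightarrow>
     prob_space Q \<and> sets Q = sets (config_space V E) \<and>
     (\<forall>g\<in>carrier G. distr Q Q (config_act G V act g) = Q)"

definition free_energy ::
  "('g, 'm) monoid_scheme \<Rightarrow> 'v set \<Rightarrow> 'v rel \<Rightarrow> ('v \<Rightarrow> real) \<Rightarrow> ('g \<Rightarrow> 'v \<Rightarrow> 'v) \<Rightarrow> 'v set \<Rightarrow> real" where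
  "free_energy G V E lam act U\<^sub>0 =
     (INF F\<in>{F. F \<subseteq> carrier G \<and> finite F \<and> F \<noteq> {}}.
        ln (partition_fun V E lam (translates act F U\<^sub>0)) / real (card (translates act F U\<^sub>0)))"

definition energy_fun ::
  "('g, 'm) monoid_scheme \<Rightarrow> 'v set \<Rightarrow> ('v \<Rightarrow> real) \<Rightarrow> ('g \<Rightarrow> 'v \<Rightarrow> 'v) \<Rightarrow> 'v set \<Rightarrow> ('v \<Rightarrow> nat) \<Rightarrow> real" where
  "energy_fun G V lam act U\<^sub>0 x =
     1 / real (card (orbits G V act)) * (\<Sum>v\<in>U\<^sub>0. real (x v) * ln (lam v))"

text \<open>Amenability, in the form of the existence of a (left) Foelner sequence; inverting the sets
  turns it into a right Foelner sequence.\<close>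

definition amenable_group :: "('g, 'm) monoid_scheme \<Rightarrow> bool" where
  "amenable_group G \<longleftrightarrow> group G \<and> countable (carrier G) \<and>
     (\<exists>F :: nat \<Rightarrow> 'g set.
        (\<forall>n. F n \<subseteq> carrier G \<and> finite (F n) \<and> F n \<noteq> {}) \<and>
        (\<forall>g\<in>carrier G.
           (\<lambda>n. real (card (sym_diff (g <#\<^bsub>G\<^esub> F n) (F n))) / real (card (F n))) \<longlonglongrightarrow> 0))"


section \<open>Gibbs specification, Gibbs measures, strong spatial mixing\<close>

definition boundary_configs ::
  "'v set \<Rightarrow> 'v rel \<Rightarrow> 'v set \<Rightarrow> ('v \<Rightarrow> nat) \<Rightarrow> ('v \<Rightarrow> nat) set" where
  "boundary_configs V E U y = {x \<in> indep_configs V E. \<forall>v\<in>V - U. x v = y v}"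

text \<open>For finite \<open>U\<close>, the probability of an event under the finitely supported measure
  \<open>\<pi>\<^sup>y\<^sub>U\<close>.\<close>

definition gibbs_spec ::
  "'v set \<Rightarrow> 'v rel \<Rightarrow> ('v \<Rightarrow> real) \<Rightarrow> 'v set \<Rightarrow> ('v \<Rightarrow> nat) \<Rightarrow> ('v \<Rightarrow> nat) set \<Rightarrow> real" where
  "gibbs_spec V E lam U y A =
     (\<Sum>x\<in>boundary_configs V E U y \<inter> A. \<Prod>v\<in>U. lam v ^ x v) /
     (\<Sum>x\<in>boundary_configs V E U y. \<Prod>v\<in>U. lam v ^ x v)"

definition coord_algebra :: "'v set \<Rightarrow> 'v rel \<Rightarrow> 'v set \<Rightarrow> ('v \<Rightarrow> nat) measure" where
  "coord_algebra V E W =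
     sigma (indep_configs V E) {{x \<in> indep_configs V E. x v = a} | v a. v \<in> W}"

definition gibbs_measure ::
  "'v set \<Rightarrow> 'v rel \<Rightarrow> ('v \<Rightarrow> real) \<Rightarrow> ('v \<Rightarrow> nat) measure \<Rightarrow> bool" where
  "gibbs_measure V E lam P \<longleftrightarrow>
     prob_space P \<and> sets P = sets (config_space V E) \<and>
     (\<forall>U U' x. finite U \<longrightarrow> U \<subseteq> V \<longrightarrow> U' \<subseteq> U \<longrightarrow> x \<in> indep_configs V E \<longrightarrow>
        (AE y in P. real_cond_exp P (coord_algebra V E (V - U)) (indicator (cylinder V E x U')) y
                    = gibbs_spec V E lam U y (cylinder V E x U')))"

definition disagreement :: "'v set \<Rightarrow> 'v set \<Rightarrow> ('v \<Rightarrow> nat) \<Rightarrow> ('v \<Rightarrow> nat) \<Rightarrow> 'v set" where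
  "disagreement V U y z = {v \<in> V - U. y v \<noteq> z v}"

definition rate_at :: "(nat \<Rightarrow> real) \<Rightarrow> enat \<Rightarrow> real" where
  "rate_at \<delta> d = (case d of enat n \<Rightarrow> \<delta> n | \<infinity> \<Rightarrow> 0)"

definition strong_spatial_mixing :: "'v set \<Rightarrow> 'v rel \<Rightarrow> ('v \<Rightarrow> real) \<Rightarrow> bool" where
  "strong_spatial_mixing V E lam \<longleftrightarrow>
     (\<exists>\<delta> :: nat \<Rightarrow> real. (\<forall>l. \<delta> l \<ge> 0) \<and> \<delta> \<longlonglongrightarrow> 0 \<and>
        (\<forall>U v y z. finite U \<longrightarrow> U \<subseteq> V \<longrightarrow> v \<in> U \<longrightarrow>
           y \<in> indep_configs V E \<longrightarrow> z \<in> indep_configs V E \<longrightarrow>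
           \<bar>gibbs_spec V E lam U y (zero_event V E v) - gibbs_spec V E lam U z (zero_event V E v)\<bar>
             \<le> rate_at \<delta> (graph_dist E v (disagreement V U y z))))"


section \<open>Random pasts and the information function\<close>

text \<open>A point of \<open>({0,1}\<^sup>G)\<^sup>G\<close>, viewed as a map from \<open>G\<close> to the subsets of \<open>G\<close>.\<close>

definition past_set :: "('g, 'm) monoid_scheme \<Rightarrow> ('g \<Rightarrow> 'g \<Rightarrow> nat) \<Rightarrow> 'g \<Rightarrow> 'g set" where
  "past_set G \<Phi> g = {h \<in> carrier G. \<Phi> g h = 1}"

definition past_space :: "('g, 'm) monoid_scheme \<Rightarrow> ('g \<Rightarrow> 'g \<Rightarrow> nat) measure" where
  "past_space G = borel_of (product_topology (\<lambda>_. cube_topology (carrier G)) (carrier G))"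

text \<open>The last clause says that the random sets \<open>\<Phi> g\<close> and \<open>g \<cdot> \<Phi> 1\<close> (the latter given through
  its indicator function) have the same distribution. The translation is on the left because the
  group acts from the left, on the vertices and on configurations: what has to be invariant is
  the relative past \<open>g\<inverse> \<cdot> \<Phi> g\<close>. With \<open>\<Phi> 1 \<cdot> g\<close> in place of \<open>g \<cdot> \<Phi> 1\<close>, which is the same for
  abelian groups, the free energy formula fails for non-abelian groups: let \<open>S\<^sub>3\<close> act by left
  multiplication on its Cayley graph with respect to two transpositions (a hexagon), with
  activity 1, and consider the pasts of the random orders in which \<open>h\<close> precedes \<open>g\<close> iff
  \<open>h \<cdot> k < g \<cdot> k\<close>, for a suitable fixed linear order \<open><\<close> and uniformly distributed \<open>k\<close>.\<close>

definition invariant_random_past ::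
  "('g, 'm) monoid_scheme \<Rightarrow> ('g \<Rightarrow> 'g \<Rightarrow> nat) measure \<Rightarrow> bool" where
  "invariant_random_past G \<nu> \<longleftrightarrow>
     prob_space \<nu> \<and> sets \<nu> = sets (past_space G) \<and>
     (AE \<Phi> in \<nu>.
        (\<forall>g\<in>carrier G. g \<notin> past_set G \<Phi> g) \<and>
        (\<forall>g\<in>carrier G. \<forall>h\<in>carrier G.
           g \<in> past_set G \<Phi> h \<longrightarrow> past_set G \<Phi> g \<subseteq> past_set G \<Phi> h) \<and>
        (\<forall>g\<in>carrier G. \<forall>h\<in>carrier G.
           g \<noteq> h \<longrightarrow> g \<in> past_set G \<Phi> h \<or> h \<in> past_set G \<Phi> g)) \<and>
     (\<forall>g\<in>carrier G.
        distr \<nu> (borel_of (cube_topology (carrier G))) (\<lambda>\<Phi>. \<Phi> g) =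
        distr \<nu> (borel_of (cube_topology (carrier G)))
          (\<lambda>\<Phi>. \<lambda>h\<in>carrier G. of_bool (h \<in> g <#\<^bsub>G\<^esub> past_set G \<Phi> \<one>\<^bsub>G\<^esub>)))"

definition exhaustion :: "('g, 'm) monoid_scheme \<Rightarrow> (nat \<Rightarrow> 'g set) \<Rightarrow> bool" where
  "exhaustion G En \<longleftrightarrow> incseq En \<and> (\<forall>n. finite (En n)) \<and> (\<Union>n. En n) = carrier G"

text \<open>A Gibbs measure gives positive mass to every cylinder of an independent set over a finite
  set of vertices, so the logarithm is only ever taken of numbers in \<open>(0, 1]\<close>.\<close>

definition information ::
  "('g, 'm) monoid_scheme \<Rightarrow> 'v set \<Rightarrow> 'v rel \<Rightarrow> ('g \<Rightarrow> 'v \<Rightarrow> 'v) \<Rightarrow> 'v set \<Rightarrow> (nat \<Rightarrow> 'g set) \<Rightarrow>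
   ('v \<Rightarrow> nat) measure \<Rightarrow> ('v \<Rightarrow> nat) \<Rightarrow> ('g \<Rightarrow> 'g \<Rightarrow> nat) \<Rightarrow> ereal" where
  "information G V E act U\<^sub>0 En P x \<Phi> =
     limsup (\<lambda>n. ereal (- (1 / real (card (orbits G V act))) *
       ln (cond_prob P (\<lambda>x'. x' \<in> cylinder V E x U\<^sub>0)
             (\<lambda>x'. x' \<in> cylinder V E x
                (translates act (past_set G \<Phi> \<one>\<^bsub>G\<^esub> \<inter> En n) U\<^sub>0)))))"

text \<open>The information function is nonnegative, so its expectation is defined in \<open>[0, \<infinity>]\<close>.\<close>

definition expected_information ::
  "('g, 'm) monoid_scheme \<Rightarrow> 'v set \<Rightarrow> 'v rel \<Rightarrow> ('g \<Rightarrow> 'v \<Rightarrow> 'v) \<Rightarrow> 'v set \<Rightarrow> (nat \<Rightarrow> 'g set) \<Rightarrow>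
   ('v \<Rightarrow> nat) measure \<Rightarrow> ('g \<Rightarrow> 'g \<Rightarrow> nat) measure \<Rightarrow> ('v \<Rightarrow> nat) \<Rightarrow> ennreal" where
  "expected_information G V E act U\<^sub>0 En P \<nu> x =
     (\<integral>\<^sup>+\<Phi>. e2ennreal (information G V E act U\<^sub>0 En P x \<Phi>) \<partial>\<nu>)"

end

theory Submission
  imports Defs
begin

text \<open>
  The formula is the chain rule for conditional probabilities, averaged over a random order. Let \<open>F\<close> be
  a finite subset of \<open>G\<close>, and reveal a configuration \<open>x\<close> on the translates \<open>g U\<^sub>0\<close>, \<open>g \<in> F\<close>, in the order
  given by a sample of the random past. Then \<open>- ln P[x on F U\<^sub>0]\<close> is the sum over \<open>g \<in> F\<close> of the
  conditional information of \<open>x\<close> on \<open>g U\<^sub>0\<close> given the part of the past of \<open>g\<close> in \<open>F\<close>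
  (\<open>chain_rule\<close>). The Gibbs measure is invariant (\<open>pr_automorphism\<close>) and the law of the past is
  equivariant (\<open>past_shift_expectation\<close>), so the mean of the summand for \<open>g\<close> is the information of
  \<open>g\<inverse> x\<close> on \<open>U\<^sub>0\<close> given the part in \<open>g\<inverse>F\<close> of the past of the identity.

  Strong spatial mixing makes this truncation harmless. A Gibbs measure conditioned on a pattern near a
  vertex is an average of the specification over boundary conditions that differ only far away; hence
  conditional probabilities depend, uniformly in \<open>x\<close>, only on the nearby part of the condition
  (\<open>cpr_local\<close>). They are bounded away from 0 for independent configurations, so the information is
  bounded, and it converges uniformly as more of the past is revealed (\<open>limit_info_approx\<close>). The same
  comparison shows that the conditional probabilities are determined by the specification, which is
  why the Gibbs measure is invariant.

  On the other hand, up to an error of the order of the boundary of \<open>F\<close>, the probability of \<open>x\<close> on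
  \<open>F U\<^sub>0\<close> is its weight divided by \<open>Z (F U\<^sub>0)\<close> (\<open>cylinder_energy\<close>). Both descriptions together
  say that the sum over \<open>g \<in> F\<close> of mean information plus energy at \<open>g\<inverse> x\<close> equals \<open>ln Z (F U\<^sub>0)\<close> up to
  \<open>\<epsilon> |F|\<close> and a boundary term (\<open>average_info_energy\<close>). Integrate over the invariant measure \<open>Q\<close>, divide by
  \<open>|F|\<close>, and let \<open>F\<close> run through a right Foelner sequence: the integral of mean information plus
  energy is the limit of \<open>ln Z (F U\<^sub>0) / |F|\<close>.

  It remains to see that this limit is the infimum over all finite \<open>F\<close> in the definition of the free energy.
  This follows from an inequality of Shearer type, \<open>Z (F)\<^sup>k \<le> (\<Prod>i. Z (F \<inter> S\<^sub>i))\<close> for \<open>k\<close>-fold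
  covers (\<open>partition_shearer\<close>), which is a consequence of Finner's inequality, applied to
  the translates of a fixed finite set (\<open>infimum_rule\<close>). The formula for the empty configuration is
  the case of the unit mass at that configuration.
\<close>

section \<open>Finner's inequality and partition functions\<close>

lemma sum_Pow_insert:
  fixes f :: "'v set \<Rightarrow> real"
  assumes "finite F" "v \<notin> F"
  shows "(\<Sum>A\<in>Pow (insert v F). f A) = (\<Sum>A\<in>Pow F. f A) + (\<Sum>A\<in>Pow F. f (insert v A))"
proof -
  have "inj_on (insert v) (Pow F)"
    using assms(2) by (auto simp: inj_on_def)
  moreover have "Pow F \<inter> insert v ` Pow F = {}"
    using assms(2) by auto
  ultimately show ?thesis
    using assms(1) by (simp add: Pow_insert sum.union_disjoint sum.reindex)
qed

text \<open>Hoelder's inequality for sums of two terms, all exponents being equal; after dividing by the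
  right hand side it is the arithmetic-geometric mean inequality.\<close>

lemma two_term_holder:
  fixes a b :: "'i \<Rightarrow> real"
  assumes J: "finite J" "J \<noteq> {}"
    and a: "\<And>i. i \<in> J \<Longrightarrow> 0 \<le> a i" and b: "\<And>i. i \<in> J \<Longrightarrow> 0 \<le> b i"
  defines "p \<equiv> 1 / real (card J)"
  shows "(\<Prod>i\<in>J. a i) powr p + (\<Prod>i\<in>J. b i) powr p \<le> (\<Prod>i\<in>J. a i + b i) powr p"
proof (cases "\<exists>i\<in>J. a i + b i = 0")
  case True
  then obtain i where "i \<in> J" "a i = 0" "b i = 0"
    using a b by (metis add_nonneg_eq_0_iff)
  then have "(\<Prod>i\<in>J. a i) = 0" "(\<Prod>i\<in>J. b i) = 0" "(\<Prod>i\<in>J. a i + b i) = 0"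
    using J(1) by (auto intro!: prod_zero bexI[of _ i])
  then show ?thesis by simp
next
  case False
  then have s: "0 < a i + b i" if "i \<in> J" for i
    using a[OF that] b[OF that] that by (metis add_nonneg_nonneg order_le_less)
  have split: "(\<Prod>i\<in>J. c i) powr p \<le> (\<Sum>i\<in>J. c i / (a i + b i) / card J) * (\<Prod>i\<in>J. a i + b i) powr p"
    if c: "\<And>i. i \<in> J \<Longrightarrow> 0 \<le> c i" for c
  proof -
    have "(\<Prod>i\<in>J. c i) = (\<Prod>i\<in>J. c i / (a i + b i)) * (\<Prod>i\<in>J. a i + b i)"
      unfolding prod.distrib[symmetric] using s by (intro prod.cong) (auto simp: less_le)
    then have "(\<Prod>i\<in>J. c i) powr p = (\<Prod>i\<in>J. c i / (a i + b i)) powr p * (\<Prod>i\<in>J. a i + b i) powr p"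
      using c s by (simp add: powr_mult prod_nonneg less_imp_le)
    also have "(\<Prod>i\<in>J. c i / (a i + b i)) powr p \<le> (\<Sum>i\<in>J. c i / (a i + b i) / card J)"
      unfolding p_def using J c s by (intro arith_geom_mean) (auto simp: less_imp_le)
    finally show ?thesis by (simp add: mult_right_mono)
  qed
  have "(\<Sum>i\<in>J. a i / (a i + b i) / card J) + (\<Sum>i\<in>J. b i / (a i + b i) / card J) = (\<Sum>i\<in>J. 1 / card J)"
    unfolding sum.distrib[symmetric] using s
    by (intro sum.cong) (auto simp: add_divide_distrib[symmetric] less_le)
  also have "\<dots> = 1" using J by simp
  finally have one: "(\<Sum>i\<in>J. a i / (a i + b i) / card J) + (\<Sum>i\<in>J. b i / (a i + b i) / card J) = 1" .
  have "(\<Prod>i\<in>J. a i) powr p + (\<Prod>i\<in>J. b i) powr p \<le>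
      ((\<Sum>i\<in>J. a i / (a i + b i) / card J) + (\<Sum>i\<in>J. b i / (a i + b i) / card J)) * (\<Prod>i\<in>J. a i + b i) powr p"
    unfolding distrib_right using split[of a] split[of b] a b by (intro add_mono) auto
  then show ?thesis unfolding one by simp
qed

text \<open>Finner's extension of the Loomis--Whitney inequality. Adding a vertex \<open>v\<close> splits every sum in two,
  according to whether \<open>v\<close> is used; only the \<open>k\<close> factors whose set contains \<open>v\<close> change, and the
  two-term inequality for exactly these \<open>k\<close> factors recombines the halves.\<close>

lemma finner_inequality:
  fixes g :: "'i \<Rightarrow> 'v set \<Rightarrow> real"
  assumes "finite F" and I: "finite I" and k: "0 < k"
    and cover: "\<And>v. v \<in> F \<Longrightarrow> card {i \<in> I. v \<in> S i} = k"
    and nonneg: "\<And>i B. i \<in> I \<Longrightarrow> 0 \<le> g i B"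
  shows "(\<Sum>A\<in>Pow F. (\<Prod>i\<in>I. g i (A \<inter> S i)) powr (1 / real k))
    \<le> (\<Prod>i\<in>I. \<Sum>B\<in>Pow (F \<inter> S i). g i B) powr (1 / real k)"
  using assms(1) cover nonneg
proof (induction F arbitrary: g rule: finite_induct)
  case empty
  then show ?case by simp
next
  case (insert v F)
  define p where "p = 1 / real k"
  \<comment> \<open>The functions \<open>g\<close> and \<open>g1\<close> are the factors when \<open>v\<close> is unused and used, respectively.\<close>
  define J where "J = {i \<in> I. v \<in> S i}"
  have J: "finite J" "card J = k" "J \<subseteq> I" "J \<noteq> {}"
    using I insert.prems(1)[of v] k by (auto simp: J_def card_gt_0_iff)
  define g1 where "g1 i B = g i (if i \<in> J then insert v B else B)" for i B
  define s0 where "s0 i = (\<Sum>B\<in>Pow (F \<inter> S i). g i B)" for i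
  define s1 where "s1 i = (\<Sum>B\<in>Pow (F \<inter> S i). g1 i B)" for i
  have fin: "finite (F \<inter> S i)" for i using insert.hyps by simp
  have nn: "0 \<le> s0 i" "0 \<le> s1 i" if "i \<in> I" for i
    using insert.prems(2)[OF that] by (auto simp: s0_def s1_def g1_def intro!: sum_nonneg)
  have "(\<Sum>A\<in>Pow (insert v F). (\<Prod>i\<in>I. g i (A \<inter> S i)) powr p)
      = (\<Sum>A\<in>Pow F. (\<Prod>i\<in>I. g i (A \<inter> S i)) powr p)
        + (\<Sum>A\<in>Pow F. (\<Prod>i\<in>I. g1 i (A \<inter> S i)) powr p)"
  proof (subst sum_Pow_insert)
    show "finite F" "v \<notin> F" by fact+
    have "g i (insert v A \<inter> S i) = g1 i (A \<inter> S i)" if "i \<in> I" for i A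
      using that by (auto simp: g1_def J_def)
    then show "(\<Sum>A\<in>Pow F. (\<Prod>i\<in>I. g i (A \<inter> S i)) powr p)
        + (\<Sum>A\<in>Pow F. (\<Prod>i\<in>I. g i (insert v A \<inter> S i)) powr p)
      = (\<Sum>A\<in>Pow F. (\<Prod>i\<in>I. g i (A \<inter> S i)) powr p)
        + (\<Sum>A\<in>Pow F. (\<Prod>i\<in>I. g1 i (A \<inter> S i)) powr p)" by simp
  qed
  also have "\<dots> \<le> (\<Prod>i\<in>I. s0 i) powr p + (\<Prod>i\<in>I. s1 i) powr p"
    unfolding p_def s0_def s1_def using insert.prems
    by (intro add_mono insert.IH) (auto simp: g1_def)
  also have "\<dots> = (\<Prod>i\<in>I-J. s0 i) powr p * ((\<Prod>i\<in>J. s0 i) powr p + (\<Prod>i\<in>J. s1 i) powr p)"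
  proof -
    have "(\<Prod>i\<in>I-J. s1 i) = (\<Prod>i\<in>I-J. s0 i)"
      by (intro prod.cong) (auto simp: s0_def s1_def g1_def)
    then show ?thesis
      using prod.subset_diff[OF J(3) I, of s0] prod.subset_diff[OF J(3) I, of s1] nn J(3)
      by (simp add: powr_mult prod_nonneg subset_iff distrib_left)
  qed
  also have "\<dots> \<le> (\<Prod>i\<in>I-J. s0 i) powr p * (\<Prod>i\<in>J. s0 i + s1 i) powr p"
  proof (rule mult_left_mono)
    show "(\<Prod>i\<in>J. s0 i) powr p + (\<Prod>i\<in>J. s1 i) powr p \<le> (\<Prod>i\<in>J. s0 i + s1 i) powr p"
      using two_term_holder[OF J(1,4), of s0 s1] nn J(2,3) by (auto simp: p_def)
  qed simp
  also have "\<dots> = (\<Prod>i\<in>I. \<Sum>B\<in>Pow (insert v F \<inter> S i). g i B) powr p"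
  proof -
    have "(\<Sum>B\<in>Pow (insert v F \<inter> S i). g i B) = s0 i + s1 i" if "i \<in> J" for i
    proof -
      have "insert v F \<inter> S i = insert v (F \<inter> S i)" using that by (auto simp: J_def)
      then show ?thesis
        using that insert.hyps by (simp add: sum_Pow_insert[OF fin] s0_def s1_def g1_def)
    qed
    moreover have "(\<Sum>B\<in>Pow (insert v F \<inter> S i). g i B) = s0 i" if "i \<in> I - J" for i
    proof -
      have "insert v F \<inter> S i = F \<inter> S i" using that by (auto simp: J_def)
      then show ?thesis by (simp add: s0_def)
    qed
    ultimately have "(\<Prod>i\<in>I. \<Sum>B\<in>Pow (insert v F \<inter> S i). g i B)
      = (\<Prod>i\<in>I-J. s0 i) * (\<Prod>i\<in>J. s0 i + s1 i)"
      by (subst prod.subset_diff[OF J(3) I]) simp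
    then show ?thesis using nn J(3) by (simp add: powr_mult prod_nonneg subset_iff)
  qed
  finally show ?case by (simp add: p_def)
qed


text \<open>Independent sets are handled as subsets here and as 0-1 valued functions in the definition of the
  partition function; the subset form suits inductions over the vertex set.\<close>

definition hardcore_weight :: "'v rel \<Rightarrow> ('v \<Rightarrow> real) \<Rightarrow> 'v set \<Rightarrow> real" where
  "hardcore_weight E lam A = (if \<forall>(u, v)\<in>E. \<not> (u \<in> A \<and> v \<in> A) then \<Prod>v\<in>A. lam v else 0)"

locale hardcore =
  fixes V :: "'v set" and E :: "'v rel" and lam :: "'v \<Rightarrow> real"
  assumes model: "hardcore_model V E lam" and lf: "locally_finite_graph V E"
begin

abbreviation Conf :: "('v \<Rightarrow> nat) set" where "Conf \<equiv> indep_configs V E"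
abbreviation Z :: "'v set \<Rightarrow> real" where "Z \<equiv> partition_fun V E lam"
abbreviation wt :: "'v set \<Rightarrow> ('v \<Rightarrow> nat) \<Rightarrow> real" where
  "wt U x \<equiv> \<Prod>v\<in>U. lam v ^ x v"

lemma lam_pos: "v \<in> V \<Longrightarrow> 0 < lam v"
  and edge_V: "(u, v) \<in> E \<Longrightarrow> u \<in> V \<and> v \<in> V"
  and edge_sym: "(u, v) \<in> E \<Longrightarrow> (v, u) \<in> E"
  using model by (auto simp: hardcore_model_def graph_def sym_def)

lemma config_cases: "x \<in> Conf \<Longrightarrow> v \<in> V \<Longrightarrow> x v = 0 \<or> x v = 1"
  by (auto simp: indep_configs_def PiE_iff)

lemma config_edge: "x \<in> Conf \<Longrightarrow> (u, v) \<in> E \<Longrightarrow> x u = 1 \<Longrightarrow> x v = 0"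
  using edge_V[of u v] config_cases[of x v] by (auto simp: indep_configs_def)

lemma wt_pos: "U \<subseteq> V \<Longrightarrow> 0 < wt U x"
  by (intro prod_pos) (auto simp: lam_pos)

lemma config_of_set: "(\<lambda>v\<in>V. of_bool (v \<in> A)) \<in> Conf" if "\<forall>(u, v)\<in>E. \<not> (u \<in> A \<and> v \<in> A)"
  using that edge_V by (auto simp: indep_configs_def restrict_def split: if_splits)

lemma partition_eq_sum_subsets:
  assumes "finite U" "U \<subseteq> V"
  shows "Z U = (\<Sum>A\<in>Pow U. hardcore_weight E lam A)"
proof -
  let ?I = "\<lambda>A. \<forall>(u, v)\<in>E. \<not> (u \<in> A \<and> v \<in> A)"
  have "Z U = (\<Sum>A\<in>{A \<in> Pow U. ?I A}. \<Prod>v\<in>A. lam v)"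
    unfolding partition_fun_def
  proof (rule sum.reindex_bij_witness[where i = "\<lambda>A. \<lambda>v\<in>V. of_bool (v \<in> A)" and j = "\<lambda>x. {v \<in> U. x v = 1}"])
    fix x assume x: "x \<in> {x \<in> Conf. \<forall>v\<in>V - U. x v = 0}"
    show "(\<lambda>v\<in>V. of_bool (v \<in> {v \<in> U. x v = 1})) = x"
    proof
      fix v show "(\<lambda>v\<in>V. of_bool (v \<in> {v \<in> U. x v = 1})) v = x v"
        using x config_cases[of x v] by (cases "v \<in> V") (auto simp: indep_configs_def PiE_iff extensional_def)
    qed
    show "{v \<in> U. x v = 1} \<in> {A \<in> Pow U. ?I A}"
      using x by (auto simp: indep_configs_def)
    have "wt U x = (\<Prod>v\<in>U. if x v = 1 then lam v else 1)"
    proof (intro prod.cong refl)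
      fix v assume "v \<in> U"
      then have "x v = 0 \<or> x v = 1" using x assms(2) config_cases[of x v] by auto
      then show "lam v ^ x v = (if x v = 1 then lam v else 1)" by auto
    qed
    also have "\<dots> = (\<Prod>v\<in>{v \<in> U. x v = 1}. lam v)"
      using assms(1) by (simp add: prod.inter_filter)
    finally show "(\<Prod>v\<in>{v \<in> U. x v = 1}. lam v) = wt U x" ..
  next
    fix A assume A: "A \<in> {A \<in> Pow U. ?I A}"
    show "{v \<in> U. (\<lambda>v\<in>V. of_bool (v \<in> A)) v = (1::nat)} = A"
      using A assms(2) by auto
    have "(\<lambda>v\<in>V. of_bool (v \<in> A)) \<in> Conf"
      using A by (intro config_of_set) auto
    then show "(\<lambda>v\<in>V. of_bool (v \<in> A)) \<in> {x \<in> Conf. \<forall>v\<in>V - U. x v = 0}"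
      using A by auto
  qed
  also have "\<dots> = (\<Sum>A\<in>Pow U. hardcore_weight E lam A)"
    unfolding hardcore_weight_def using assms(1) by (intro sum.inter_filter) simp
  finally show ?thesis .
qed

lemma hardcore_weight_nonneg: "A \<subseteq> V \<Longrightarrow> 0 \<le> hardcore_weight E lam A"
  by (auto simp: hardcore_weight_def intro!: prod_nonneg less_imp_le[OF lam_pos])

lemma partition_ge_1:
  assumes "finite U" "U \<subseteq> V" shows "1 \<le> Z U"
proof -
  have "hardcore_weight E lam {} \<le> (\<Sum>A\<in>Pow U. hardcore_weight E lam A)"
    using assms by (intro member_le_sum) (auto intro!: hardcore_weight_nonneg)
  then show ?thesis using assms by (simp add: partition_eq_sum_subsets hardcore_weight_def)
qed

lemma partition_pos: "finite U \<Longrightarrow> U \<subseteq> V \<Longrightarrow> 0 < Z U"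
  using partition_ge_1[of U] by simp

lemma partition_le_prod:
  assumes "finite U" "U \<subseteq> V" shows "Z U \<le> (\<Prod>v\<in>U. 1 + lam v)"
proof -
  have "Z U \<le> (\<Sum>A\<in>Pow U. \<Prod>v\<in>A. lam v)"
    unfolding partition_eq_sum_subsets[OF assms] using assms(2)
    by (intro sum_mono) (auto simp: hardcore_weight_def intro!: prod_nonneg less_imp_le[OF lam_pos])
  also have "\<dots> = (\<Prod>v\<in>U. lam v + 1)"
    by (simp add: prod_add[OF assms(1)])
  finally show ?thesis by (simp add: add.commute)
qed

text \<open>A Shearer-type inequality for partition functions: the hardcore weight of a set is the \<open>k\<close>-th root
  of the product of its weights inside the members of a \<open>k\<close>-fold cover, or is smaller, since an edge
  may lie in no member. It provides both the subadditivity of \<open>ln \<circ> Z\<close> and the infimum rule for the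
  free energy.\<close>

lemma partition_shearer:
  assumes F: "finite F" "F \<subseteq> V" and I: "finite I" and k: "0 < k"
    and cover: "\<And>v. v \<in> F \<Longrightarrow> card {i \<in> I. v \<in> S i} = k"
  shows "real k * ln (Z F) \<le> (\<Sum>i\<in>I. ln (Z (F \<inter> S i)))"
proof -
  let ?g = "\<lambda>i B. if B \<subseteq> V then hardcore_weight E lam B else 0"
  have FS: "finite (F \<inter> S i)" "F \<inter> S i \<subseteq> V" for i using F by auto
  have "Z F \<le> (\<Sum>A\<in>Pow F. (\<Prod>i\<in>I. ?g i (A \<inter> S i)) powr (1 / real k))"
    unfolding partition_eq_sum_subsets[OF F]
  proof (rule sum_mono)
    fix A assume A: "A \<in> Pow F"
    then have AV: "A \<subseteq> V" and finA: "finite A" using F finite_subset by auto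
    show "hardcore_weight E lam A \<le> (\<Prod>i\<in>I. ?g i (A \<inter> S i)) powr (1 / real k)"
    proof (cases "\<forall>(u, v)\<in>E. \<not> (u \<in> A \<and> v \<in> A)")
      case True
      have "(\<Prod>i\<in>I. ?g i (A \<inter> S i)) = (\<Prod>i\<in>I. \<Prod>v\<in>A. if v \<in> S i then lam v else 1)"
        using True AV finA
        by (intro prod.cong refl) (auto simp: hardcore_weight_def prod.If_cases)
      also have "\<dots> = (\<Prod>v\<in>A. \<Prod>i\<in>I. if v \<in> S i then lam v else 1)"
        by (rule prod.swap)
      also have "\<dots> = (\<Prod>v\<in>A. lam v ^ k)"
      proof (rule prod.cong[OF refl])
        fix v assume "v \<in> A"
        then have "card {i \<in> I. v \<in> S i} = k" using A by (intro cover) auto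
        then show "(\<Prod>i\<in>I. if v \<in> S i then lam v else 1) = lam v ^ k"
          using I by (simp add: prod.inter_filter[symmetric])
      qed
      also have "\<dots> = hardcore_weight E lam A powr real k"
        using True AV k by (subst powr_realpow')
          (auto simp: hardcore_weight_def prod_power_distrib intro!: prod_nonneg less_imp_le[OF lam_pos])
      finally show ?thesis
        using k hardcore_weight_nonneg[OF AV] by (simp add: powr_powr)
    next
      case False
      then have "hardcore_weight E lam A = 0" unfolding hardcore_weight_def by (rule if_not_P)
      then show ?thesis by (simp only: powr_ge_zero)
    qed
  qed
  also have "\<dots> \<le> (\<Prod>i\<in>I. \<Sum>B\<in>Pow (F \<inter> S i). ?g i B) powr (1 / real k)"
    using F(1) I k cover by (rule finner_inequality) (auto intro: hardcore_weight_nonneg)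
  also have "(\<Prod>i\<in>I. \<Sum>B\<in>Pow (F \<inter> S i). ?g i B) = (\<Prod>i\<in>I. Z (F \<inter> S i))"
    unfolding partition_eq_sum_subsets[OF FS] using F(2)
    by (intro prod.cong sum.cong) auto
  finally have "ln (Z F) \<le> ln ((\<Prod>i\<in>I. Z (F \<inter> S i)) powr (1 / real k))"
    using partition_pos[OF F] by (intro ln_mono)
  also have "\<dots> = (1 / real k) * (\<Sum>i\<in>I. ln (Z (F \<inter> S i)))"
    using partition_pos[OF FS] I by (simp add: ln_powr ln_prod prod_pos less_imp_neq[symmetric])
  finally show ?thesis using k by (simp add: field_simps)
qed

lemma partition_subadditive:
  assumes "finite A" "finite B" "A \<subseteq> V" "B \<subseteq> V" "A \<inter> B = {}"
  shows "Z (A \<union> B) \<le> Z A * Z B"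
proof -
  let ?S = "\<lambda>i. if i then A else B"
  have "card {i \<in> UNIV. v \<in> ?S i} = 1" if "v \<in> A \<union> B" for v
  proof -
    have "{i \<in> UNIV. v \<in> ?S i} = {v \<in> A}"
      using that assms(5) by (auto split: if_splits)
    then show ?thesis by simp
  qed
  from partition_shearer[where k = 1 and I = UNIV and S = ?S and F = "A \<union> B", OF _ _ _ _ this] assms
  have "ln (Z (A \<union> B)) \<le> ln (Z ((A \<union> B) \<inter> A)) + ln (Z ((A \<union> B) \<inter> B))"
    by (simp add: UNIV_bool)
  moreover have "(A \<union> B) \<inter> A = A" "(A \<union> B) \<inter> B = B" by auto
  ultimately have "ln (Z (A \<union> B)) \<le> ln (Z A * Z B)"
    using partition_pos[of A] partition_pos[of B] assms by (simp add: ln_mult)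
  then show ?thesis
    using partition_pos[of A] partition_pos[of B] partition_pos[of "A \<union> B"] assms by simp
qed

end

section \<open>Borel sets of topologies\<close>

lemma space_borel_of [simp]: "space (borel_of T) = topspace T"
  unfolding borel_of_def by (rule space_measure_of) (auto dest: openin_subset)

lemma sets_borel_of: "sets (borel_of T) = sigma_sets (topspace T) {U. openin T U}"
  unfolding borel_of_def by (rule sets_measure_of) (auto dest: openin_subset)

lemma openin_sets_borel_of: "openin T U \<Longrightarrow> U \<in> sets (borel_of T)"
  by (auto simp: sets_borel_of)

lemma continuous_map_measurable:
  assumes "continuous_map S T f" shows "f \<in> measurable (borel_of S) (borel_of T)"
  unfolding borel_of_def[of T]
proof (rule measurable_measure_of)
  show "{U. openin T U} \<subseteq> Pow (topspace T)" by (auto dest: openin_subset)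
  show "f \<in> space (borel_of S) \<rightarrow> topspace T"
    using assms by (auto simp: continuous_map_def)
  show "f -` U \<inter> space (borel_of S) \<in> sets (borel_of S)" if "U \<in> {U. openin T U}" for U
  proof -
    have "f -` U \<inter> space (borel_of S) = {x \<in> topspace S. f x \<in> U}" by auto
    then show ?thesis
      using openin_continuous_map_preimage[OF assms, of U] that by (simp add: openin_sets_borel_of)
  qed
qed

lemma topspace_cube [simp]: "topspace (cube_topology I) = I \<rightarrow>\<^sub>E {0, 1}"
  by (simp add: cube_topology_def)

lemma continuous_map_cube_coordinate:
  "i \<in> I \<Longrightarrow> continuous_map (cube_topology I) (discrete_topology {0, 1}) (\<lambda>x. x i)"
  unfolding cube_topology_def by (rule continuous_map_product_projection)

section \<open>The Gibbs specification\<close>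

context hardcore
begin

text \<open>The values of \<open>x\<close> inside \<open>U\<close> and those of \<open>y\<close> outside. With \<^term>\<open>empty_config V\<close> in place of
  \<open>y\<close> or \<open>x\<close> this clears a configuration off \<open>U\<close> or on \<open>U\<close>.\<close>

definition glue :: "'v set \<Rightarrow> ('v \<Rightarrow> nat) \<Rightarrow> ('v \<Rightarrow> nat) \<Rightarrow> 'v \<Rightarrow> nat" where
  "glue U x y = (\<lambda>v\<in>V. if v \<in> U then x v else y v)"

definition boundary_sum :: "'v set \<Rightarrow> ('v \<Rightarrow> nat) \<Rightarrow> real" where
  "boundary_sum U y = (\<Sum>x\<in>boundary_configs V E U y. wt U x)"

lemma glue_config:
  assumes x: "x \<in> Conf" and y: "y \<in> Conf"
    and e: "\<And>u v. (u, v) \<in> E \<Longrightarrow> u \<in> U \<Longrightarrow> v \<notin> U \<Longrightarrow> x u = 1 \<Longrightarrow> y v = 0"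
  shows "glue U x y \<in> Conf"
proof -
  have "\<not> (glue U x y u = 1 \<and> glue U x y v = 1)" if uv: "(u, v) \<in> E" for u v
    using edge_V[OF uv] edge_sym[OF uv] uv e[OF uv] e[of v u] config_edge[OF x uv] config_edge[OF y uv]
    by (auto simp: glue_def split: if_splits)
  moreover have "glue U x y \<in> V \<rightarrow>\<^sub>E {0, 1}"
    using x y by (auto simp: indep_configs_def glue_def PiE_iff)
  ultimately show ?thesis by (auto simp: indep_configs_def)
qed

lemma zero_config: "empty_config V \<in> Conf"
  using edge_V by (auto simp: indep_configs_def empty_config_def)

lemma glue_zero_config: "x \<in> Conf \<Longrightarrow> glue U x (empty_config V) \<in> Conf"
  "x \<in> Conf \<Longrightarrow> glue U (empty_config V) x \<in> Conf"
  using edge_V by (auto intro!: glue_config zero_config) (auto simp: empty_config_def)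

lemma config_eqI: "x \<in> Conf \<Longrightarrow> y \<in> Conf \<Longrightarrow> (\<And>v. v \<in> V \<Longrightarrow> x v = y v) \<Longrightarrow> x = y"
  by (auto simp: indep_configs_def intro: PiE_ext)

lemma boundary_configs_sub: "boundary_configs V E U y \<subseteq> Conf"
  by (auto simp: boundary_configs_def)

lemma inj_on_glue_zero: "inj_on (\<lambda>x. glue U x (empty_config V)) (boundary_configs V E U y)"
proof (rule inj_onI)
  fix x x' assume a: "x \<in> boundary_configs V E U y" "x' \<in> boundary_configs V E U y"
    and eq: "glue U x (empty_config V) = glue U x' (empty_config V)"
  show "x = x'"
  proof (rule config_eqI)
    fix v assume "v \<in> V"
    then show "x v = x' v"
      using a fun_cong[OF eq, of v] by (cases "v \<in> U") (auto simp: glue_def boundary_configs_def)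
  qed (use a in \<open>auto simp: boundary_configs_def\<close>)
qed

lemma partition_eq_boundary_sum: "Z U = boundary_sum U (empty_config V)"
  unfolding partition_fun_def boundary_sum_def boundary_configs_def empty_config_def
  by (intro sum.cong) auto

lemma finite_boundary_configs:
  assumes "finite U" shows "finite (boundary_configs V E U y)"
proof (rule finite_imageD[OF finite_subset])
  show "(\<lambda>x. {v \<in> U. x v = 1}) ` boundary_configs V E U y \<subseteq> Pow U" by auto
  show "inj_on (\<lambda>x. {v \<in> U. x v = 1}) (boundary_configs V E U y)"
  proof (rule inj_onI)
    fix x x' assume a: "x \<in> boundary_configs V E U y" "x' \<in> boundary_configs V E U y"
      and eq: "{v \<in> U. x v = 1} = {v \<in> U. x' v = 1}"
    show "x = x'"
    proof (rule config_eqI)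
      fix v assume "v \<in> V"
      then have c: "x v = 0 \<or> x v = 1" "x' v = 0 \<or> x' v = 1"
        using a config_cases by (auto simp: boundary_configs_def)
      have "v \<in> U \<Longrightarrow> (x v = 1) = (x' v = 1)" using eq by auto
      then show "x v = x' v"
        using a c \<open>v \<in> V\<close> by (cases "v \<in> U") (auto simp: boundary_configs_def)
    qed (use a in \<open>auto simp: boundary_configs_def\<close>)
  qed
qed (use assms in simp)

text \<open>A boundary condition only forbids configurations: clearing a configuration outside \<open>U\<close> keeps it
  independent and keeps its weight.\<close>

lemma boundary_sum_le_partition:
  assumes U: "finite U" "U \<subseteq> V" and y: "y \<in> Conf"
  shows "boundary_sum U y \<le> Z U"
proof -
  let ?f = "\<lambda>x. glue U x (empty_config V)"
  have "boundary_sum U y = (\<Sum>x\<in>boundary_configs V E U y. wt U (?f x))"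
    unfolding boundary_sum_def using U by (intro sum.cong prod.cong refl) (auto simp: glue_def)
  also have "\<dots> = (\<Sum>x\<in>?f ` boundary_configs V E U y. wt U x)"
    by (subst sum.reindex[OF inj_on_glue_zero]) simp
  also have "\<dots> \<le> boundary_sum U (empty_config V)"
    unfolding boundary_sum_def
  proof (rule sum_mono2)
    show "finite (boundary_configs V E U (empty_config V))" by (rule finite_boundary_configs[OF U(1)])
    show "?f ` boundary_configs V E U y \<subseteq> boundary_configs V E U (empty_config V)"
      using glue_zero_config(1) by (auto simp: boundary_configs_def) (auto simp: glue_def)
    show "\<And>x. 0 \<le> wt U x" using wt_pos[OF U(2)] by (simp add: less_imp_le)
  qed
  finally show ?thesis by (simp add: partition_eq_boundary_sum)
qed

text \<open>A configuration supported on vertices of \<open>U\<close> without neighbours outside \<open>U\<close> is compatible with every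
  boundary condition. Hence a boundary condition changes the partition function at most by the
  contribution of the boundary layer \<open>D\<close>.\<close>

lemma partition_interior_le_boundary_sum:
  assumes U: "finite U" "U \<subseteq> V" and y: "y \<in> Conf" and D: "D \<subseteq> U"
    and int: "\<And>u v. u \<in> U - D \<Longrightarrow> (u, v) \<in> E \<Longrightarrow> v \<in> U"
  shows "Z (U - D) \<le> boundary_sum U y"
proof -
  let ?f = "\<lambda>x. glue U x y"
  let ?S = "boundary_configs V E (U - D) (empty_config V)"
  have off: "x v = 0" if "x \<in> ?S" "v \<in> V" "v \<notin> U - D" for x v
    using that by (auto simp: boundary_configs_def empty_config_def)
  have "Z (U - D) = (\<Sum>x\<in>?S. wt U (?f x))"
    unfolding partition_eq_boundary_sum boundary_sum_def
  proof (rule sum.cong[OF refl])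
    fix x assume x: "x \<in> ?S"
    have "wt U (?f x) = wt U x"
      using U by (intro prod.cong refl) (auto simp: glue_def)
    also have "\<dots> = wt (U - D) x"
      using U D off[OF x] by (intro prod.mono_neutral_right) auto
    finally show "wt (U - D) x = wt U (?f x)" ..
  qed
  also have "\<dots> = (\<Sum>x\<in>?f ` ?S. wt U x)"
  proof (subst sum.reindex)
    show "inj_on ?f ?S"
    proof (rule inj_onI)
      fix x x' assume a: "x \<in> ?S" "x' \<in> ?S" and eq: "?f x = ?f x'"
      show "x = x'"
      proof (rule config_eqI)
        fix v assume v: "v \<in> V"
        show "x v = x' v"
          using off[OF a(1) v] off[OF a(2) v] fun_cong[OF eq, of v] v
          by (cases "v \<in> U") (auto simp: glue_def)
      qed (use a in \<open>auto simp: boundary_configs_def\<close>)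
    qed
  qed simp
  also have "\<dots> \<le> boundary_sum U y"
    unfolding boundary_sum_def
  proof (rule sum_mono2)
    show "finite (boundary_configs V E U y)" by (rule finite_boundary_configs[OF U(1)])
    show "?f ` ?S \<subseteq> boundary_configs V E U y"
    proof safe
      fix x assume x: "x \<in> ?S"
      have "?f x \<in> Conf"
      proof (rule glue_config)
        show "x \<in> Conf" using x boundary_configs_sub by auto
        fix u v assume "(u, v) \<in> E" "u \<in> U" "v \<notin> U" "x u = 1"
        then show "y v = 0" using off[OF x, of u] int[of u v] U by fastforce
      qed (rule y)
      then show "?f x \<in> boundary_configs V E U y"
        by (auto simp: boundary_configs_def glue_def)
    qed
    show "\<And>x. 0 \<le> wt U x" using wt_pos[OF U(2)] by (simp add: less_imp_le)
  qed
  finally show ?thesis .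
qed

lemma partition_empty: "Z {} = 1"
  by (simp add: partition_eq_sum_subsets hardcore_weight_def)

lemma boundary_sum_pos:
  assumes "finite U" "U \<subseteq> V" "y \<in> Conf" shows "0 < boundary_sum U y"
  using partition_interior_le_boundary_sum[OF assms, of U] partition_empty by simp

text \<open>At most one configuration has boundary condition \<open>y\<close> and agrees with \<open>x\<close> on \<open>U\<close>.\<close>

lemma gibbs_spec_cylinder_le:
  assumes U: "finite U" "U \<subseteq> V" and y: "y \<in> Conf" and x: "x \<in> Conf"
  shows "gibbs_spec V E lam U y (cylinder V E x U) \<le> wt U x / boundary_sum U y"
proof -
  have "boundary_configs V E U y \<inter> cylinder V E x U \<subseteq> {glue U x y}"
  proof
    fix z assume z: "z \<in> boundary_configs V E U y \<inter> cylinder V E x U"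
    have "z = glue U x y"
    proof
      fix v show "z v = glue U x y v"
        using z by (cases "v \<in> V")
          (auto simp: boundary_configs_def cylinder_def glue_def indep_configs_def PiE_iff extensional_def)
    qed
    then show "z \<in> {glue U x y}" by simp
  qed
  then have "(\<Sum>x\<in>boundary_configs V E U y \<inter> cylinder V E x U. wt U x) \<le> (\<Sum>x\<in>{glue U x y}. wt U x)"
    using wt_pos[OF U(2)] by (intro sum_mono2) (auto simp: less_imp_le)
  also have "\<dots> = wt U x"
    using U by (auto simp: glue_def intro!: prod.cong)
  finally show ?thesis
    unfolding gibbs_spec_def using boundary_sum_pos[OF U y]
    by (simp add: boundary_sum_def[symmetric] divide_right_mono less_imp_le)
qed

lemma gibbs_spec_cylinder_ge:
  assumes U: "finite U" "U \<subseteq> V" and y: "y \<in> Conf" and x: "x \<in> Conf" and g: "glue U x y \<in> Conf"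
  shows "wt U x / Z U \<le> gibbs_spec V E lam U y (cylinder V E x U)"
proof -
  have "glue U x y \<in> boundary_configs V E U y \<inter> cylinder V E x U"
    using g U by (auto simp: boundary_configs_def cylinder_def glue_def)
  then have "wt U (glue U x y) \<le> (\<Sum>x\<in>boundary_configs V E U y \<inter> cylinder V E x U. wt U x)"
    using wt_pos[OF U(2)] finite_boundary_configs[OF U(1)]
    by (intro member_le_sum) (auto simp: less_imp_le)
  also have "wt U (glue U x y) = wt U x"
    using U by (auto simp: glue_def intro!: prod.cong)
  finally have "wt U x / boundary_sum U y \<le> gibbs_spec V E lam U y (cylinder V E x U)"
    unfolding gibbs_spec_def using boundary_sum_pos[OF U y]
    by (simp add: boundary_sum_def[symmetric] divide_right_mono less_imp_le)
  moreover have "wt U x / Z U \<le> wt U x / boundary_sum U y"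
    using boundary_sum_pos[OF U y] boundary_sum_le_partition[OF U y] wt_pos[OF U(2), of x]
    by (intro divide_left_mono) auto
  ultimately show ?thesis by linarith
qed

lemma finite_neighbours: "finite U \<Longrightarrow> U \<subseteq> V \<Longrightarrow> finite (E `` U)"
  using lf by (auto simp: locally_finite_graph_def Image_def Union_eq subset_iff
      intro: finite_subset[of _ "\<Union>u\<in>U. {w. (u, w) \<in> E}"])

lemma neighbours_V: "E `` U \<subseteq> V"
  using edge_V by auto

lemma space_config_space: "space (config_space V E) = Conf"
  by (auto simp: config_space_def indep_configs_def)

lemma coordinate_measurable:
  assumes "v \<in> V" shows "{x \<in> Conf. x v = a} \<in> sets (config_space V E)"
proof (cases "a \<in> {0, 1}")
  case True
  have "openin (subtopology (cube_topology V) Conf)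
      {x \<in> topspace (subtopology (cube_topology V) Conf). x v \<in> {a}}"
    using True assms
    by (intro openin_continuous_map_preimage[OF continuous_map_from_subtopology[OF continuous_map_cube_coordinate]]) auto
  also have "{x \<in> topspace (subtopology (cube_topology V) Conf). x v \<in> {a}} = {x \<in> Conf. x v = a}"
    by (auto simp: indep_configs_def)
  finally show ?thesis
    unfolding config_space_def by (rule openin_sets_borel_of)
next
  case False
  then have "{x \<in> Conf. x v = a} = {}" using config_cases[OF _ assms] by fastforce
  then show ?thesis by (simp only: sets.empty_sets)
qed

lemma subset_coord_algebra: "{{x \<in> Conf. x v = a} | v a. v \<in> W} \<subseteq> Pow Conf"
  by auto

lemma space_coord_algebra: "space (coord_algebra V E W) = Conf"
  unfolding coord_algebra_def by (rule space_measure_of[OF subset_coord_algebra])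

lemma cylinder_coord_algebra:
  assumes "finite W" "W \<subseteq> W'" shows "cylinder V E x W \<in> sets (coord_algebra V E W')"
proof (cases "W = {}")
  case True
  have "Conf \<in> sets (coord_algebra V E W')"
    using sets.top[of "coord_algebra V E W'"] by (simp only: space_coord_algebra)
  then show ?thesis using True by (simp add: cylinder_def)
next
  case False
  have "cylinder V E x W = (\<Inter>w\<in>W. {x' \<in> Conf. x' w = x w})"
    using False by (auto simp: cylinder_def)
  also have "\<dots> \<in> sets (coord_algebra V E W')"
  proof (rule sets.finite_INT[OF assms(1) False])
    fix w assume "w \<in> W"
    then have "{x' \<in> Conf. x' w = x w} \<in> {{x \<in> Conf. x v = a} | v a. v \<in> W'}" using assms(2) by blast
    then show "{x' \<in> Conf. x' w = x w} \<in> sets (coord_algebra V E W')"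
      unfolding coord_algebra_def sets_measure_of[OF subset_coord_algebra] by (rule sigma_sets.Basic)
  qed
  finally show ?thesis .
qed

lemma coord_algebra_subalgebra:
  assumes "W \<subseteq> V" "sets M = sets (config_space V E)"
  shows "Conditional_Expectation.subalgebra M (coord_algebra V E W)"
proof -
  have sp: "space M = Conf"
    using sets_eq_imp_space_eq[OF assms(2)] space_config_space by simp
  have "sets (coord_algebra V E W) \<subseteq> sets M"
    unfolding coord_algebra_def sets_measure_of[OF subset_coord_algebra]
    using assms coordinate_measurable by (subst sp[symmetric], intro sets.sigma_sets_subset) auto
  then show ?thesis
    unfolding Conditional_Expectation.subalgebra_def sp
    by (simp add: space_coord_algebra)
qed

end

section \<open>Consequences of the DLR equations\<close>

locale hardcore_gibbs = hardcore V E lam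
  for V :: "'v set" and E and lam :: "'v \<Rightarrow> real" +
  fixes P :: "('v \<Rightarrow> nat) measure"
  assumes gibbs: "gibbs_measure V E lam P"
begin

abbreviation pr :: "('v \<Rightarrow> nat) \<Rightarrow> 'v set \<Rightarrow> real" where
  "pr x W \<equiv> measure P (cylinder V E x W)"

lemma prob_P: "prob_space P" and sets_P: "sets P = sets (config_space V E)"
  using gibbs by (auto simp: gibbs_measure_def)

lemma space_P: "space P = Conf"
  using sets_eq_imp_space_eq[OF sets_P] space_config_space by simp

lemma cylinder_sets: "finite W \<Longrightarrow> W \<subseteq> V \<Longrightarrow> cylinder V E x W \<in> sets P"
  using coord_algebra_subalgebra[OF order_refl sets_P] cylinder_coord_algebra
  by (auto simp: Conditional_Expectation.subalgebra_def)

lemma pr_empty: "pr x {} = 1"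
proof -
  have "cylinder V E x {} = space P" by (simp add: cylinder_def space_P)
  then show ?thesis using prob_space.prob_space[OF prob_P] by simp
qed

text \<open>All that is used of the Gibbs property: since the cylinder over \<open>W\<close> is measurable with respect to the
  coordinates outside \<open>U\<close>, the probability of the joint cylinder is the integral of the specification
  over the cylinder, and pointwise bounds on the specification carry over.\<close>

lemma
  assumes U: "finite U" "U \<subseteq> V" "U' \<subseteq> U" and W: "finite W" "W \<subseteq> V" "W \<inter> U = {}"
    and x: "x \<in> Conf"
  shows dlr_lower: "(\<And>y. y \<in> Conf \<Longrightarrow> (\<And>w. w \<in> W \<Longrightarrow> y w = x w) \<Longrightarrow>
        a \<le> gibbs_spec V E lam U y (cylinder V E x U')) \<Longrightarrow> a * pr x W \<le> pr x (U' \<union> W)"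
    and dlr_upper: "(\<And>y. y \<in> Conf \<Longrightarrow> (\<And>w. w \<in> W \<Longrightarrow> y w = x w) \<Longrightarrow>
        gibbs_spec V E lam U y (cylinder V E x U') \<le> b) \<Longrightarrow> pr x (U' \<union> W) \<le> b * pr x W"
proof -
  interpret prob_space P by (rule prob_P)
  let ?F = "coord_algebra V E (V - U)"
  have sub: "Conditional_Expectation.subalgebra P ?F" by (rule coord_algebra_subalgebra[OF _ sets_P]) auto
  interpret finite_measure_subalgebra P ?F by unfold_locales (rule sub)
  let ?C = "cylinder V E x W" and ?A = "cylinder V E x U'"
  have fU': "finite U'" "U' \<subseteq> V" using U finite_subset by auto
  have CF: "?C \<in> sets ?F" using W by (intro cylinder_coord_algebra) auto
  have C[measurable]: "?C \<in> sets P" by (rule cylinder_sets[OF W(1,2)])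
  have A[measurable]: "?A \<in> sets P" by (rule cylinder_sets[OF fU'])
  have intA: "integrable P (indicator ?A :: _ \<Rightarrow> real)"
    by (rule integrable_real_indicator) (auto simp: A emeasure_eq_measure)
  have "?C \<inter> ?A = cylinder V E x (U' \<union> W)" by (auto simp: cylinder_def)
  then have "pr x (U' \<union> W) = (LINT y:?C|P. indicator ?A y)"
    unfolding set_lebesgue_integral_def using sets.sets_into_space[OF cylinder_sets[of "U' \<union> W" x]] fU' W
    by (simp add: indicator_inter_arith[symmetric] Int_absorb2)
  also have "\<dots> = (LINT y:?C|P. real_cond_exp P ?F (indicator ?A) y)"
    by (rule real_cond_exp_intA[OF intA CF])
  finally have eq: "pr x (U' \<union> W) = (LINT y|P. indicator ?C y * real_cond_exp P ?F (indicator ?A) y)"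
    unfolding set_lebesgue_integral_def by simp
  have AEb: "AE y in P. real_cond_exp P ?F (indicator ?A) y = gibbs_spec V E lam U y ?A"
    using gibbs U x unfolding gibbs_measure_def by blast
  have int: "integrable P (\<lambda>y. indicator ?C y * real_cond_exp P ?F (indicator ?A) y)"
    using integrable_mult_indicator[OF C real_cond_exp_int(1)[OF intA]] by simp
  have intc: "integrable P (\<lambda>y. indicator ?C y * c)" for c :: real
    by (intro integrable_mult_left integrable_real_indicator) (auto simp: emeasure_eq_measure)
  have const: "(LINT y|P. indicator ?C y * c) = c * pr x W" for c :: real
    by simp
  show "a * pr x W \<le> pr x (U' \<union> W)"
    if a: "\<And>y. y \<in> Conf \<Longrightarrow> (\<And>w. w \<in> W \<Longrightarrow> y w = x w) \<Longrightarrow> a \<le> gibbs_spec V E lam U y ?A"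
  proof -
    have "a \<le> gibbs_spec V E lam U y ?A" if "y \<in> ?C" for y
      using that a by (auto simp: cylinder_def)
    then show ?thesis
      unfolding eq const[symmetric] using AEb
      by (intro integral_mono_AE intc int) (auto elim!: eventually_mono split: split_indicator)
  qed
  show "pr x (U' \<union> W) \<le> b * pr x W"
    if b: "\<And>y. y \<in> Conf \<Longrightarrow> (\<And>w. w \<in> W \<Longrightarrow> y w = x w) \<Longrightarrow> gibbs_spec V E lam U y ?A \<le> b"
  proof -
    have "gibbs_spec V E lam U y ?A \<le> b" if "y \<in> ?C" for y
      using that b by (auto simp: cylinder_def)
    then show ?thesis
      unfolding eq const[symmetric] using AEb
      by (intro integral_mono_AE intc int) (auto elim!: eventually_mono split: split_indicator)
  qed
qed

lemma pr_mono: "finite W \<Longrightarrow> W \<subseteq> V \<Longrightarrow> (\<And>w. w \<in> W' \<Longrightarrow> w \<in> W \<and> x w = x' w) \<Longrightarrow> finite W' \<Longrightarrow> pr x W \<le> pr x' W'"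
  by (intro finite_measure.finite_measure_mono[OF prob_space.finite_measure[OF prob_P]] cylinder_sets)
    (auto simp: cylinder_def)

lemma pr_cong: "(\<And>w. w \<in> W \<Longrightarrow> x w = x' w) \<Longrightarrow> pr x W = pr x' W"
  by (intro arg_cong[where f = "measure P"]) (auto simp: cylinder_def)

text \<open>The cost of prescribing \<open>x\<close> on \<open>U\<close> in addition to \<open>W\<close> is bounded below, whatever happens elsewhere:
  the vertices of \<open>D\<close> around \<open>U\<close> may be set to 0, and after that the configuration on \<open>D\<close> is compatible
  with every continuation outside \<open>D\<close>. This one estimate yields the positivity of cylinders, the lower
  bound on conditional probabilities and one half of the comparison with partition functions.\<close>

lemma pr_lower:
  assumes x: "x \<in> Conf" and D: "finite D" "D \<subseteq> V" and U: "U \<subseteq> D" and W: "finite W" "W \<subseteq> V" "W \<inter> D = {}"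
    and nb: "E `` U \<subseteq> D \<union> W"
  shows "pr x W * (wt U x / Z D) \<le> pr x (U \<union> W)"
proof -
  \<comment> \<open>Only the ones of \<open>x\<close> on \<open>U \<union> W\<close> are kept, so the value is 0 on \<open>D - U\<close>.\<close>
  define x' where "x' = glue (U \<union> W) x (empty_config V)"
  have x': "x' \<in> Conf" unfolding x'_def by (rule glue_zero_config(1)[OF x])
  have x'x: "x' v = x v" if "v \<in> U \<union> W" for v
    using that U D W by (auto simp: x'_def glue_def)
  have x'0: "x' v = 0" if "v \<in> D - U" for v
    using that U D W by (auto simp: x'_def glue_def empty_config_def)
  have "wt D x' / Z D * pr x' W \<le> pr x' (D \<union> W)"
  proof (rule dlr_lower[OF D order_refl W x'])
    fix y assume y: "y \<in> Conf" "\<And>w. w \<in> W \<Longrightarrow> y w = x' w"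
    show "wt D x' / Z D \<le> gibbs_spec V E lam D y (cylinder V E x' D)"
    proof (rule gibbs_spec_cylinder_ge[OF D y(1) x'])
      show "glue D x' y \<in> Conf"
      proof (rule glue_config[OF x' y(1)])
        fix u v assume uv: "(u, v) \<in> E" "u \<in> D" "v \<notin> D" "x' u = 1"
        then have "u \<in> U" using x'0[of u] by auto
        then have "v \<in> W" using uv nb by auto
        then show "y v = 0" using config_edge[OF x' uv(1,4)] y(2) by simp
      qed
    qed
  qed
  moreover have "wt D x' = wt U x"
  proof -
    have "wt D x' = wt U x'"
      using D U x'0 by (intro prod.mono_neutral_right) auto
    also have "\<dots> = wt U x" using x'x by (intro prod.cong) auto
    finally show ?thesis .
  qed
  moreover have "pr x' W = pr x W" using x'x by (intro pr_cong) auto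
  moreover have "pr x' (D \<union> W) \<le> pr x (U \<union> W)"
    using D W U x'x by (intro pr_mono) (auto intro: finite_subset)
  ultimately show ?thesis by (simp add: mult.commute)
qed

lemma pr_pos:
  assumes x: "x \<in> Conf" and W: "finite W" "W \<subseteq> V" shows "0 < pr x W"
proof -
  have D: "finite (W \<union> E `` W)" "W \<union> E `` W \<subseteq> V"
    using W finite_neighbours neighbours_V by auto
  have "0 < wt W x / Z (W \<union> E `` W)" using wt_pos[OF W(2)] partition_pos[OF D] by simp
  also have "\<dots> \<le> pr x W"
    using pr_lower[OF x D, of W "{}"] by (simp add: pr_empty)
  finally show ?thesis .
qed

lemma pr_upper:
  assumes x: "x \<in> Conf" and W: "finite W" "W \<subseteq> V" and D: "D \<subseteq> W" and int: "E `` (W - D) \<subseteq> W"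
  shows "pr x W \<le> wt W x / Z W * Z D"
proof -
  have fD: "finite D" "finite (W - D)" "D \<subseteq> V" "W - D \<subseteq> V" using W D finite_subset by auto
  have "pr x (W \<union> {}) \<le> wt W x / Z (W - D) * pr x {}"
  proof (rule dlr_upper[OF W order_refl _ _ _ x])
    fix y assume y: "y \<in> Conf"
    have "gibbs_spec V E lam W y (cylinder V E x W) \<le> wt W x / boundary_sum W y"
      by (rule gibbs_spec_cylinder_le[OF W y x])
    also have "\<dots> \<le> wt W x / Z (W - D)"
    proof (rule divide_left_mono)
      show "Z (W - D) \<le> boundary_sum W y"
        using int by (intro partition_interior_le_boundary_sum[OF W y D]) auto
    qed (use wt_pos[OF W(2), of x] boundary_sum_pos[OF W y] partition_pos[OF fD(2,4)] in auto)
    finally show "gibbs_spec V E lam W y (cylinder V E x W) \<le> wt W x / Z (W - D)" .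
  qed auto
  also have "\<dots> \<le> wt W x / Z W * Z D"
  proof -
    have "Z W \<le> Z (W - D) * Z D"
      using partition_subadditive[OF fD(2,1,4,3)] D by (simp add: Un_absorb2 Int_commute)
    then show ?thesis
      using wt_pos[OF W(2), of x] partition_pos[OF W] partition_pos[OF fD(2,4)]
      by (simp add: pr_empty field_simps)
  qed
  finally show ?thesis by simp
qed

end

section \<open>Strong spatial mixing\<close>

context hardcore
begin

text \<open>Balls are built by iterating the neighbourhood operator, because this form commutes visibly with
  automorphisms.\<close>

definition graph_ball :: "'v \<Rightarrow> nat \<Rightarrow> 'v set" where
  "graph_ball v L = ((\<lambda>A. A \<union> E `` A) ^^ L) {v}"

lemma graph_ball_finite: "v \<in> V \<Longrightarrow> finite (graph_ball v L) \<and> graph_ball v L \<subseteq> V"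
  by (induction L) (use finite_neighbours neighbours_V in \<open>auto simp: graph_ball_def\<close>)

lemma graph_ball_mono: "L \<le> M \<Longrightarrow> graph_ball v L \<subseteq> graph_ball v M"
  by (rule lift_Suc_mono_le[of "graph_ball v"]) (auto simp: graph_ball_def)

lemma graph_ball_center: "v \<in> graph_ball v L"
  using graph_ball_mono[of 0 L v] by (simp add: graph_ball_def)

lemma relpow_graph_ball: "(v, w) \<in> E ^^ n \<Longrightarrow> w \<in> graph_ball v n"
proof (induction n arbitrary: w)
  case 0
  then show ?case by (simp add: graph_ball_def)
next
  case (Suc n)
  then obtain u where "(v, u) \<in> E ^^ n" "(u, w) \<in> E" by auto
  then show ?case using Suc.IH[of u] by (auto simp: graph_ball_def)
qed

lemma graph_dist_ge:
  assumes "D \<inter> graph_ball v L = {}" shows "enat L \<le> graph_dist E v D"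
  unfolding graph_dist_def
proof (rule Inf_greatest)
  fix d assume "d \<in> {enat n | n. \<exists>w\<in>D. (v, w) \<in> E ^^ n}"
  then obtain n w where "d = enat n" "w \<in> D" "(v, w) \<in> E ^^ n" by auto
  then show "enat L \<le> d"
    using assms relpow_graph_ball[of v w n] graph_ball_mono[of n L v] by (cases "L \<le> n") auto
qed

lemma ssm_ball:
  assumes ssm: "strong_spatial_mixing V E lam" and "0 < \<eta>"
  obtains L where "\<And>v W x y. v \<in> V \<Longrightarrow> v \<notin> W \<Longrightarrow> x \<in> Conf \<Longrightarrow> y \<in> Conf \<Longrightarrow> (\<And>w. w \<in> W \<Longrightarrow> y w = x w) \<Longrightarrow>
    \<bar>gibbs_spec V E lam (graph_ball v L - W) y (zero_event V E v)
     - gibbs_spec V E lam (graph_ball v L - W) x (zero_event V E v)\<bar> \<le> \<eta>"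
proof -
  obtain \<delta> :: "nat \<Rightarrow> real" where \<delta>: "\<delta> \<longlonglongrightarrow> 0" and
    mix: "\<And>U v y z. finite U \<Longrightarrow> U \<subseteq> V \<Longrightarrow> v \<in> U \<Longrightarrow> y \<in> Conf \<Longrightarrow> z \<in> Conf \<Longrightarrow>
      \<bar>gibbs_spec V E lam U y (zero_event V E v) - gibbs_spec V E lam U z (zero_event V E v)\<bar>
        \<le> rate_at \<delta> (graph_dist E v (disagreement V U y z))"
    using ssm unfolding strong_spatial_mixing_def by metis
  from \<delta> \<open>0 < \<eta>\<close> have "eventually (\<lambda>l. \<delta> l < \<eta>) sequentially" by (rule order_tendstoD)
  then obtain L where L: "\<And>l. L \<le> l \<Longrightarrow> \<delta> l < \<eta>" by (auto simp: eventually_sequentially)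
  show ?thesis
  proof (rule that[of L])
    fix v W x y assume v: "v \<in> V" "v \<notin> W" and xy: "x \<in> Conf" "y \<in> Conf" and eq: "\<And>w. w \<in> W \<Longrightarrow> y w = x w"
    let ?U = "graph_ball v L - W"
    have "disagreement V ?U y x \<inter> graph_ball v L = {}"
      using eq by (auto simp: disagreement_def)
    then have "enat L \<le> graph_dist E v (disagreement V ?U y x)"
      by (rule graph_dist_ge)
    then have "rate_at \<delta> (graph_dist E v (disagreement V ?U y x)) \<le> \<eta>"
      using L \<open>0 < \<eta>\<close> by (auto simp: rate_at_def less_imp_le split: enat.split)
    moreover have "\<bar>gibbs_spec V E lam ?U y (zero_event V E v) - gibbs_spec V E lam ?U x (zero_event V E v)\<bar>
        \<le> rate_at \<delta> (graph_dist E v (disagreement V ?U y x))"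
      using graph_ball_finite[OF v(1), of L] graph_ball_center v xy by (intro mix) auto
    ultimately show "\<bar>gibbs_spec V E lam ?U y (zero_event V E v) - gibbs_spec V E lam ?U x (zero_event V E v)\<bar> \<le> \<eta>"
      by linarith
  qed
qed

end

locale hardcore_ssm = hardcore_gibbs V E lam P
  for V :: "'v set" and E and lam :: "'v \<Rightarrow> real" and P +
  assumes ssm: "strong_spatial_mixing V E lam"
begin

definition zero_prob :: "('v \<Rightarrow> nat) \<Rightarrow> 'v \<Rightarrow> 'v set \<Rightarrow> real" where
  "zero_prob x v W = measure P (zero_event V E v \<inter> cylinder V E x W) / pr x W"

definition cpr :: "('v \<Rightarrow> nat) \<Rightarrow> 'v set \<Rightarrow> 'v set \<Rightarrow> real" where
  "cpr x T W = pr x (T \<union> W) / pr x W"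

lemma clear_config: "x \<in> Conf \<Longrightarrow> v \<in> V \<Longrightarrow> x(v := 0) \<in> Conf"
  by (auto simp: indep_configs_def PiE_iff extensional_def)

lemma zero_event_inter: "v \<notin> W \<Longrightarrow> zero_event V E v \<inter> cylinder V E x W = cylinder V E (x(v := 0)) (insert v W)"
  by (auto simp: zero_event_def cylinder_def)

lemma zero_event_eq: "zero_event V E v = cylinder V E (x(v := 0)) {v}"
  by (auto simp: zero_event_def cylinder_def)

text \<open>Conditioning the Gibbs measure on \<open>W\<close> averages the specification on a ball around \<open>v\<close> minus \<open>W\<close> over
  boundary conditions that agree with \<open>x\<close> on \<open>W\<close>. Two of these can differ only outside the ball, so
  by spatial mixing each of them gives nearly the value at \<open>x\<close> itself. The approximating quantity does
  not involve the Gibbs measure; this is how uniqueness enters.\<close>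

lemma zero_prob_approx:
  assumes "0 < \<eta>"
  obtains L where "\<And>v W x. v \<in> V \<Longrightarrow> v \<notin> W \<Longrightarrow> x \<in> Conf \<Longrightarrow> finite W \<Longrightarrow> W \<subseteq> V \<Longrightarrow>
    \<bar>zero_prob x v W - gibbs_spec V E lam (graph_ball v L - W) x (zero_event V E v)\<bar> \<le> \<eta>"
proof -
  obtain L where L: "\<And>v W x y. v \<in> V \<Longrightarrow> v \<notin> W \<Longrightarrow> x \<in> Conf \<Longrightarrow> y \<in> Conf \<Longrightarrow> (\<And>w. w \<in> W \<Longrightarrow> y w = x w) \<Longrightarrow>
    \<bar>gibbs_spec V E lam (graph_ball v L - W) y (zero_event V E v)
     - gibbs_spec V E lam (graph_ball v L - W) x (zero_event V E v)\<bar> \<le> \<eta>"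
    using ssm_ball[OF ssm assms] by blast
  show ?thesis
  proof (rule that[of L])
    fix v W x assume v: "v \<in> V" "v \<notin> W" and x: "x \<in> Conf" and W: "finite W" "W \<subseteq> V"
    define x' where "x' = x(v := 0)"
    let ?U = "graph_ball v L - W"
    let ?c = "gibbs_spec V E lam ?U x (zero_event V E v)"
    have U: "finite ?U" "?U \<subseteq> V" "{v} \<subseteq> ?U" "W \<inter> ?U = {}"
      using graph_ball_finite[OF v(1), of L] graph_ball_center v by auto
    have x': "x' \<in> Conf" unfolding x'_def by (rule clear_config[OF x v(1)])
    have z: "zero_event V E v = cylinder V E x' {v}"
      unfolding x'_def by (rule zero_event_eq)
    have c: "?c - \<eta> \<le> gibbs_spec V E lam ?U y (cylinder V E x' {v})"
      "gibbs_spec V E lam ?U y (cylinder V E x' {v}) \<le> ?c + \<eta>"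
      if "y \<in> Conf" "\<And>w. w \<in> W \<Longrightarrow> y w = x' w" for y
    proof -
      have "\<bar>gibbs_spec V E lam ?U y (zero_event V E v) - ?c\<bar> \<le> \<eta>"
        using that v by (intro L[OF v x]) (auto simp: x'_def)
      then show "?c - \<eta> \<le> gibbs_spec V E lam ?U y (cylinder V E x' {v})"
        "gibbs_spec V E lam ?U y (cylinder V E x' {v}) \<le> ?c + \<eta>"
        unfolding z by linarith+
    qed
    have eq: "pr x' W = pr x W" using v by (intro pr_cong) (auto simp: x'_def)
    have pos: "0 < pr x W" by (rule pr_pos[OF x W])
    have "(?c - \<eta>) * pr x' W \<le> pr x' ({v} \<union> W)" "pr x' ({v} \<union> W) \<le> (?c + \<eta>) * pr x' W"
      by (rule dlr_lower[OF U(1-3) W U(4) x' c(1)], assumption, simp)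
        (rule dlr_upper[OF U(1-3) W U(4) x' c(2)], assumption, simp)
    then have "?c - \<eta> \<le> zero_prob x v W" "zero_prob x v W \<le> ?c + \<eta>"
      using pos v by (simp_all add: eq zero_prob_def zero_event_inter x'_def[symmetric] field_simps)
    then show "\<bar>zero_prob x v W - ?c\<bar> \<le> \<eta>" by linarith
  qed
qed

lemma cpr_singleton:
  assumes "x \<in> Conf" "v \<in> V" "v \<notin> W" "finite W" "W \<subseteq> V"
  shows "cpr x {v} W = (if x v = 0 then zero_prob x v W else 1 - zero_prob x v W)"
proof (cases "x v = 0")
  case True
  then have "x(v := 0) = x" by auto
  then show ?thesis
    using True assms by (simp add: cpr_def zero_prob_def zero_event_inter)
next
  case False
  interpret prob_space P by (rule prob_P)
  have "cylinder V E x (insert v W) = cylinder V E x W - cylinder V E (x(v := 0)) (insert v W)"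
  proof -
    have "y v = x v \<longleftrightarrow> y v \<noteq> 0" if "y \<in> Conf" for y
      using False assms(2) config_cases[OF assms(1,2)] config_cases[OF that assms(2)] by auto
    then show ?thesis using assms(3) False by (auto simp: cylinder_def)
  qed
  moreover have "cylinder V E (x(v := 0)) (insert v W) \<subseteq> cylinder V E x W"
    using assms(3) by (auto simp: cylinder_def)
  moreover have "cylinder V E x W \<in> sets P" "cylinder V E (x(v := 0)) (insert v W) \<in> sets P"
    using assms by (auto intro!: cylinder_sets)
  ultimately have "pr x (insert v W) = pr x W - pr (x(v := 0)) (insert v W)"
    by (simp only: finite_measure_Diff)
  then show ?thesis
    using False assms pr_pos[of x W] by (simp add: cpr_def zero_prob_def zero_event_inter diff_divide_distrib)
qed

lemma cpr_mult:
  assumes "x \<in> Conf" "finite T" "T \<subseteq> V" "finite W" "W \<subseteq> V"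
  shows "cpr x S (T \<union> W) * cpr x T W = cpr x (S \<union> T) W"
  using pr_pos[of x "T \<union> W"] assms by (simp add: cpr_def Un_assoc)

lemma cpr_bounds:
  assumes "x \<in> Conf" "finite T" "T \<subseteq> V" "finite W" "W \<subseteq> V"
  shows "0 < cpr x T W" "cpr x T W \<le> 1"
proof -
  show "0 < cpr x T W" unfolding cpr_def using assms by (intro divide_pos_pos pr_pos) auto
  have "pr x (T \<union> W) \<le> pr x W" using assms by (intro pr_mono) auto
  then show "cpr x T W \<le> 1" unfolding cpr_def using pr_pos[of x W] assms by simp
qed

text \<open>Conditional probabilities of a finite pattern depend, uniformly in the configuration, only on the
  part of the condition that is near the pattern. The vertices of \<open>T\<close> are revealed one at a time, since
  spatial mixing concerns single vertices.\<close>

lemma cpr_local: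
  assumes "finite T" "T \<subseteq> V" "0 < \<epsilon>"
  shows "\<exists>R. finite R \<and> R \<subseteq> V \<and> (\<forall>x\<in>Conf. \<forall>W W'. finite W \<longrightarrow> W \<subseteq> V \<longrightarrow> finite W' \<longrightarrow> W' \<subseteq> V \<longrightarrow>
    W \<inter> T = {} \<longrightarrow> W' \<inter> T = {} \<longrightarrow> W \<inter> R = W' \<inter> R \<longrightarrow> \<bar>cpr x T W - cpr x T W'\<bar> \<le> \<epsilon>)"
  using assms
proof (induction T arbitrary: \<epsilon> rule: finite_induct)
  case empty
  have "cpr x {} W = 1" if "x \<in> Conf" "finite W" "W \<subseteq> V" for x W
    using pr_pos[OF that] by (simp add: cpr_def)
  then show ?case using \<open>0 < \<epsilon>\<close> by (intro exI[of _ "{}"]) auto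
next
  case (insert v T)
  have v: "v \<in> V" and T: "finite T" "T \<subseteq> V" using insert by auto
  obtain R where R: "finite R" "R \<subseteq> V" and IH: "\<And>x W W'. x \<in> Conf \<Longrightarrow> finite W \<Longrightarrow> W \<subseteq> V \<Longrightarrow> finite W' \<Longrightarrow> W' \<subseteq> V \<Longrightarrow>
      W \<inter> T = {} \<Longrightarrow> W' \<inter> T = {} \<Longrightarrow> W \<inter> R = W' \<inter> R \<Longrightarrow> \<bar>cpr x T W - cpr x T W'\<bar> \<le> \<epsilon> / 2"
  proof -
    have "0 < \<epsilon> / 2" using \<open>0 < \<epsilon>\<close> by simp
    from insert.IH[OF T(2) this] that show ?thesis by meson
  qed
  obtain L where L: "\<And>v W x. v \<in> V \<Longrightarrow> v \<notin> W \<Longrightarrow> x \<in> Conf \<Longrightarrow> finite W \<Longrightarrow> W \<subseteq> V \<Longrightarrow>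
      \<bar>zero_prob x v W - gibbs_spec V E lam (graph_ball v L - W) x (zero_event V E v)\<bar> \<le> \<epsilon> / 4"
  proof -
    have "0 < \<epsilon> / 4" using \<open>0 < \<epsilon>\<close> by simp
    from zero_prob_approx[OF this] that show ?thesis by blast
  qed
  show ?case
  proof (intro exI[of _ "R \<union> graph_ball v L"] conjI ballI allI impI)
    show "finite (R \<union> graph_ball v L)" "R \<union> graph_ball v L \<subseteq> V"
      using R graph_ball_finite[OF v] by auto
    fix x W W' assume x: "x \<in> Conf" and W: "finite W" "W \<subseteq> V" and W': "finite W'" "W' \<subseteq> V"
      and disj: "W \<inter> insert v T = {}" "W' \<inter> insert v T = {}"
      and eq: "W \<inter> (R \<union> graph_ball v L) = W' \<inter> (R \<union> graph_ball v L)"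
    have 1: "\<bar>cpr x T W - cpr x T W'\<bar> \<le> \<epsilon> / 2"
      using disj eq by (intro IH x W W') auto
    have ball_eq: "graph_ball v L - (T \<union> W) = graph_ball v L - (T \<union> W')" using eq by blast
    have "\<bar>zero_prob x v (T \<union> W) - gibbs_spec V E lam (graph_ball v L - (T \<union> W)) x (zero_event V E v)\<bar> \<le> \<epsilon> / 4"
      using disj T W insert.hyps by (intro L v x) auto
    moreover have "\<bar>zero_prob x v (T \<union> W') - gibbs_spec V E lam (graph_ball v L - (T \<union> W')) x (zero_event V E v)\<bar> \<le> \<epsilon> / 4"
      using disj T W' insert.hyps by (intro L v x) auto
    ultimately have "\<bar>zero_prob x v (T \<union> W) - zero_prob x v (T \<union> W')\<bar> \<le> \<epsilon> / 2"
      unfolding ball_eq by linarith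
    then have 2: "\<bar>cpr x {v} (T \<union> W) - cpr x {v} (T \<union> W')\<bar> \<le> \<epsilon> / 2"
      using disj T W W' insert.hyps
      by (subst (1 2) cpr_singleton[OF x v]) (auto simp: abs_if split: if_splits)
    have b: "0 < cpr x T W" "cpr x T W \<le> 1" "0 < cpr x {v} (T \<union> W')" "cpr x {v} (T \<union> W') \<le> 1"
      using cpr_bounds[OF x T W] cpr_bounds[OF x, of "{v}" "T \<union> W'"] T W' v by auto
    have "cpr x (insert v T) W - cpr x (insert v T) W'
      = (cpr x {v} (T \<union> W) - cpr x {v} (T \<union> W')) * cpr x T W + cpr x {v} (T \<union> W') * (cpr x T W - cpr x T W')"
      using cpr_mult[OF x T W, of "{v}"] cpr_mult[OF x T W', of "{v}"] by (simp add: algebra_simps)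
    also have "\<bar>\<dots>\<bar> \<le> \<epsilon> / 2 * 1 + 1 * (\<epsilon> / 2)"
      unfolding abs_mult abs_triangle_ineq
      by (rule order_trans[OF abs_triangle_ineq], unfold abs_mult, intro add_mono mult_mono)
        (use 1 2 b \<open>0 < \<epsilon>\<close> in auto)
    finally show "\<bar>cpr x (insert v T) W - cpr x (insert v T) W'\<bar> \<le> \<epsilon>" by simp
  qed
qed

end

section \<open>Invariance under automorphisms\<close>

locale hardcore_automorphism = hardcore V E lam
  for V :: "'v set" and E and lam :: "'v \<Rightarrow> real" +
  fixes \<tau> :: "'v \<Rightarrow> 'v"
  assumes bij: "bij_betw \<tau> V V"
    and edge_iff: "\<And>u v. u \<in> V \<Longrightarrow> v \<in> V \<Longrightarrow> (\<tau> u, \<tau> v) \<in> E \<longleftrightarrow> (u, v) \<in> E"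
    and lam_eq: "\<And>v. v \<in> V \<Longrightarrow> lam (\<tau> v) = lam v"
begin

text \<open>Precomposition with \<open>\<tau>\<close>, that is, the action of the inverse of \<open>\<tau>\<close> on configurations.\<close>

definition pull :: "('v \<Rightarrow> nat) \<Rightarrow> 'v \<Rightarrow> nat" where
  "pull x = (\<lambda>v\<in>V. x (\<tau> v))"

lemma tau_V: "v \<in> V \<Longrightarrow> \<tau> v \<in> V" and tau_inj: "inj_on \<tau> V" and tau_surj: "\<tau> ` V = V"
  using bij by (auto simp: bij_betw_def)

lemma pull_config: "x \<in> Conf \<Longrightarrow> pull x \<in> Conf"
proof -
  assume x: "x \<in> Conf"
  have "\<not> (pull x u = 1 \<and> pull x v = 1)" if uv: "(u, v) \<in> E" for u v
    using config_edge[OF x, of "\<tau> u" "\<tau> v"] edge_iff[of u v] edge_V[OF uv] uv by (auto simp: pull_def)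
  moreover have "pull x \<in> V \<rightarrow>\<^sub>E {0, 1}"
    using x tau_V by (auto simp: indep_configs_def pull_def PiE_iff)
  ultimately show ?thesis by (auto simp: indep_configs_def)
qed

lemma image_neighbours: "A \<subseteq> V \<Longrightarrow> E `` (\<tau> ` A) = \<tau> ` (E `` A)"
proof
  assume A: "A \<subseteq> V"
  show "E `` (\<tau> ` A) \<subseteq> \<tau> ` (E `` A)"
  proof
    fix w assume "w \<in> E `` (\<tau> ` A)"
    then obtain u where u: "u \<in> A" "(\<tau> u, w) \<in> E" by auto
    then obtain w' where w': "w' \<in> V" "w = \<tau> w'" using edge_V[OF u(2)] tau_surj by auto
    then have "(u, w') \<in> E" using u A edge_iff[of u w'] by auto
    then show "w \<in> \<tau> ` (E `` A)" using u w' by auto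
  qed
  show "\<tau> ` (E `` A) \<subseteq> E `` (\<tau> ` A)"
  proof
    fix w assume "w \<in> \<tau> ` (E `` A)"
    then obtain u w' where u: "u \<in> A" "(u, w') \<in> E" "w = \<tau> w'" by auto
    then have "(\<tau> u, \<tau> w') \<in> E" using A edge_V[OF u(2)] edge_iff[of u w'] by auto
    then show "w \<in> E `` (\<tau> ` A)" using u by auto
  qed
qed

lemma image_graph_ball: "v \<in> V \<Longrightarrow> graph_ball (\<tau> v) L = \<tau> ` graph_ball v L"
proof (induction L)
  case (Suc L)
  have "graph_ball (\<tau> v) (Suc L) = graph_ball (\<tau> v) L \<union> E `` graph_ball (\<tau> v) L" for v
    by (simp add: graph_ball_def)
  moreover have "graph_ball v (Suc L) = graph_ball v L \<union> E `` graph_ball v L" for v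
    by (simp add: graph_ball_def)
  ultimately show ?case
    using Suc image_neighbours[of "graph_ball v L"] graph_ball_finite[of v L] by auto
qed (simp add: graph_ball_def)

lemma pull_inj: "x \<in> Conf \<Longrightarrow> x' \<in> Conf \<Longrightarrow> pull x = pull x' \<Longrightarrow> x = x'"
proof (rule config_eqI)
  fix v assume eq: "pull x = pull x'" and "v \<in> V"
  then obtain u where "u \<in> V" "v = \<tau> u" using tau_surj by auto
  then show "x v = x' v" using fun_cong[OF eq, of u] by (simp add: pull_def)
qed

lemma pull_surj: "y \<in> Conf \<Longrightarrow> \<exists>x\<in>Conf. pull x = y"
proof -
  assume y: "y \<in> Conf"
  define x where "x = (\<lambda>v\<in>V. y (inv_into V \<tau> v))"
  have ii: "inv_into V \<tau> v \<in> V" "\<tau> (inv_into V \<tau> v) = v" if "v \<in> V" for v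
    using that tau_surj by (auto intro!: inv_into_into f_inv_into_f)
  have "x \<in> V \<rightarrow>\<^sub>E {0, 1}" using y ii by (auto simp: x_def indep_configs_def PiE_iff)
  moreover have "\<not> (x u = 1 \<and> x v = 1)" if uv: "(u, v) \<in> E" for u v
  proof -
    have "(inv_into V \<tau> u, inv_into V \<tau> v) \<in> E"
      using edge_iff[of "inv_into V \<tau> u" "inv_into V \<tau> v"] uv edge_V[OF uv] ii by auto
    then show ?thesis using config_edge[OF y] edge_V[OF uv] by (auto simp: x_def)
  qed
  ultimately have "x \<in> Conf" by (auto simp: indep_configs_def)
  moreover have "pull x = y"
    using y tau_V tau_inj by (auto simp: pull_def x_def indep_configs_def PiE_iff extensional_def fun_eq_iff)
  ultimately show ?thesis by blast
qed

lemma partition_automorphism: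
  assumes "finite U" "U \<subseteq> V" shows "Z (\<tau> ` U) = Z U"
proof -
  have iV: "inj_on \<tau> U" "\<tau> ` U \<subseteq> V" using tau_inj tau_surj assms by (auto intro: inj_on_subset)
  have weight: "hardcore_weight E lam (\<tau> ` A) = hardcore_weight E lam A" if A: "A \<in> Pow U" for A
  proof -
    have AV: "A \<subseteq> V" and inj: "inj_on \<tau> A" using A assms iV by (auto intro: inj_on_subset)
    have "(\<forall>(u, v)\<in>E. \<not> (u \<in> \<tau> ` A \<and> v \<in> \<tau> ` A)) \<longleftrightarrow> (\<forall>u\<in>A. \<forall>v\<in>A. (\<tau> u, \<tau> v) \<notin> E)"
      by blast
    also have "\<dots> \<longleftrightarrow> (\<forall>u\<in>A. \<forall>v\<in>A. (u, v) \<notin> E)"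
      using edge_iff AV by blast
    also have "\<dots> \<longleftrightarrow> (\<forall>(u, v)\<in>E. \<not> (u \<in> A \<and> v \<in> A))" by blast
    finally have "(\<forall>(u, v)\<in>E. \<not> (u \<in> \<tau> ` A \<and> v \<in> \<tau> ` A)) \<longleftrightarrow> (\<forall>(u, v)\<in>E. \<not> (u \<in> A \<and> v \<in> A))" .
    moreover have "(\<Prod>v\<in>\<tau> ` A. lam v) = (\<Prod>v\<in>A. lam v)"
      unfolding prod.reindex[OF inj] comp_def using AV lam_eq by (intro prod.cong) auto
    ultimately show ?thesis by (simp only: hardcore_weight_def)
  qed
  have "Z (\<tau> ` U) = (\<Sum>A\<in>(`) \<tau> ` Pow U. hardcore_weight E lam A)"
    using assms iV by (simp add: partition_eq_sum_subsets image_Pow_surj)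
  also have "\<dots> = (\<Sum>A\<in>Pow U. hardcore_weight E lam (\<tau> ` A))"
    by (subst sum.reindex[OF inj_on_image_Pow[OF iV(1)]]) simp
  also have "\<dots> = Z U"
    unfolding partition_eq_sum_subsets[OF assms] by (rule sum.cong[OF refl weight])
  finally show ?thesis .
qed

lemma gibbs_spec_automorphism:
  assumes U: "U \<subseteq> V" and x: "x \<in> Conf" and v: "v \<in> V"
  shows "gibbs_spec V E lam (\<tau> ` U) x (zero_event V E (\<tau> v)) = gibbs_spec V E lam U (pull x) (zero_event V E v)"
proof -
  have mem: "z \<in> boundary_configs V E (\<tau> ` U) x \<longleftrightarrow> pull z \<in> boundary_configs V E U (pull x)" if z: "z \<in> Conf" for z
  proof -
    have "V - \<tau> ` U = \<tau> ` (V - U)" using tau_inj tau_surj U by (simp add: inj_on_image_set_diff)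
    then have "(\<forall>v\<in>V - \<tau> ` U. z v = x v) \<longleftrightarrow> (\<forall>v\<in>V - U. pull z v = pull x v)"
      by (auto simp: pull_def)
    then show ?thesis using pull_config[OF z] z by (auto simp: boundary_configs_def)
  qed
  have w: "wt (\<tau> ` U) z = wt U (pull z)" for z
  proof -
    have "wt (\<tau> ` U) z = (\<Prod>u\<in>U. lam (\<tau> u) ^ z (\<tau> u))"
      using tau_inj U by (subst prod.reindex) (auto intro: inj_on_subset)
    also have "\<dots> = wt U (pull z)"
      using U by (intro prod.cong) (auto simp: lam_eq pull_def)
    finally show ?thesis .
  qed
  have zero: "z \<in> zero_event V E (\<tau> v) \<longleftrightarrow> pull z \<in> zero_event V E v" if z: "z \<in> Conf" for z
    using v pull_config[OF z] z by (auto simp: zero_event_def pull_def)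
  have sum_eq: "(\<Sum>z\<in>B. wt (\<tau> ` U) z) = (\<Sum>z\<in>C. wt U z)"
    if B: "B \<subseteq> Conf" and C: "C \<subseteq> Conf" and BC: "\<And>z. z \<in> Conf \<Longrightarrow> z \<in> B \<longleftrightarrow> pull z \<in> C" for B C
  proof -
    have "C = pull ` B"
    proof
      show "C \<subseteq> pull ` B"
      proof
        fix c assume c: "c \<in> C"
        then obtain z where "z \<in> Conf" "pull z = c" using C pull_surj[of c] by auto
        then show "c \<in> pull ` B" using BC[of z] c by auto
      qed
      show "pull ` B \<subseteq> C" using B BC by auto
    qed
    moreover have "inj_on pull B" using B pull_inj by (auto intro!: inj_onI)
    ultimately show ?thesis by (simp only: sum.reindex comp_def w)
  qed
  show ?thesis
    unfolding gibbs_spec_def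
    by (intro arg_cong2[where f = "(/)"] sum_eq)
      (use mem zero in \<open>auto simp: boundary_configs_def\<close>)
qed

end

context hardcore_ssm
begin

text \<open>The Gibbs measure is invariant because its conditional probabilities are limits of values of the
  specification on balls, and both balls and specification are carried along by automorphisms. The
  chain rule passes from single vertices to cylinders.\<close>

lemma pr_automorphism:
  assumes aut: "hardcore_automorphism V E lam \<tau>" and x: "x \<in> Conf" and W: "finite W" "W \<subseteq> V"
  shows "pr x (\<tau> ` W) = pr (\<lambda>v\<in>V. x (\<tau> v)) W"
proof -
  interpret hardcore_automorphism V E lam \<tau> by (rule aut)
  have px: "pull x \<in> Conf" by (rule pull_config[OF x])
  have zero: "zero_prob x (\<tau> v) (\<tau> ` W) = zero_prob (pull x) v W"
    if v: "v \<in> V" "v \<notin> W" and W: "finite W" "W \<subseteq> V" for v W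
  proof -
    have "\<bar>zero_prob x (\<tau> v) (\<tau> ` W) - zero_prob (pull x) v W\<bar> \<le> \<eta>" if \<eta>: "0 < \<eta>" for \<eta>
    proof -
      obtain L where L: "\<And>v W x. v \<in> V \<Longrightarrow> v \<notin> W \<Longrightarrow> x \<in> Conf \<Longrightarrow> finite W \<Longrightarrow> W \<subseteq> V \<Longrightarrow>
        \<bar>zero_prob x v W - gibbs_spec V E lam (graph_ball v L - W) x (zero_event V E v)\<bar> \<le> \<eta> / 2"
      proof -
        have "0 < \<eta> / 2" using \<eta> by simp
        from zero_prob_approx[OF this] that show ?thesis by blast
      qed
      have "graph_ball (\<tau> v) L - \<tau> ` W = \<tau> ` (graph_ball v L - W)"
        unfolding image_graph_ball[OF v(1)] using W graph_ball_finite[OF v(1), of L]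
        by (intro inj_on_image_set_diff[OF tau_inj, symmetric]) auto
      then have "gibbs_spec V E lam (graph_ball (\<tau> v) L - \<tau> ` W) x (zero_event V E (\<tau> v))
          = gibbs_spec V E lam (graph_ball v L - W) (pull x) (zero_event V E v)"
        using graph_ball_finite[OF v(1), of L] by (simp, intro gibbs_spec_automorphism x v) auto
      moreover have "\<tau> v \<notin> \<tau> ` W" using tau_inj v W by (auto simp: inj_on_def)
      ultimately have "\<bar>zero_prob x (\<tau> v) (\<tau> ` W)
          - gibbs_spec V E lam (graph_ball v L - W) (pull x) (zero_event V E v)\<bar> \<le> \<eta> / 2"
        using L[of "\<tau> v" "\<tau> ` W" x] v W x tau_V[OF v(1)] image_mono[OF W(2), of \<tau>] tau_surj by auto
      with L[OF v px W] show ?thesis by linarith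
    qed
    then show ?thesis using field_le_epsilon[of "\<bar>zero_prob x (\<tau> v) (\<tau> ` W) - zero_prob (pull x) v W\<bar>" 0] by auto
  qed
  show ?thesis using W unfolding pull_def[symmetric]
  proof (induction W rule: finite_induct)
    case empty
    then show ?case by (simp add: pr_empty)
  next
    case (insert v W)
    have v: "v \<in> V" and W: "finite W" "W \<subseteq> V" using insert by auto
    have tW: "finite (\<tau> ` W)" "\<tau> ` W \<subseteq> V" "\<tau> v \<notin> \<tau> ` W" "\<tau> v \<in> V"
      using W v tau_V tau_inj insert.hyps by (auto simp: inj_on_def)
    have "cpr x {\<tau> v} (\<tau> ` W) = cpr (pull x) {v} W"
      unfolding cpr_singleton[OF x tW(4,3,1,2)] cpr_singleton[OF px v insert.hyps(2) W]
      using zero[OF v insert.hyps(2) W] v by (simp add: pull_def)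
    then show ?case
      using insert.IH[OF W(2)] pr_pos[OF px W] by (simp add: cpr_def)
  qed
qed

end

section \<open>Translates of a fundamental domain and the chain rule\<close>

locale hardcore_action = hardcore_ssm V E lam P
  for V :: "'v set" and E and lam :: "'v \<Rightarrow> real" and P +
  fixes G :: "('g, 'm) monoid_scheme" (structure)
    and act :: "'g \<Rightarrow> 'v \<Rightarrow> 'v" and U\<^sub>0 :: "'v set"
  assumes amenable: "amenable_group G"
    and hc: "hardcore_class G V E lam act"
    and domain: "fundamental_domain G V act U\<^sub>0"
begin

sublocale group G
  using amenable by (simp add: amenable_group_def)

lemma action: "group_action G V act"
  using hc by (simp add: hardcore_class_def faithful_action_def)

lemma act_V: "g \<in> carrier G \<Longrightarrow> v \<in> V \<Longrightarrow> act g v \<in> V"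
  using group_action.element_image[OF action] by blast

lemma act_mult: "g \<in> carrier G \<Longrightarrow> h \<in> carrier G \<Longrightarrow> v \<in> V \<Longrightarrow> act (g \<otimes> h) v = act g (act h v)"
  using group_action.composition_rule[OF action] by blast

lemma act_one: "v \<in> V \<Longrightarrow> act \<one> v = v"
  using group_action.id_eq_one[OF action] by (metis restrict_apply')

lemma act_inv: "g \<in> carrier G \<Longrightarrow> v \<in> V \<Longrightarrow> act (inv g) (act g v) = v"
  using group_action.orbit_sym_aux[OF action] by blast

lemma free: "g \<in> carrier G \<Longrightarrow> v \<in> V \<Longrightarrow> act g v = v \<Longrightarrow> g = \<one>"
  using hc unfolding hardcore_class_def by blast

lemma act_automorphism: "g \<in> carrier G \<Longrightarrow> hardcore_automorphism V E lam (act g)"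
  using hc group_action.bij_prop0[OF action, of g]
  by unfold_locales (auto simp: hardcore_class_def Bij_def)

lemma U0_V: "U\<^sub>0 \<subseteq> V"
  using domain by (simp add: fundamental_domain_def)

lemma U0_orbit: "v \<in> V \<Longrightarrow> \<exists>!u. u \<in> U\<^sub>0 \<and> u \<in> orbit G act v"
  using domain unfolding fundamental_domain_def orbits_def by blast

lemma orbit_self: "v \<in> V \<Longrightarrow> v \<in> orbit G act v"
  by (rule group_action.orbit_refl[OF action])

lemma U0_bij: "bij_betw (orbit G act) U\<^sub>0 (orbits G V act)"
proof (rule bij_betwI')
  fix u u' assume u: "u \<in> U\<^sub>0" "u' \<in> U\<^sub>0"
  show "orbit G act u = orbit G act u' \<longleftrightarrow> u = u'"
  proof
    assume "orbit G act u = orbit G act u'"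
    then show "u = u'" using U0_orbit[of u] U0_V u orbit_self[of u] orbit_self[of u'] by blast
  qed simp
next
  fix u assume "u \<in> U\<^sub>0" then show "orbit G act u \<in> orbits G V act"
    using U0_V by (auto simp: orbits_def)
next
  fix B assume "B \<in> orbits G V act"
  then obtain v where v: "v \<in> V" "B = orbit G act v" by (auto simp: orbits_def)
  obtain u where u: "u \<in> U\<^sub>0" "u \<in> orbit G act v" using U0_orbit[OF v(1)] by blast
  have "orbit G act u = orbit G act v"
  proof -
    obtain g where g: "g \<in> carrier G" "u = act g v" using u by (auto simp: orbit_def)
    have "act h u \<in> orbit G act v" if "h \<in> carrier G" for h
      using that g v act_mult[of h g v] by (auto simp: orbit_def intro!: exI[of _ "h \<otimes> g"])
    moreover have "act h v \<in> orbit G act u" if "h \<in> carrier G" for h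
    proof -
      have "act h v = act (h \<otimes> inv g) u"
        using that g v act_mult[of h "inv g" u] act_inv[OF g(1) v(1)] act_V by auto
      then show ?thesis using that g by (auto simp: orbit_def)
    qed
    ultimately show ?thesis by (auto simp: orbit_def)
  qed
  then show "\<exists>x\<in>U\<^sub>0. B = orbit G act x" using u v by auto
qed

lemma finite_U0: "finite U\<^sub>0" and card_U0: "card U\<^sub>0 = card (orbits G V act)"
  using U0_bij hc bij_betw_finite[OF U0_bij] bij_betw_same_card[OF U0_bij]
  by (auto simp: hardcore_class_def)

text \<open>Freeness of the action identifies \<open>V\<close> with \<open>carrier G \<times> U\<^sub>0\<close>.\<close>

lemma act_U0_unique:
  assumes g: "g \<in> carrier G" "g' \<in> carrier G" and u: "u \<in> U\<^sub>0" "u' \<in> U\<^sub>0" and eq: "act g u = act g' u'"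
  shows "g = g' \<and> u = u'"
proof -
  have V: "u \<in> V" "u' \<in> V" using u U0_V by auto
  have e: "u = act (inv g \<otimes> g') u'"
    using act_mult[of "inv g" g' u'] act_inv[of g u] g V eq by simp
  then have "u \<in> orbit G act u'" using g by (auto simp: orbit_def)
  then have uu: "u = u'" using U0_orbit[OF V(2)] orbit_self[OF V(2)] u by blast
  then have "inv g \<otimes> g' = \<one>" using free[of "inv g \<otimes> g'" u'] e g V by simp
  then have "g = g'" using g by (metis inv_equality inv_inv inv_closed)
  then show ?thesis using uu by simp
qed

abbreviation tr :: "'g set \<Rightarrow> 'v set" where
  "tr F \<equiv> translates act F U\<^sub>0"

lemma tr_image: "tr F = (\<lambda>(g, u). act g u) ` (F \<times> U\<^sub>0)"
  by (auto simp: translates_def)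

lemma tr_Un: "tr (A \<union> B) = tr A \<union> tr B"
  by (auto simp: translates_def)

lemma tr_mono: "A \<subseteq> B \<Longrightarrow> tr A \<subseteq> tr B"
  by (auto simp: translates_def)

lemma tr_empty: "tr {} = {}"
  by (auto simp: translates_def)

lemma tr_V: "F \<subseteq> carrier G \<Longrightarrow> tr F \<subseteq> V"
  unfolding translates_def using U0_V act_V by blast

lemma tr_finite: "finite F \<Longrightarrow> finite (tr F)"
  by (simp add: tr_image finite_U0)

lemma act_inj: "F \<subseteq> carrier G \<Longrightarrow> inj_on (\<lambda>(g, u). act g u) (F \<times> U\<^sub>0)"
  by (rule inj_onI, clarsimp) (use act_U0_unique in blast)

lemma tr_card: "F \<subseteq> carrier G \<Longrightarrow> card (tr F) = card F * card U\<^sub>0"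
  by (simp add: tr_image card_image act_inj card_cartesian_product)

lemma tr_Int:
  assumes "A \<subseteq> carrier G" "B \<subseteq> carrier G" shows "tr (A \<inter> B) = tr A \<inter> tr B"
proof -
  have "A \<times> U\<^sub>0 \<subseteq> carrier G \<times> U\<^sub>0" "B \<times> U\<^sub>0 \<subseteq> carrier G \<times> U\<^sub>0" using assms by auto
  from inj_on_image_Int[OF act_inj[OF order_refl] this] show ?thesis
    by (simp only: tr_image Times_Int_Times Int_absorb)
qed

lemma tr_Diff:
  assumes "A \<subseteq> carrier G" "B \<subseteq> A" shows "tr (A - B) = tr A - tr B"
proof -
  have "tr A = tr (A - B) \<union> tr B" using assms by (simp add: tr_Un[symmetric] Un_absorb2)
  moreover have "tr (A - B) \<inter> tr B = tr ((A - B) \<inter> B)" using assms by (intro tr_Int[symmetric]) auto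
  moreover have "(A - B) \<inter> B = {}" by auto
  ultimately show ?thesis using tr_empty by auto
qed

lemma tr_singleton_one: "tr {\<one>} = U\<^sub>0"
  using U0_V act_one by (force simp: translates_def)

lemma tr_shift: "g \<in> carrier G \<Longrightarrow> A \<subseteq> carrier G \<Longrightarrow> act g ` tr A = tr ((\<lambda>h. g \<otimes> h) ` A)"
proof -
  assume g: "g \<in> carrier G" and A: "A \<subseteq> carrier G"
  have "act g ` tr A = (\<lambda>(h, u). act g (act h u)) ` (A \<times> U\<^sub>0)"
    by (simp add: tr_image image_image case_prod_beta)
  also have "\<dots> = (\<lambda>(h, u). act (g \<otimes> h) u) ` (A \<times> U\<^sub>0)"
    using g A U0_V by (intro image_cong refl) (auto simp: act_mult subset_iff)
  also have "\<dots> = tr ((\<lambda>h. g \<otimes> h) ` A)"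
    by (force simp: tr_image)
  finally show ?thesis .
qed

lemma tr_cover:
  assumes "finite R" "R \<subseteq> V"
  obtains S where "finite S" "S \<subseteq> carrier G" "R \<subseteq> tr S"
proof -
  have "R \<subseteq> (\<lambda>(g, u). act g u) ` (carrier G \<times> U\<^sub>0)"
  proof
    fix v assume "v \<in> R"
    then have v: "v \<in> V" using assms by auto
    then obtain u where u: "u \<in> U\<^sub>0" "u \<in> orbit G act v" using U0_orbit by blast
    then obtain g where g: "g \<in> carrier G" "act g v = u" by (auto simp: orbit_def)
    then have "act (inv g) u = v" using act_inv v by auto
    then show "v \<in> (\<lambda>(g, u). act g u) ` (carrier G \<times> U\<^sub>0)" using g u by (force simp: image_iff)
  qed
  then obtain C where C: "C \<subseteq> carrier G \<times> U\<^sub>0" "finite C" "R = (\<lambda>(g, u). act g u) ` C"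
    using finite_subset_image[OF assms(1)] by metis
  show ?thesis
  proof (rule that[of "fst ` C"])
    show "R \<subseteq> tr (fst ` C)" using C by (force simp: tr_image)
  qed (use C in auto)
qed

abbreviation shift :: "'g \<Rightarrow> ('v \<Rightarrow> nat) \<Rightarrow> 'v \<Rightarrow> nat" where
  "shift g x \<equiv> config_act G V act (inv g) x"

lemma shift_eq: "g \<in> carrier G \<Longrightarrow> shift g x = (\<lambda>v\<in>V. x (act g v))"
  by (simp add: config_act_def)

lemma shift_config: "g \<in> carrier G \<Longrightarrow> x \<in> Conf \<Longrightarrow> shift g x \<in> Conf"
  using hardcore_automorphism.pull_config[OF act_automorphism, of g x]
  by (simp add: shift_eq hardcore_automorphism.pull_def[OF act_automorphism])

lemma pr_shift:
  "g \<in> carrier G \<Longrightarrow> x \<in> Conf \<Longrightarrow> finite W \<Longrightarrow> W \<subseteq> V \<Longrightarrow> pr x (act g ` W) = pr (shift g x) W"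
  using pr_automorphism[OF act_automorphism] by (simp add: shift_eq)

text \<open>Conditional information of the pattern of \<open>x\<close> on the fundamental domain, given its pattern on the
  translates by \<open>A\<close>; not yet divided by the number of orbits.\<close>

definition info :: "('v \<Rightarrow> nat) \<Rightarrow> 'g set \<Rightarrow> real" where
  "info x A = - ln (cpr x U\<^sub>0 (tr A))"

lemma cpr_translate:
  assumes g: "g \<in> carrier G" and x: "x \<in> Conf" and A: "finite A" "A \<subseteq> carrier G"
  shows "- ln (cpr x (tr {g}) (tr A)) = info (shift g x) ((\<lambda>h. inv g \<otimes> h) ` A)"
proof -
  let ?B = "(\<lambda>h. inv g \<otimes> h) ` A"
  have B: "?B \<subseteq> carrier G" "finite ?B" using g A by auto
  have "(\<lambda>h. g \<otimes> h) ` ?B = A"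
    using g A by (force simp: image_image m_assoc[symmetric] subset_iff)
  then have 1: "tr A = act g ` tr ?B"
    using tr_shift[OF g B(1)] by simp
  have 2: "tr {g} = act g ` U\<^sub>0" by (auto simp: translates_def)
  have fin: "finite (tr ?B)" "tr ?B \<subseteq> V" using B tr_finite tr_V by auto
  have "pr x (act g ` (U\<^sub>0 \<union> tr ?B)) = pr (shift g x) (U\<^sub>0 \<union> tr ?B)"
    using fin finite_U0 U0_V by (intro pr_shift g x) auto
  then show ?thesis
    unfolding info_def cpr_def 1 2 image_Un[symmetric] using pr_shift[OF g x fin] by simp
qed

text \<open>The probability of a pattern on the translates by \<open>F\<close> factors along the linear order on \<open>F\<close>
  in which \<open>past g\<close> collects the predecessors of \<open>g\<close>. The element of \<open>F\<close> with the largest past is the last one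
  in this order and is split off.\<close>

lemma chain_rule:
  fixes past :: "'g \<Rightarrow> 'g set"
  assumes x: "x \<in> Conf" and F: "finite F" "F \<subseteq> carrier G"
    and irr: "\<And>g. g \<in> carrier G \<Longrightarrow> g \<notin> past g"
    and trans: "\<And>g h. g \<in> carrier G \<Longrightarrow> h \<in> carrier G \<Longrightarrow> g \<in> past h \<Longrightarrow> past g \<subseteq> past h"
    and total: "\<And>g h. g \<in> carrier G \<Longrightarrow> h \<in> carrier G \<Longrightarrow> g \<noteq> h \<Longrightarrow> g \<in> past h \<or> h \<in> past g"
  shows "- ln (pr x (tr F)) = (\<Sum>g\<in>F. - ln (cpr x (tr {g}) (tr (past g \<inter> F))))"
  using F
proof (induction "card F" arbitrary: F)
  case 0
  then show ?case by (simp add: tr_empty pr_empty)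
next
  case (Suc n)
  have "F \<noteq> {}" using Suc.hyps(2) by auto
  then have "\<exists>m\<in>F. \<forall>g\<in>F. card (past g \<inter> F) \<le> card (past m \<inter> F)"
  proof -
    let ?c = "\<lambda>g. card (past g \<inter> F)"
    have "Max (?c ` F) \<in> ?c ` F" using \<open>F \<noteq> {}\<close> Suc.prems(1) by (intro Max_in) auto
    then obtain m where "m \<in> F" "?c m = Max (?c ` F)" by auto
    then show ?thesis using Suc.prems(1) by (intro bexI[of _ m]) auto
  qed
  then obtain m where m: "m \<in> F" "\<And>g. g \<in> F \<Longrightarrow> card (past g \<inter> F) \<le> card (past m \<inter> F)" by auto
  have pm: "past m \<inter> F = F - {m}"
  proof -
    have "g \<in> past m" if g: "g \<in> F" "g \<noteq> m" for g
    proof (rule ccontr)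
      assume "g \<notin> past m"
      then have mg: "m \<in> past g" using total[of g m] g m Suc.prems by auto
      then have "past m \<subseteq> past g" using trans[of m g] g m Suc.prems by auto
      moreover have "m \<notin> past m" using irr m Suc.prems by auto
      ultimately have "past m \<inter> F \<subset> past g \<inter> F" using mg m by auto
      then have "card (past m \<inter> F) < card (past g \<inter> F)"
        using Suc.prems by (intro psubset_card_mono) auto
      then show False using m(2)[OF g(1)] by simp
    qed
    then show ?thesis using irr[of m] m Suc.prems by auto
  qed
  have notin: "m \<notin> past g" if "g \<in> F - {m}" for g
  proof
    assume "m \<in> past g"
    moreover have "g \<in> past m" using pm that by auto
    ultimately have "m \<in> past m" using trans[of g m] that m Suc.prems by auto
    then show False using irr m Suc.prems by auto
  qed
  have F': "finite (F - {m})" "F - {m} \<subseteq> carrier G" "n = card (F - {m})"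
    using Suc m by auto
  have W: "finite (tr (F - {m}))" "tr (F - {m}) \<subseteq> V" using F' tr_finite tr_V by auto
  have W': "finite (tr {m})" "tr {m} \<subseteq> V" using m Suc.prems tr_finite[of "{m}"] tr_V[of "{m}"] by auto
  have "F = {m} \<union> (F - {m})" using m by auto
  then have "pr x (tr F) = pr x (tr {m} \<union> tr (F - {m}))" using tr_Un by metis
  also have "\<dots> = cpr x (tr {m}) (tr (F - {m})) * pr x (tr (F - {m}))"
    using pr_pos[OF x W] by (simp add: cpr_def)
  finally have "- ln (pr x (tr F)) = - ln (cpr x (tr {m}) (tr (F - {m}))) + - ln (pr x (tr (F - {m})))"
    using cpr_bounds[OF x W' W] pr_pos[OF x W] by (simp add: ln_mult)
  also have "- ln (pr x (tr (F - {m}))) = (\<Sum>g\<in>F - {m}. - ln (cpr x (tr {g}) (tr (past g \<inter> (F - {m})))))"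
    by (rule Suc.hyps(1)[OF F'(3,1,2)])
  also have "\<dots> = (\<Sum>g\<in>F - {m}. - ln (cpr x (tr {g}) (tr (past g \<inter> F))))"
  proof (rule sum.cong[OF refl])
    fix g assume "g \<in> F - {m}"
    then have "past g \<inter> (F - {m}) = past g \<inter> F" using notin by auto
    then show "- ln (cpr x (tr {g}) (tr (past g \<inter> (F - {m})))) = - ln (cpr x (tr {g}) (tr (past g \<inter> F)))" by simp
  qed
  finally show ?case
    using pm m(1) Suc.prems(1) by (simp add: sum.remove)
qed

section \<open>Uniform bounds on the information\<close>

text \<open>Independence of \<open>x\<close> matters: a vertex with value 1 has no occupied neighbour in the condition, so its
  pattern keeps a probability bounded away from 0.\<close>

lemma cpr_U0_lower:
  obtains c where "0 < c" "\<And>x A. x \<in> Conf \<Longrightarrow> finite A \<Longrightarrow> A \<subseteq> carrier G - {\<one>} \<Longrightarrow> c \<le> cpr x U\<^sub>0 (tr A)"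
proof -
  let ?N = "U\<^sub>0 \<union> E `` U\<^sub>0"
  have N: "finite ?N" "?N \<subseteq> V" using finite_U0 U0_V finite_neighbours neighbours_V by auto
  define a where "a = (\<Prod>v\<in>U\<^sub>0. min 1 (lam v))"
  define b where "b = (\<Prod>v\<in>?N. 1 + lam v)"
  have a: "0 < a" unfolding a_def using U0_V lam_pos by (intro prod_pos) auto
  have b: "0 < b" unfolding b_def using N lam_pos by (intro prod_pos) (auto simp: add_pos_pos subset_iff)
  show ?thesis
  proof (rule that[of "a / b"])
    show "0 < a / b" using a b by simp
    fix x A assume x: "x \<in> Conf" and A: "finite A" "A \<subseteq> carrier G - {\<one>}"
    have W: "finite (tr A)" "tr A \<subseteq> V" using A tr_finite tr_V by auto
    have disj: "U\<^sub>0 \<inter> tr A = {}"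
    proof -
      have "{\<one>} \<inter> A = {}" "A \<subseteq> carrier G" using A by auto
      then show ?thesis using tr_Int[of "{\<one>}" A] tr_singleton_one tr_empty by simp
    qed
    let ?D = "?N - tr A"
    have D: "finite ?D" "?D \<subseteq> V" using N by auto
    have "a \<le> wt U\<^sub>0 x"
      unfolding a_def
    proof (rule prod_mono)
      fix v assume "v \<in> U\<^sub>0"
      then have v: "v \<in> V" using U0_V by auto
      show "0 \<le> min 1 (lam v) \<and> min 1 (lam v) \<le> lam v ^ x v"
        using config_cases[OF x v] lam_pos[OF v] by auto
    qed
    moreover have "Z ?D \<le> b"
    proof -
      have "Z ?D \<le> (\<Prod>v\<in>?D. 1 + lam v)" by (rule partition_le_prod[OF D])
      also have "\<dots> \<le> b" unfolding b_def
        using N lam_pos by (intro prod_mono2) (auto simp: less_imp_le subset_iff add_nonneg_nonneg)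
      finally show ?thesis .
    qed
    ultimately have "a / b \<le> wt U\<^sub>0 x / Z ?D"
      using a partition_pos[OF D] by (intro frac_le) auto
    then have "a / b * pr x (tr A) \<le> pr x (tr A) * (wt U\<^sub>0 x / Z ?D)"
      using mult_right_mono[of "a / b" "wt U\<^sub>0 x / Z ?D" "pr x (tr A)"] pr_pos[OF x W] by (simp add: mult.commute)
    also have "\<dots> \<le> pr x (U\<^sub>0 \<union> tr A)"
      using disj by (intro pr_lower[OF x D _ W]) auto
    finally show "a / b \<le> cpr x U\<^sub>0 (tr A)"
      unfolding cpr_def by (simp only: pos_le_divide_eq[OF pr_pos[OF x W]])
  qed
qed

lemma info_bounded:
  obtains C where "0 \<le> C" "\<And>x A. x \<in> Conf \<Longrightarrow> finite A \<Longrightarrow> A \<subseteq> carrier G - {\<one>} \<Longrightarrow> 0 \<le> info x A \<and> info x A \<le> C"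
proof -
  obtain c where c: "0 < c" "\<And>x A. x \<in> Conf \<Longrightarrow> finite A \<Longrightarrow> A \<subseteq> carrier G - {\<one>} \<Longrightarrow> c \<le> cpr x U\<^sub>0 (tr A)"
    using cpr_U0_lower by metis
  show ?thesis
  proof (rule that[of "max 0 (- ln c)"])
    fix x A assume x: "x \<in> Conf" and A: "finite A" "A \<subseteq> carrier G - {\<one>}"
    have "0 < cpr x U\<^sub>0 (tr A)" "cpr x U\<^sub>0 (tr A) \<le> 1"
      using A tr_finite[of A] tr_V[of A] by (auto intro!: cpr_bounds x finite_U0 U0_V)
    then show "0 \<le> info x A \<and> info x A \<le> max 0 (- ln c)"
      using c(1) c(2)[OF x A] by (auto simp: info_def max_def intro: ln_mono)
  qed simp
qed

text \<open>The logarithm is Lipschitz on \<open>[c, 1]\<close>, where \<open>c\<close> bounds the conditional probabilities from below.\<close>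

lemma info_local:
  assumes "0 < \<epsilon>"
  obtains S where "finite S" "S \<subseteq> carrier G"
    "\<And>x A B. x \<in> Conf \<Longrightarrow> finite A \<Longrightarrow> A \<subseteq> carrier G - {\<one>} \<Longrightarrow> finite B \<Longrightarrow> B \<subseteq> carrier G - {\<one>} \<Longrightarrow>
      A \<inter> S = B \<inter> S \<Longrightarrow> \<bar>info x A - info x B\<bar> \<le> \<epsilon>"
proof -
  obtain c where c: "0 < c" "\<And>x A. x \<in> Conf \<Longrightarrow> finite A \<Longrightarrow> A \<subseteq> carrier G - {\<one>} \<Longrightarrow> c \<le> cpr x U\<^sub>0 (tr A)"
    using cpr_U0_lower by metis
  have "0 < \<epsilon> * c" using assms c by simp
  then obtain R where R: "finite R" "R \<subseteq> V" and loc: "\<And>x W W'. x \<in> Conf \<Longrightarrow> finite W \<Longrightarrow> W \<subseteq> V \<Longrightarrow> finite W' \<Longrightarrow> W' \<subseteq> V \<Longrightarrow>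
      W \<inter> U\<^sub>0 = {} \<Longrightarrow> W' \<inter> U\<^sub>0 = {} \<Longrightarrow> W \<inter> R = W' \<inter> R \<Longrightarrow> \<bar>cpr x U\<^sub>0 W - cpr x U\<^sub>0 W'\<bar> \<le> \<epsilon> * c"
    using cpr_local[OF finite_U0 U0_V] by meson
  obtain S where S: "finite S" "S \<subseteq> carrier G" "R \<subseteq> tr S" using tr_cover[OF R] by blast
  show ?thesis
  proof (rule that[OF S(1,2)])
    fix x A B assume x: "x \<in> Conf" and A: "finite A" "A \<subseteq> carrier G - {\<one>}"
      and B: "finite B" "B \<subseteq> carrier G - {\<one>}" and eq: "A \<inter> S = B \<inter> S"
    have disj: "tr A \<inter> U\<^sub>0 = {}" if "A \<subseteq> carrier G - {\<one>}" for A
    proof -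
      have "A \<inter> {\<one>} = {}" "A \<subseteq> carrier G" using that by auto
      then show ?thesis using tr_Int[of A "{\<one>}"] tr_singleton_one tr_empty by simp
    qed
    have "tr A \<inter> tr S = tr B \<inter> tr S"
      using tr_Int[of A S] tr_Int[of B S] A B S eq by auto
    then have "tr A \<inter> R = tr B \<inter> R" using S(3) by blast
    then have d: "\<bar>cpr x U\<^sub>0 (tr A) - cpr x U\<^sub>0 (tr B)\<bar> \<le> \<epsilon> * c"
      using A B by (intro loc x tr_finite tr_V disj) auto
    have p: "c \<le> cpr x U\<^sub>0 (tr A)" "c \<le> cpr x U\<^sub>0 (tr B)" using c x A B by auto
    \<comment> \<open>From \<open>ln t \<le> t - 1\<close> at \<open>t = q / p\<close>.\<close>
    have ln_le: "ln q - ln p \<le> \<epsilon>" if "c \<le> p" "c \<le> q" "\<bar>p - q\<bar> \<le> \<epsilon> * c" for p q :: real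
    proof -
      have "ln q - ln p \<le> (q - p) / p" using that c by (intro ln_diff_le) auto
      also have "\<dots> \<le> (\<epsilon> * c) / p" using that c by (intro divide_right_mono) auto
      also have "\<dots> \<le> (\<epsilon> * c) / c" using that c assms by (intro divide_left_mono) auto
      finally show ?thesis using c by simp
    qed
    show "\<bar>info x A - info x B\<bar> \<le> \<epsilon>"
      using ln_le[OF p d] ln_le[OF p(2,1)] d by (simp add: info_def abs_minus_commute abs_le_iff)
  qed
qed

end

section \<open>Cylinder probabilities and partition functions\<close>

context hardcore_action
begin

text \<open>The elements of \<open>F\<close> that some right translation by \<open>S\<close> moves out of \<open>F\<close>. All error terms are
  expressed through the size of this set for a fixed finite \<open>S\<close>.\<close>

definition right_boundary :: "'g set \<Rightarrow> 'g set \<Rightarrow> 'g set" where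
  "right_boundary F S = {g \<in> F. \<exists>s\<in>S. g \<otimes> s \<notin> F}"

definition log_activity_sum :: real where
  "log_activity_sum = (\<Sum>u\<in>U\<^sub>0. ln (1 + lam u))"

definition energy :: "('v \<Rightarrow> nat) \<Rightarrow> real" where
  "energy x = (\<Sum>u\<in>U\<^sub>0. real (x u) * ln (lam u))"

lemma lam_act: "g \<in> carrier G \<Longrightarrow> v \<in> V \<Longrightarrow> lam (act g v) = lam v"
  using hc by (simp add: hardcore_class_def)

lemma log_activity_sum_nonneg: "0 \<le> log_activity_sum"
  unfolding log_activity_sum_def using U0_V lam_pos by (intro sum_nonneg) (auto simp: subset_iff less_imp_le)

lemma prod_tr:
  fixes f :: "'v \<Rightarrow> 'b :: comm_monoid_mult"
  assumes "F \<subseteq> carrier G"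
  shows "(\<Prod>v\<in>tr F. f v) = (\<Prod>g\<in>F. \<Prod>u\<in>U\<^sub>0. f (act g u))"
  unfolding tr_image prod.reindex[OF act_inj[OF assms]] prod.cartesian_product
  by (simp add: comp_def case_prod_beta)

lemma ln_partition_tr_le:
  assumes F: "finite F" "F \<subseteq> carrier G" shows "ln (Z (tr F)) \<le> real (card F) * log_activity_sum"
proof -
  have T: "finite (tr F)" "tr F \<subseteq> V" using F tr_finite tr_V by auto
  have "ln (Z (tr F)) \<le> ln (\<Prod>v\<in>tr F. 1 + lam v)"
    using partition_pos[OF T] partition_le_prod[OF T] by (intro ln_mono)
  also have "(\<Prod>v\<in>tr F. 1 + lam v) = (\<Prod>g\<in>F. \<Prod>u\<in>U\<^sub>0. 1 + lam u)"
    unfolding prod_tr[OF F(2)] using F U0_V by (intro prod.cong refl) (auto simp: lam_act subset_iff)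
  also have "\<dots> = (\<Prod>u\<in>U\<^sub>0. 1 + lam u) ^ card F" by simp
  also have "ln \<dots> = real (card F) * ln (\<Prod>u\<in>U\<^sub>0. 1 + lam u)"
    by (rule ln_realpow)
  also have "ln (\<Prod>u\<in>U\<^sub>0. 1 + lam u) = log_activity_sum"
    unfolding log_activity_sum_def
  proof (rule ln_prod[OF finite_U0])
    fix u assume "u \<in> U\<^sub>0" then show "1 + lam u \<noteq> 0" using U0_V lam_pos[of u] by auto
  qed
  finally show ?thesis .
qed

lemma ln_wt_tr:
  assumes F: "finite F" "F \<subseteq> carrier G"
  shows "ln (wt (tr F) x) = (\<Sum>g\<in>F. energy (shift g x))"
proof -
  have "wt (tr F) x = (\<Prod>g\<in>F. \<Prod>u\<in>U\<^sub>0. lam u ^ shift g x u)"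
    unfolding prod_tr[OF F(2)] using F U0_V
    by (intro prod.cong refl) (auto simp: lam_act shift_eq subset_iff)
  also have "ln \<dots> = (\<Sum>g\<in>F. ln (\<Prod>u\<in>U\<^sub>0. lam u ^ shift g x u))"
  proof (rule ln_prod[OF F(1)])
    fix g show "wt U\<^sub>0 (shift g x) \<noteq> 0" using wt_pos[OF U0_V, of "shift g x"] by simp
  qed
  also have "\<dots> = (\<Sum>g\<in>F. energy (shift g x))"
  proof (rule sum.cong[OF refl])
    fix g
    have "ln (\<Prod>u\<in>U\<^sub>0. lam u ^ shift g x u) = (\<Sum>u\<in>U\<^sub>0. ln (lam u ^ shift g x u))"
    proof (rule ln_prod[OF finite_U0])
      fix u assume "u \<in> U\<^sub>0"
      then show "lam u ^ shift g x u \<noteq> 0" using U0_V lam_pos[of u] by auto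
    qed
    also have "\<dots> = energy (shift g x)"
      unfolding energy_def by (simp only: ln_realpow)
    finally show "ln (\<Prod>u\<in>U\<^sub>0. lam u ^ shift g x u) = energy (shift g x)" .
  qed
  finally show ?thesis .
qed

lemma ln_partition_Un_le:
  assumes "finite A" "finite B" "A \<subseteq> carrier G" "B \<subseteq> carrier G" "A \<inter> B = {}"
  shows "ln (Z (tr (A \<union> B))) \<le> ln (Z (tr A)) + real (card B) * log_activity_sum"
proof -
  have T: "finite (tr A)" "finite (tr B)" "tr A \<subseteq> V" "tr B \<subseteq> V" "tr A \<inter> tr B = {}"
    using assms tr_finite tr_V tr_Int[of A B] tr_empty by auto
  have "ln (Z (tr (A \<union> B))) \<le> ln (Z (tr A) * Z (tr B))"
    unfolding tr_Un using T partition_subadditive[OF T] by (intro ln_mono partition_pos) auto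
  also have "\<dots> = ln (Z (tr A)) + ln (Z (tr B))"
    using T partition_pos[of "tr A"] partition_pos[of "tr B"] by (simp add: ln_mult)
  finally show ?thesis using ln_partition_tr_le[OF assms(2,4)] by linarith
qed

text \<open>Up to a boundary term, the Gibbs measure gives a pattern on the translates by \<open>F\<close> the probability
  that it has in the finite model: weight divided by partition function. The set \<open>S\<close> reaches all
  neighbours of the fundamental domain, so the vertices with neighbours outside lie over
  \<^term>\<open>right_boundary F S\<close>, and those neighbours lie over its products with \<open>S\<close>.\<close>

lemma cylinder_energy:
  obtains S c where "finite S" "S \<subseteq> carrier G"
    "\<And>x F. x \<in> Conf \<Longrightarrow> finite F \<Longrightarrow> F \<subseteq> carrier G \<Longrightarrow>
      \<bar>- ln (pr x (tr F)) + (\<Sum>g\<in>F. energy (shift g x)) - ln (Z (tr F))\<bar> \<le> c * real (card (right_boundary F S))"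
proof -
  obtain S where S: "finite S" "S \<subseteq> carrier G" "E `` U\<^sub>0 \<subseteq> tr S"
    using tr_cover[OF finite_neighbours[OF finite_U0 U0_V] neighbours_V] by metis
  have nb: "E `` tr A \<subseteq> tr {g \<otimes> s | g s. g \<in> A \<and> s \<in> S}" if A: "A \<subseteq> carrier G" for A
  proof
    fix w assume "w \<in> E `` tr A"
    then obtain g u where g: "g \<in> A" and u: "u \<in> U\<^sub>0" and e: "(act g u, w) \<in> E"
      by (auto simp: translates_def)
    have gG: "g \<in> carrier G" using g A by auto
    have "act g ` (E `` U\<^sub>0) = E `` (act g ` U\<^sub>0)"
      using hardcore_automorphism.image_neighbours[OF act_automorphism[OF gG] U0_V] by simp
    then have "w \<in> act g ` tr S" using e u S(3) by blast
    then show "w \<in> tr {g \<otimes> s | g s. g \<in> A \<and> s \<in> S}"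
      unfolding tr_shift[OF gG S(2)] using g by (auto simp: translates_def)
  qed
  define c where "c = (real (card S) + 1) * log_activity_sum"
  show ?thesis
  proof (rule that[OF S(1,2), of c])
    fix x F assume x: "x \<in> Conf" and F: "finite F" "F \<subseteq> carrier G"
    let ?B = "right_boundary F S"
    have B: "finite ?B" "?B \<subseteq> F" "?B \<subseteq> carrier G" using F by (auto simp: right_boundary_def)
    have T: "finite (tr F)" "tr F \<subseteq> V" using F tr_finite tr_V by auto
    have TB: "finite (tr ?B)" "tr ?B \<subseteq> V" using B tr_finite tr_V by auto
    have wtp: "0 < wt (tr F) x" by (rule wt_pos[OF T(2)])
    have Zp: "0 < Z (tr F)" "0 < Z (tr ?B)" using partition_pos T TB by auto
    have "E `` (tr F - tr ?B) \<subseteq> tr F"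
    proof -
      have "{g \<otimes> s | g s. g \<in> F - ?B \<and> s \<in> S} \<subseteq> F" by (auto simp: right_boundary_def)
      then show ?thesis
        using nb[of "F - ?B"] tr_Diff[OF F(2) B(2)] F tr_mono by blast
    qed
    then have "pr x (tr F) \<le> wt (tr F) x / Z (tr F) * Z (tr ?B)"
      by (intro pr_upper[OF x T tr_mono[OF B(2)]])
    then have "ln (pr x (tr F)) \<le> ln (wt (tr F) x / Z (tr F) * Z (tr ?B))"
      using pr_pos[OF x T] by (intro ln_mono)
    also have "\<dots> = ln (wt (tr F) x) - ln (Z (tr F)) + ln (Z (tr ?B))"
      using wtp Zp by (simp add: ln_mult ln_div)
    also have "\<dots> \<le> ln (wt (tr F) x) - ln (Z (tr F)) + c * real (card ?B)"
    proof -
      have "real (card ?B) * log_activity_sum \<le> c * real (card ?B)"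
        using log_activity_sum_nonneg by (simp add: c_def algebra_simps mult_nonneg_nonneg)
      then show ?thesis using ln_partition_tr_le[OF B(1,3)] by linarith
    qed
    finally have upper: "ln (pr x (tr F)) \<le> ln (wt (tr F) x) - ln (Z (tr F)) + c * real (card ?B)" .
    let ?O = "(\<lambda>(g, s). g \<otimes> s) ` (?B \<times> S) - F"
    have O: "finite ?O" "?O \<subseteq> carrier G" "F \<inter> ?O = {}" using B S by auto
    have cO: "real (card ?O) \<le> real (card ?B) * real (card S)"
    proof -
      have "card ?O \<le> card ((\<lambda>(g, s). g \<otimes> s) ` (?B \<times> S))" using B S by (intro card_mono) auto
      also have "\<dots> \<le> card (?B \<times> S)" using B S by (intro card_image_le) auto
      finally show ?thesis by (metis card_cartesian_product of_nat_le_iff of_nat_mult)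
    qed
    have TO: "finite (tr (F \<union> ?O))" "tr (F \<union> ?O) \<subseteq> V"
      using F O by (intro tr_finite tr_V; auto)+
    have "E `` tr F \<subseteq> tr (F \<union> ?O) \<union> {}"
    proof -
      have "{g \<otimes> s | g s. g \<in> F \<and> s \<in> S} \<subseteq> F \<union> ?O" by (force simp: right_boundary_def)
      then show ?thesis using nb[OF F(2)] tr_mono by blast
    qed
    then have "pr x {} * (wt (tr F) x / Z (tr (F \<union> ?O))) \<le> pr x (tr F \<union> {})"
      by (intro pr_lower[OF x TO]) (auto intro!: tr_mono)
    then have "ln (wt (tr F) x / Z (tr (F \<union> ?O))) \<le> ln (pr x (tr F))"
      using wtp partition_pos[OF TO] by (intro ln_mono) (auto simp: pr_empty)
    moreover have "ln (wt (tr F) x / Z (tr (F \<union> ?O))) = ln (wt (tr F) x) - ln (Z (tr (F \<union> ?O)))"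
      using wtp partition_pos[OF TO] by (simp add: ln_div)
    moreover have "ln (Z (tr (F \<union> ?O))) \<le> ln (Z (tr F)) + real (card ?O) * log_activity_sum"
      using F O by (intro ln_partition_Un_le) auto
    moreover have "real (card ?O) * log_activity_sum \<le> c * real (card ?B)"
    proof -
      have "real (card ?O) * log_activity_sum \<le> real (card ?B) * real (card S) * log_activity_sum"
        using cO log_activity_sum_nonneg by (rule mult_right_mono)
      also have "\<dots> \<le> c * real (card ?B)"
        using log_activity_sum_nonneg by (simp add: c_def algebra_simps mult_nonneg_nonneg)
      finally show ?thesis .
    qed
    ultimately show "\<bar>- ln (pr x (tr F)) + (\<Sum>g\<in>F. energy (shift g x)) - ln (Z (tr F))\<bar> \<le> c * real (card ?B)"
      using upper unfolding ln_wt_tr[OF F] by linarith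
  qed
qed

section \<open>The infimum rule along Foelner sets\<close>

lemma partition_tr_shift:
  assumes "h \<in> carrier G" "finite K" "K \<subseteq> carrier G"
  shows "Z (tr ((\<lambda>k. h \<otimes> k) ` K)) = Z (tr K)"
  unfolding tr_shift[OF assms(1,3), symmetric]
  by (intro hardcore_automorphism.partition_automorphism act_automorphism assms tr_finite tr_V)

text \<open>The translates \<open>h K\<close> cover every element of \<open>F\<close> exactly \<^term>\<open>card K\<close> times, so the Shearer-type
  inequality applies. Translates inside \<open>F\<close> contribute the partition function of \<open>K\<close>, and there are at
  most \<^term>\<open>card F\<close> of them; the remaining ones meet the boundary of \<open>F\<close> and are estimated crudely.\<close>

lemma infimum_rule:
  assumes K: "finite K" "K \<subseteq> carrier G" "K \<noteq> {}" and F: "finite F" "F \<subseteq> carrier G"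
  defines "S \<equiv> {inv k \<otimes> k' | k k'. k \<in> K \<and> k' \<in> K}"
  shows "real (card K) * ln (Z (tr F))
    \<le> real (card F) * ln (Z (tr K)) + real (card K) * real (card K) * log_activity_sum * real (card (right_boundary F S))"
proof -
  define I where "I = (\<lambda>(g, k). g \<otimes> inv k) ` (F \<times> K)"
  \<comment> \<open>\<open>I\<close> indexes the translates \<open>h K\<close> that meet \<open>F\<close>.\<close>
  let ?hK = "\<lambda>h. (\<lambda>k. h \<otimes> k) ` K"
  have I: "finite I" "I \<subseteq> carrier G" using F K by (auto simp: I_def)
  have B: "finite (right_boundary F S)" using F by (auto simp: right_boundary_def)
  have hK: "?hK h \<subseteq> carrier G" "finite (?hK h)" "card (?hK h) \<le> card K" if "h \<in> I" for h
    using that I K by (auto intro: card_image_le)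
  have cover: "card {h \<in> I. v \<in> tr (?hK h)} = card K" if v: "v \<in> tr F" for v
  proof -
    obtain g u where g: "g \<in> F" "g \<in> carrier G" and u: "u \<in> U\<^sub>0" and vg: "v = act g u"
      using v F by (auto simp: translates_def)
    have iff: "v \<in> tr A \<longleftrightarrow> g \<in> A" if "A \<subseteq> carrier G" for A
    proof
      assume "v \<in> tr A"
      then obtain g' u' where g': "g' \<in> A" "u' \<in> U\<^sub>0" "v = act g' u'" by (auto simp: translates_def)
      then have "g' = g" using act_U0_unique[of g' g u' u] g u vg that by auto
      then show "g \<in> A" using g' by simp
    next
      assume "g \<in> A" then show "v \<in> tr A" using u vg by (auto simp: translates_def)
    qed
    have "{h \<in> I. v \<in> tr (?hK h)} = (\<lambda>k. g \<otimes> inv k) ` K"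
    proof
      show "{h \<in> I. v \<in> tr (?hK h)} \<subseteq> (\<lambda>k. g \<otimes> inv k) ` K"
      proof safe
        fix h assume h: "h \<in> I" "v \<in> tr (?hK h)"
        then obtain k where k: "k \<in> K" "g = h \<otimes> k" using iff[OF hK(1)[OF h(1)]] by auto
        have "g \<otimes> inv k = h" using k h K I by (auto simp: m_assoc subset_iff)
        then show "h \<in> (\<lambda>k. g \<otimes> inv k) ` K" using k(1) by (metis imageI)
      qed
      show "(\<lambda>k. g \<otimes> inv k) ` K \<subseteq> {h \<in> I. v \<in> tr (?hK h)}"
      proof safe
        fix k assume k: "k \<in> K"
        show i: "g \<otimes> inv k \<in> I" using g k by (auto simp: I_def)
        have "g = (g \<otimes> inv k) \<otimes> k" using g k K by (auto simp: m_assoc subset_iff)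
        then show "v \<in> tr (?hK (g \<otimes> inv k))" unfolding iff[OF hK(1)[OF i]] using k by (rule image_eqI)
      qed
    qed
    moreover have "inj_on (\<lambda>k. g \<otimes> inv k) K"
    proof (rule inj_onI)
      fix k k' assume k: "k \<in> K" "k' \<in> K" and eq: "g \<otimes> inv k = g \<otimes> inv k'"
      then have "inv k = inv k'" using g K by (auto simp: subset_iff)
      then show "k = k'" using k K by (metis inv_inv subsetD)
    qed
    ultimately show ?thesis by (simp add: card_image)
  qed
  have "real (card K) * ln (Z (tr F)) \<le> (\<Sum>h\<in>I. ln (Z (tr F \<inter> tr (?hK h))))"
    using K F I cover by (intro partition_shearer tr_finite tr_V) (auto simp: card_gt_0_iff)
  also have "\<dots> = (\<Sum>h\<in>I. ln (Z (tr (F \<inter> ?hK h))))"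
    using tr_Int[OF F(2) hK(1)] by (intro sum.cong) auto
  also have "\<dots> = (\<Sum>h\<in>{h \<in> I. ?hK h \<subseteq> F}. ln (Z (tr (F \<inter> ?hK h)))) + (\<Sum>h\<in>{h \<in> I. \<not> ?hK h \<subseteq> F}. ln (Z (tr (F \<inter> ?hK h))))"
    using I by (subst sum.union_disjoint[symmetric]) (auto intro!: sum.cong)
  also have "\<dots> \<le> real (card F) * ln (Z (tr K)) + real (card K) * real (card (right_boundary F S)) * (real (card K) * log_activity_sum)"
  proof (rule add_mono)
    have "(\<Sum>h\<in>{h \<in> I. ?hK h \<subseteq> F}. ln (Z (tr (F \<inter> ?hK h)))) = (\<Sum>h\<in>{h \<in> I. ?hK h \<subseteq> F}. ln (Z (tr K)))"
    proof (rule sum.cong[OF refl])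
      fix h assume h: "h \<in> {h \<in> I. ?hK h \<subseteq> F}"
      then have "F \<inter> ?hK h = ?hK h" by auto
      then show "ln (Z (tr (F \<inter> ?hK h))) = ln (Z (tr K))"
        using partition_tr_shift[of h K] h I K by auto
    qed
    also have "\<dots> = real (card {h \<in> I. ?hK h \<subseteq> F}) * ln (Z (tr K))" by simp
    also have "\<dots> \<le> real (card F) * ln (Z (tr K))"
    proof (rule mult_right_mono)
      obtain k where k: "k \<in> K" using K by auto
      have "inj_on (\<lambda>h. h \<otimes> k) {h \<in> I. ?hK h \<subseteq> F}"
        using k K I by (auto simp: inj_on_def subset_iff)
      then have "card {h \<in> I. ?hK h \<subseteq> F} \<le> card F"
        using k F(1) by (intro card_inj_on_le[of "\<lambda>h. h \<otimes> k"]) auto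
      then show "real (card {h \<in> I. ?hK h \<subseteq> F}) \<le> real (card F)" by simp
      show "0 \<le> ln (Z (tr K))" using partition_ge_1[of "tr K"] K tr_finite tr_V by auto
    qed
    finally show "(\<Sum>h\<in>{h \<in> I. ?hK h \<subseteq> F}. ln (Z (tr (F \<inter> ?hK h)))) \<le> real (card F) * ln (Z (tr K))" .
    have "(\<Sum>h\<in>{h \<in> I. \<not> ?hK h \<subseteq> F}. ln (Z (tr (F \<inter> ?hK h)))) \<le> (\<Sum>h\<in>{h \<in> I. \<not> ?hK h \<subseteq> F}. real (card K) * log_activity_sum)"
    proof (rule sum_mono)
      fix h assume h: "h \<in> {h \<in> I. \<not> ?hK h \<subseteq> F}"
      have "card (F \<inter> ?hK h) \<le> card (?hK h)" using h hK by (intro card_mono) auto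
      then have "real (card (F \<inter> ?hK h)) * log_activity_sum \<le> real (card K) * log_activity_sum"
        using hK(3)[of h] h log_activity_sum_nonneg by (intro mult_right_mono) auto
      moreover have "ln (Z (tr (F \<inter> ?hK h))) \<le> real (card (F \<inter> ?hK h)) * log_activity_sum"
        using F by (intro ln_partition_tr_le) auto
      ultimately show "ln (Z (tr (F \<inter> ?hK h))) \<le> real (card K) * log_activity_sum" by linarith
    qed
    also have "\<dots> = real (card {h \<in> I. \<not> ?hK h \<subseteq> F}) * (real (card K) * log_activity_sum)" by simp
    also have "\<dots> \<le> real (card K) * real (card (right_boundary F S)) * (real (card K) * log_activity_sum)"
    proof (rule mult_right_mono)
      have "{h \<in> I. \<not> ?hK h \<subseteq> F} \<subseteq> (\<lambda>(g, k). g \<otimes> inv k) ` (right_boundary F S \<times> K)"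
      proof
        fix h assume "h \<in> {h \<in> I. \<not> ?hK h \<subseteq> F}"
        then obtain k' where h: "h \<in> I" and k': "k' \<in> K" "h \<otimes> k' \<notin> F" by auto
        then obtain g k where g: "g \<in> F" "k \<in> K" "h = g \<otimes> inv k" by (auto simp: I_def)
        have "h \<otimes> k' = g \<otimes> (inv k \<otimes> k')" using g k' F K by (auto simp: m_assoc subset_iff)
        then have "g \<in> right_boundary F S" using g k' by (auto simp: right_boundary_def S_def)
        then show "h \<in> (\<lambda>(g, k). g \<otimes> inv k) ` (right_boundary F S \<times> K)" using g by auto
      qed
      then have "card {h \<in> I. \<not> ?hK h \<subseteq> F} \<le> card ((\<lambda>(g, k). g \<otimes> inv k) ` (right_boundary F S \<times> K))"
        using B K by (intro card_mono) auto
      also have "\<dots> \<le> card (right_boundary F S \<times> K)" using B K by (intro card_image_le) auto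
      finally have "card {h \<in> I. \<not> ?hK h \<subseteq> F} \<le> card K * card (right_boundary F S)"
        by (simp only: card_cartesian_product mult.commute)
      then show "real (card {h \<in> I. \<not> ?hK h \<subseteq> F}) \<le> real (card K) * real (card (right_boundary F S))"
        unfolding of_nat_mult[symmetric] of_nat_le_iff .
    qed (use log_activity_sum_nonneg in simp)
    finally show "(\<Sum>h\<in>{h \<in> I. \<not> ?hK h \<subseteq> F}. ln (Z (tr (F \<inter> ?hK h)))) \<le> real (card K) * real (card (right_boundary F S)) * (real (card K) * log_activity_sum)" .
  qed
  finally show ?thesis by (simp add: mult_ac)
qed

text \<open>Inversion turns the left invariance in the definition of amenability into right invariance.\<close>

lemma right_foelner:
  obtains F :: "nat \<Rightarrow> 'g set" where "\<And>n. finite (F n)" "\<And>n. F n \<subseteq> carrier G" "\<And>n. F n \<noteq> {}"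
    "\<And>S. finite S \<Longrightarrow> S \<subseteq> carrier G \<Longrightarrow> (\<lambda>n. real (card (right_boundary (F n) S)) / real (card (F n))) \<longlonglongrightarrow> 0"
proof -
  from amenable obtain F :: "nat \<Rightarrow> 'g set" where
      F0: "\<forall>n. F n \<subseteq> carrier G \<and> finite (F n) \<and> F n \<noteq> {}"
      and lim: "\<forall>g\<in>carrier G. (\<lambda>n. real (card (sym_diff (g <# F n) (F n))) / real (card (F n))) \<longlonglongrightarrow> 0"
    unfolding amenable_group_def by (elim conjE exE)
  have F: "F n \<subseteq> carrier G" "finite (F n)" "F n \<noteq> {}" for n using F0 by auto
  let ?F = "\<lambda>n. (\<lambda>g. inv g) ` F n"
  have inj: "inj_on (\<lambda>g. inv g) A" if "A \<subseteq> carrier G" for A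
    using that by (auto simp: inj_on_def subset_iff)
  have cF: "card (?F n) = card (F n)" for n using inj[OF F(1)] by (rule card_image)
  have count: "card (right_boundary (?F n) S) \<le> (\<Sum>s\<in>S. card (sym_diff (inv s <# F n) (F n)))"
    if S: "finite S" "S \<subseteq> carrier G" for n S
  proof -
    have "right_boundary (?F n) S \<subseteq> (\<Union>s\<in>S. {g \<in> ?F n. g \<otimes> s \<notin> ?F n})" by (auto simp: right_boundary_def)
    then have "card (right_boundary (?F n) S) \<le> card (\<Union>s\<in>S. {g \<in> ?F n. g \<otimes> s \<notin> ?F n})"
      using S F by (intro card_mono) auto
    also have "\<dots> \<le> (\<Sum>s\<in>S. card {g \<in> ?F n. g \<otimes> s \<notin> ?F n})" by (rule card_UN_le[OF S(1)])
    also have "\<dots> \<le> (\<Sum>s\<in>S. card (sym_diff (inv s <# F n) (F n)))"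
    proof (rule sum_mono)
      fix s assume "s \<in> S"
      then have s: "s \<in> carrier G" using S by auto
      show "card {g \<in> ?F n. g \<otimes> s \<notin> ?F n} \<le> card (sym_diff (inv s <# F n) (F n))"
      proof (rule card_inj_on_le[of "\<lambda>g. inv (g \<otimes> s)"])
        show "inj_on (\<lambda>g. inv (g \<otimes> s)) {g \<in> ?F n. g \<otimes> s \<notin> ?F n}"
        proof (rule inj_onI)
          fix g g' assume "g \<in> {g \<in> ?F n. g \<otimes> s \<notin> ?F n}" "g' \<in> {g \<in> ?F n. g \<otimes> s \<notin> ?F n}"
            and eq: "inv (g \<otimes> s) = inv (g' \<otimes> s)"
          then have g: "g \<in> carrier G" "g' \<in> carrier G" using F(1)[of n] by auto
          then have "g \<otimes> s = g' \<otimes> s" using eq s by (metis inv_inv m_closed)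
          then show "g = g'" using g s by simp
        qed
        show "(\<lambda>g. inv (g \<otimes> s)) ` {g \<in> ?F n. g \<otimes> s \<notin> ?F n} \<subseteq> sym_diff (inv s <# F n) (F n)"
        proof safe
          fix f assume f: "f \<in> F n" and ni: "inv f \<otimes> s \<notin> ?F n"
          have fG: "f \<in> carrier G" using f F by auto
          have eq: "inv (inv f \<otimes> s) = inv s \<otimes> f" using fG s by (simp add: inv_mult_group)
          show "inv (inv f \<otimes> s) \<in> inv s <# F n" unfolding eq using f by (auto simp: l_coset_def)
          assume "inv (inv f \<otimes> s) \<in> F n"
          then have "inv (inv (inv f \<otimes> s)) \<in> ?F n" by (rule imageI)
          then show False using ni fG s by simp
        qed
        show "finite (sym_diff (inv s <# F n) (F n))"
          using F(2)[of n] by (auto simp: l_coset_def)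
      qed
    qed
    finally show ?thesis .
  qed
  show ?thesis
  proof (rule that[of ?F])
    fix S assume S: "finite S" "S \<subseteq> carrier G"
    have "(\<lambda>n. \<Sum>s\<in>S. real (card (sym_diff (inv s <# F n) (F n))) / real (card (F n))) \<longlonglongrightarrow> (\<Sum>s\<in>S. 0)"
      using S by (intro tendsto_sum lim[rule_format]) auto
    then have "(\<lambda>n. \<Sum>s\<in>S. real (card (sym_diff (inv s <# F n) (F n))) / real (card (F n))) \<longlonglongrightarrow> 0" by simp
    then show "(\<lambda>n. real (card (right_boundary (?F n) S)) / real (card (?F n))) \<longlonglongrightarrow> 0"
    proof (rule tendsto_sandwich[OF _ _ tendsto_const, rotated 2])
      show "\<forall>\<^sub>F n in sequentially. real (card (right_boundary (?F n) S)) / real (card (?F n))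
          \<le> (\<Sum>s\<in>S. real (card (sym_diff (inv s <# F n) (F n))) / real (card (F n)))"
      proof (rule always_eventually, rule allI)
        fix n
        have "real (card (right_boundary (?F n) S)) \<le> (\<Sum>s\<in>S. real (card (sym_diff (inv s <# F n) (F n))))"
          using count[OF S, of n] unfolding of_nat_sum[symmetric] of_nat_le_iff .
        then show "real (card (right_boundary (?F n) S)) / real (card (?F n))
          \<le> (\<Sum>s\<in>S. real (card (sym_diff (inv s <# F n) (F n))) / real (card (F n)))"
          unfolding cF sum_divide_distrib[symmetric] by (rule divide_right_mono) simp
      qed
    qed simp
  qed (use F in auto)
qed

end

section \<open>The information function of a random past\<close>

lemma measurable_finite_pattern:
  fixes f :: "'k set \<Rightarrow> real"
  assumes "finite K" "\<And>k. k \<in> K \<Longrightarrow> {\<omega> \<in> space M. p k \<omega>} \<in> sets M"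
  shows "(\<lambda>\<omega>. f {k \<in> K. p k \<omega>}) \<in> borel_measurable M"
  using assms
proof (induction K arbitrary: f rule: finite_induct)
  case empty
  then show ?case by simp
next
  case (insert a K)
  have "(\<lambda>\<omega>. if p a \<omega> then f (insert a {k \<in> K. p k \<omega>}) else f {k \<in> K. p k \<omega>}) \<in> borel_measurable M"
    using insert.IH[of "\<lambda>A. f (insert a A)"] insert.IH[of f] insert.prems
    by (intro measurable_If) auto
  also have "(\<lambda>\<omega>. if p a \<omega> then f (insert a {k \<in> K. p k \<omega>}) else f {k \<in> K. p k \<omega>})
      = (\<lambda>\<omega>. f {k \<in> insert a K. p k \<omega>})"
  proof
    fix \<omega>
    have "{k \<in> insert a K. p k \<omega>} = (if p a \<omega> then insert a {k \<in> K. p k \<omega>} else {k \<in> K. p k \<omega>})" by auto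
    then show "(if p a \<omega> then f (insert a {k \<in> K. p k \<omega>}) else f {k \<in> K. p k \<omega>}) = f {k \<in> insert a K. p k \<omega>}"
      by simp
  qed
  finally show ?case .
qed

lemma cube_coordinate_event:
  assumes "i \<in> I" shows "{x \<in> space (borel_of (cube_topology I)). x i = 1} \<in> sets (borel_of (cube_topology I))"
proof -
  have "openin (cube_topology I) {x \<in> topspace (cube_topology I). x i \<in> {1}}"
    using assms by (intro openin_continuous_map_preimage[OF continuous_map_cube_coordinate]) auto
  then show ?thesis using openin_sets_borel_of by fastforce
qed

locale hardcore_past = hardcore_action V E lam P G act U\<^sub>0
  for V :: "'v set" and E and lam :: "'v \<Rightarrow> real" and P
    and G :: "('g, 'm) monoid_scheme" (structure) and act and U\<^sub>0 +
  fixes En :: "nat \<Rightarrow> 'g set" and \<nu> :: "('g \<Rightarrow> 'g \<Rightarrow> nat) measure"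
  assumes exhaust: "exhaustion G En" and random_past: "invariant_random_past G \<nu>"
begin

abbreviation past :: "('g \<Rightarrow> 'g \<Rightarrow> nat) \<Rightarrow> 'g \<Rightarrow> 'g set" where
  "past \<Phi> g \<equiv> past_set G \<Phi> g"

lemma En: "incseq En" "finite (En n)" "En n \<subseteq> carrier G" "(\<Union>n. En n) = carrier G"
  using exhaust by (auto simp: exhaustion_def)

lemma En_covers:
  assumes "finite S" "S \<subseteq> carrier G" obtains N where "\<And>n. N \<le> n \<Longrightarrow> S \<subseteq> En n"
proof -
  have "\<exists>N. S \<subseteq> En N"
    using assms
  proof (induction S rule: finite_induct)
    case (insert s S)
    then obtain N where "S \<subseteq> En N" by auto
    moreover obtain M where "s \<in> En M" using insert.prems En(4) by auto
    moreover have "En N \<subseteq> En (max N M)" "En M \<subseteq> En (max N M)"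
      using En(1) by (auto simp: incseq_def)
    ultimately show ?case by (intro exI[of _ "max N M"]) auto
  qed simp
  then obtain N where "S \<subseteq> En N" ..
  then show ?thesis using En(1) by (intro that[of N]) (auto simp: incseq_def)
qed

lemma prob_nu: "prob_space \<nu>" and sets_nu: "sets \<nu> = sets (past_space G)"
  using random_past by (auto simp: invariant_random_past_def)

lemma past_G: "past \<Phi> g \<subseteq> carrier G"
  by (auto simp: past_set_def)

lemma past_order:
  "AE \<Phi> in \<nu>. (\<forall>g\<in>carrier G. g \<notin> past \<Phi> g) \<and>
     (\<forall>g\<in>carrier G. \<forall>h\<in>carrier G. g \<in> past \<Phi> h \<longrightarrow> past \<Phi> g \<subseteq> past \<Phi> h) \<and>
     (\<forall>g\<in>carrier G. \<forall>h\<in>carrier G. g \<noteq> h \<longrightarrow> g \<in> past \<Phi> h \<or> h \<in> past \<Phi> g)"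
  using random_past by (simp add: invariant_random_past_def)

lemma continuous_past_coordinate:
  "g \<in> carrier G \<Longrightarrow> continuous_map (product_topology (\<lambda>_. cube_topology (carrier G)) (carrier G))
    (cube_topology (carrier G)) (\<lambda>\<Phi>. \<Phi> g)"
  by (rule continuous_map_product_projection)

lemma past_event:
  assumes "g \<in> carrier G" "h \<in> carrier G" shows "{\<Phi> \<in> space \<nu>. h \<in> past \<Phi> g} \<in> sets \<nu>"
proof -
  have m: "(\<lambda>\<Phi>. \<Phi> g) \<in> measurable \<nu> (borel_of (cube_topology (carrier G)))"
    using continuous_map_measurable[OF continuous_past_coordinate[OF assms(1)]]
    by (simp add: past_space_def[symmetric] cong: measurable_cong_sets[OF sets_nu refl])
  have "(\<lambda>\<Phi>. \<Phi> g) -` {x \<in> space (borel_of (cube_topology (carrier G))). x h = 1} \<inter> space \<nu> \<in> sets \<nu>"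
    by (rule measurable_sets[OF m cube_coordinate_event[OF assms(2)]])
  also have "(\<lambda>\<Phi>. \<Phi> g) -` {x \<in> space (borel_of (cube_topology (carrier G))). x h = 1} \<inter> space \<nu> = {\<Phi> \<in> space \<nu>. h \<in> past \<Phi> g}"
    using measurable_space[OF m] assms(2) by (auto simp: past_set_def simp del: topspace_cube space_borel_of)
  finally show ?thesis .
qed

lemma past_pattern_measurable:
  assumes "g \<in> carrier G" "finite F" "F \<subseteq> carrier G"
  shows "(\<lambda>\<Phi>. f (past \<Phi> g \<inter> F) :: real) \<in> borel_measurable \<nu>"
proof -
  have "(\<lambda>\<Phi>. f {h \<in> F. h \<in> past \<Phi> g}) \<in> borel_measurable \<nu>"
    using assms by (intro measurable_finite_pattern past_event) auto
  moreover have "{h \<in> F. h \<in> past \<Phi> g} = past \<Phi> g \<inter> F" for \<Phi> by auto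
  ultimately show ?thesis by simp
qed

lemma past_pattern_integrable:
  assumes "g \<in> carrier G" "finite F" "F \<subseteq> carrier G"
  shows "integrable \<nu> (\<lambda>\<Phi>. f (past \<Phi> g \<inter> F) :: real)"
proof -
  interpret prob_space \<nu> by (rule prob_nu)
  let ?B = "\<Sum>A\<in>Pow F. \<bar>f A\<bar>"
  have "\<bar>f (past \<Phi> g \<inter> F)\<bar> \<le> ?B" for \<Phi>
    using assms(2) member_le_sum[of "past \<Phi> g \<inter> F" "Pow F" "\<lambda>A. \<bar>f A\<bar>"] by auto
  then show ?thesis
    by (intro integrable_const_bound[of _ ?B] past_pattern_measurable assms) auto
qed

text \<open>The invariance of the random past is an equality of laws on the space of subsets of \<open>G\<close>; here it is
  transferred to functions of the trace of the past on a finite set. Both maps into the space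
  of subsets are continuous, hence measurable.\<close>

lemma past_shift_expectation:
  fixes f :: "'g set \<Rightarrow> real"
  assumes g: "g \<in> carrier G" and F: "finite F" "F \<subseteq> carrier G"
  shows "(\<integral>\<Phi>. f (past \<Phi> g \<inter> F) \<partial>\<nu>) = (\<integral>\<Phi>. f ((g <# past \<Phi> \<one>) \<inter> F) \<partial>\<nu>)"
proof -
  let ?N = "borel_of (cube_topology (carrier G))"
  let ?T = "product_topology (\<lambda>_. cube_topology (carrier G)) (carrier G)"
  let ?b = "\<lambda>\<Phi>. \<lambda>h\<in>carrier G. of_bool (h \<in> g <# past \<Phi> \<one>) :: nat"
  let ?f = "\<lambda>\<psi>. f {k \<in> F. \<psi> k = (1::nat)}"
  have nuT: "measurable \<nu> ?N = measurable (borel_of ?T) ?N"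
    by (rule measurable_cong_sets) (simp_all add: sets_nu past_space_def)
  have a: "(\<lambda>\<Phi>. \<Phi> g) \<in> measurable \<nu> ?N"
    unfolding nuT by (rule continuous_map_measurable[OF continuous_past_coordinate[OF g]])
  have b: "?b \<in> measurable \<nu> ?N"
    unfolding nuT
  proof (rule continuous_map_measurable)
    show "continuous_map ?T (cube_topology (carrier G)) ?b"
      unfolding cube_topology_def[of "carrier G"] continuous_map_componentwise
    proof (intro conjI ballI)
      show "?b ` topspace (product_topology (\<lambda>_. product_topology (\<lambda>_. discrete_topology {0, 1}) (carrier G)) (carrier G)) \<subseteq> extensional (carrier G)"
        by auto
      fix h assume h: "h \<in> carrier G"
      have "continuous_map ?T (discrete_topology {0, 1}) (\<lambda>\<Phi>. \<Phi> \<one> (inv g \<otimes> h))"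
        using continuous_map_compose[OF continuous_past_coordinate[OF one_closed] continuous_map_cube_coordinate[of "inv g \<otimes> h"]] g h
        by (simp add: comp_def)
      moreover have "\<Phi> \<one> (inv g \<otimes> h) = ?b \<Phi> h" if "\<Phi> \<in> topspace ?T" for \<Phi>
      proof -
        have "\<Phi> \<one> \<in> carrier G \<rightarrow>\<^sub>E {0, 1}" using that by (auto simp: PiE_iff)
        then have v: "\<Phi> \<one> (inv g \<otimes> h) = 0 \<or> \<Phi> \<one> (inv g \<otimes> h) = 1" using g h by (auto simp: PiE_iff)
        have "h \<in> g <# past \<Phi> \<one> \<longleftrightarrow> \<Phi> \<one> (inv g \<otimes> h) = 1"
        proof
          assume "h \<in> g <# past \<Phi> \<one>"
          then obtain k where "k \<in> carrier G" "\<Phi> \<one> k = 1" "h = g \<otimes> k"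
            by (auto simp: l_coset_def past_set_def)
          then show "\<Phi> \<one> (inv g \<otimes> h) = 1" using g by (simp add: m_assoc[symmetric])
        next
          assume "\<Phi> \<one> (inv g \<otimes> h) = 1"
          then have "inv g \<otimes> h \<in> past \<Phi> \<one>" using g h by (auto simp: past_set_def)
          moreover have "h = g \<otimes> (inv g \<otimes> h)" using g h by (simp add: m_assoc[symmetric])
          ultimately show "h \<in> g <# past \<Phi> \<one>" by (auto simp: l_coset_def)
        qed
        then show ?thesis using v h by auto
      qed
      ultimately show "continuous_map (product_topology (\<lambda>_. product_topology (\<lambda>_. discrete_topology {0, 1}) (carrier G)) (carrier G))
          (discrete_topology {0, 1}) (\<lambda>\<Phi>. ?b \<Phi> h)"
        unfolding cube_topology_def by (rule continuous_map_eq)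
    qed
  qed
  have f: "?f \<in> borel_measurable ?N"
    using F by (intro measurable_finite_pattern cube_coordinate_event) auto
  have "{k \<in> F. \<Phi> g k = 1} = past \<Phi> g \<inter> F" for \<Phi>
    using F by (auto simp: past_set_def)
  then have "(\<integral>\<Phi>. f (past \<Phi> g \<inter> F) \<partial>\<nu>) = (\<integral>\<psi>. ?f \<psi> \<partial>(distr \<nu> ?N (\<lambda>\<Phi>. \<Phi> g)))"
    unfolding integral_distr[OF a f] by simp
  also have "distr \<nu> ?N (\<lambda>\<Phi>. \<Phi> g) = distr \<nu> ?N ?b"
    using random_past g by (simp add: invariant_random_past_def)
  also have "(\<integral>\<psi>. ?f \<psi> \<partial>(distr \<nu> ?N ?b)) = (\<integral>\<Phi>. ?f (?b \<Phi>) \<partial>\<nu>)"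
    by (rule integral_distr[OF b f])
  also have "\<dots> = (\<integral>\<Phi>. f ((g <# past \<Phi> \<one>) \<inter> F) \<partial>\<nu>)"
  proof -
    have "{k \<in> F. ?b \<Phi> k = 1} = (g <# past \<Phi> \<one>) \<inter> F" for \<Phi> using F by auto
    then show ?thesis by simp
  qed
  finally show ?thesis .
qed

text \<open>The mean of \<^term>\<open>info\<close> over the random past, when only the part in \<open>T\<close> of the past is revealed.\<close>

definition finite_info :: "'g set \<Rightarrow> ('v \<Rightarrow> nat) \<Rightarrow> real" where
  "finite_info T x = (\<integral>\<Phi>. info x (past \<Phi> \<one> \<inter> T) \<partial>\<nu>)"

definition limit_info :: "('v \<Rightarrow> nat) \<Rightarrow> ('g \<Rightarrow> 'g \<Rightarrow> nat) \<Rightarrow> real" where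
  "limit_info x \<Phi> = lim (\<lambda>n. info x (past \<Phi> \<one> \<inter> En n))"

text \<open>The expected information, multiplied by the number of orbits.\<close>

definition mean_info :: "('v \<Rightarrow> nat) \<Rightarrow> real" where
  "mean_info x = (\<integral>\<Phi>. limit_info x \<Phi> \<partial>\<nu>)"

lemma one_not_past: "AE \<Phi> in \<nu>. \<one> \<notin> past \<Phi> \<one>"
  using past_order by eventually_elim auto

lemma limit_info_bound:
  assumes "0 < \<epsilon>"
  obtains S where "finite S" "S \<subseteq> carrier G"
    "\<And>x \<Phi> T. x \<in> Conf \<Longrightarrow> \<one> \<notin> past \<Phi> \<one> \<Longrightarrow> finite T \<Longrightarrow> T \<subseteq> carrier G \<Longrightarrow> S \<subseteq> T \<Longrightarrow>
      \<forall>\<^sub>F n in sequentially. \<bar>info x (past \<Phi> \<one> \<inter> T) - info x (past \<Phi> \<one> \<inter> En n)\<bar> \<le> \<epsilon>"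
proof -
  obtain S where S: "finite S" "S \<subseteq> carrier G" and loc:
    "\<And>x A B. x \<in> Conf \<Longrightarrow> finite A \<Longrightarrow> A \<subseteq> carrier G - {\<one>} \<Longrightarrow> finite B \<Longrightarrow> B \<subseteq> carrier G - {\<one>} \<Longrightarrow>
      A \<inter> S = B \<inter> S \<Longrightarrow> \<bar>info x A - info x B\<bar> \<le> \<epsilon>"
    using info_local[OF assms] by metis
  obtain N where N: "\<And>n. N \<le> n \<Longrightarrow> S \<subseteq> En n" using En_covers[OF S] by metis
  show ?thesis
  proof (rule that[OF S])
    fix x \<Phi> T assume x: "x \<in> Conf" and one: "\<one> \<notin> past \<Phi> \<one>" and T: "finite T" "T \<subseteq> carrier G" "S \<subseteq> T"
    have "\<bar>info x (past \<Phi> \<one> \<inter> T) - info x (past \<Phi> \<one> \<inter> En n)\<bar> \<le> \<epsilon>" if "N \<le> n" for n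
      using N[OF that] one T En(2)[of n] past_G[of \<Phi> \<one>] by (intro loc[OF x]) auto
    then show "\<forall>\<^sub>F n in sequentially. \<bar>info x (past \<Phi> \<one> \<inter> T) - info x (past \<Phi> \<one> \<inter> En n)\<bar> \<le> \<epsilon>"
      unfolding eventually_sequentially by blast
  qed
qed

lemma limit_info_LIMSEQ:
  assumes x: "x \<in> Conf" and one: "\<one> \<notin> past \<Phi> \<one>"
  shows "(\<lambda>n. info x (past \<Phi> \<one> \<inter> En n)) \<longlonglongrightarrow> limit_info x \<Phi>"
proof -
  let ?f = "\<lambda>n. info x (past \<Phi> \<one> \<inter> En n)"
  have "Cauchy ?f"
    unfolding Cauchy_def
  proof (intro allI impI)
    fix e :: real assume e: "0 < e"
    then have "0 < e / 3" by simp
    then obtain S where S: "finite S" "S \<subseteq> carrier G"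
      "\<And>x \<Phi> T. x \<in> Conf \<Longrightarrow> \<one> \<notin> past \<Phi> \<one> \<Longrightarrow> finite T \<Longrightarrow> T \<subseteq> carrier G \<Longrightarrow> S \<subseteq> T \<Longrightarrow>
        \<forall>\<^sub>F n in sequentially. \<bar>info x (past \<Phi> \<one> \<inter> T) - info x (past \<Phi> \<one> \<inter> En n)\<bar> \<le> e / 3"
      using limit_info_bound by metis
    from S(3)[OF x one S(1,2) order_refl]
    obtain N where N: "\<And>n. N \<le> n \<Longrightarrow> \<bar>info x (past \<Phi> \<one> \<inter> S) - ?f n\<bar> \<le> e / 3"
      by (auto simp: eventually_sequentially)
    have "dist (?f m) (?f n) < e" if "N \<le> m" "N \<le> n" for m n
      using N[OF that(1)] N[OF that(2)] e unfolding dist_real_def by linarith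
    then show "\<exists>M. \<forall>m\<ge>M. \<forall>n\<ge>M. dist (?f m) (?f n) < e" by blast
  qed
  then have "convergent ?f" by (simp add: Cauchy_convergent_iff)
  then show ?thesis unfolding limit_info_def by (simp add: convergent_LIMSEQ_iff)
qed

text \<open>The estimate is uniform in \<open>x\<close> and in the past, and \<open>T\<close> is an arbitrary finite set containing \<open>S\<close>,
  not only a member of the exhaustion: the sets \<open>g\<inverse>F\<close> are used for \<open>T\<close> below.\<close>

lemma limit_info_approx:
  assumes "0 < \<epsilon>"
  obtains S where "finite S" "S \<subseteq> carrier G"
    "\<And>x \<Phi> T. x \<in> Conf \<Longrightarrow> \<one> \<notin> past \<Phi> \<one> \<Longrightarrow> finite T \<Longrightarrow> T \<subseteq> carrier G \<Longrightarrow> S \<subseteq> T \<Longrightarrow>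
      \<bar>info x (past \<Phi> \<one> \<inter> T) - limit_info x \<Phi>\<bar> \<le> \<epsilon>"
proof -
  obtain S where S: "finite S" "S \<subseteq> carrier G"
      "\<And>x \<Phi> T. x \<in> Conf \<Longrightarrow> \<one> \<notin> past \<Phi> \<one> \<Longrightarrow> finite T \<Longrightarrow> T \<subseteq> carrier G \<Longrightarrow> S \<subseteq> T \<Longrightarrow>
        \<forall>\<^sub>F n in sequentially. \<bar>info x (past \<Phi> \<one> \<inter> T) - info x (past \<Phi> \<one> \<inter> En n)\<bar> \<le> \<epsilon>"
    using limit_info_bound[OF assms] by metis
  show ?thesis
  proof (rule that[OF S(1,2)])
    fix x \<Phi> T assume x: "x \<in> Conf" and one: "\<one> \<notin> past \<Phi> \<one>" and T: "finite T" "T \<subseteq> carrier G" "S \<subseteq> T"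
    have "(\<lambda>n. \<bar>info x (past \<Phi> \<one> \<inter> T) - info x (past \<Phi> \<one> \<inter> En n)\<bar>) \<longlonglongrightarrow> \<bar>info x (past \<Phi> \<one> \<inter> T) - limit_info x \<Phi>\<bar>"
      by (intro tendsto_intros limit_info_LIMSEQ x one)
    then show "\<bar>info x (past \<Phi> \<one> \<inter> T) - limit_info x \<Phi>\<bar> \<le> \<epsilon>"
      by (rule tendsto_upperbound[OF _ S(3)[OF x one T]]) simp
  qed
qed

lemma limit_info_measurable: "limit_info x \<in> borel_measurable \<nu>"
  unfolding limit_info_def by (intro borel_measurable_lim_metric past_pattern_measurable one_closed En)

lemma info_uniform_bound:
  obtains C where "0 \<le> C"
    "\<And>x \<Phi> T. x \<in> Conf \<Longrightarrow> \<one> \<notin> past \<Phi> \<one> \<Longrightarrow> finite T \<Longrightarrow> T \<subseteq> carrier G \<Longrightarrow>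
      0 \<le> info x (past \<Phi> \<one> \<inter> T) \<and> info x (past \<Phi> \<one> \<inter> T) \<le> C"
    "\<And>x \<Phi>. x \<in> Conf \<Longrightarrow> \<one> \<notin> past \<Phi> \<one> \<Longrightarrow> 0 \<le> limit_info x \<Phi> \<and> limit_info x \<Phi> \<le> C"
proof -
  obtain C where C: "0 \<le> C" "\<And>x A. x \<in> Conf \<Longrightarrow> finite A \<Longrightarrow> A \<subseteq> carrier G - {\<one>} \<Longrightarrow> 0 \<le> info x A \<and> info x A \<le> C"
    using info_bounded by metis
  have 1: "0 \<le> info x (past \<Phi> \<one> \<inter> T) \<and> info x (past \<Phi> \<one> \<inter> T) \<le> C"
    if "x \<in> Conf" "\<one> \<notin> past \<Phi> \<one>" "finite T" "T \<subseteq> carrier G" for x \<Phi> T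
    using that past_G[of \<Phi> \<one>] by (intro C(2)) auto
  show ?thesis
  proof (rule that[OF C(1) 1])
    fix x \<Phi> assume x: "x \<in> Conf" and one: "\<one> \<notin> past \<Phi> \<one>"
    show "0 \<le> limit_info x \<Phi> \<and> limit_info x \<Phi> \<le> C"
      using 1[OF x one En(2,3)]
      by (auto intro!: LIMSEQ_le_const[OF limit_info_LIMSEQ[OF x one]] LIMSEQ_le_const2[OF limit_info_LIMSEQ[OF x one]])
  qed
qed

lemma limit_info_integrable: assumes "x \<in> Conf" shows "integrable \<nu> (limit_info x)"
proof -
  interpret prob_space \<nu> by (rule prob_nu)
  obtain C where C: "\<And>x \<Phi>. x \<in> Conf \<Longrightarrow> \<one> \<notin> past \<Phi> \<one> \<Longrightarrow> 0 \<le> limit_info x \<Phi> \<and> limit_info x \<Phi> \<le> C"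
    using info_uniform_bound by metis
  have "AE \<Phi> in \<nu>. norm (limit_info x \<Phi>) \<le> C"
    using one_not_past by eventually_elim (use C[OF assms] in auto)
  then show ?thesis by (rule integrable_const_bound) (rule limit_info_measurable)
qed

lemma mean_info_bounds:
  obtains C where "0 \<le> C" "\<And>x. x \<in> Conf \<Longrightarrow> 0 \<le> mean_info x \<and> mean_info x \<le> C"
    "\<And>x T. x \<in> Conf \<Longrightarrow> finite T \<Longrightarrow> T \<subseteq> carrier G \<Longrightarrow> 0 \<le> finite_info T x \<and> finite_info T x \<le> C"
proof -
  interpret prob_space \<nu> by (rule prob_nu)
  obtain C where C: "0 \<le> C"
    "\<And>x \<Phi> T. x \<in> Conf \<Longrightarrow> \<one> \<notin> past \<Phi> \<one> \<Longrightarrow> finite T \<Longrightarrow> T \<subseteq> carrier G \<Longrightarrow>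
      0 \<le> info x (past \<Phi> \<one> \<inter> T) \<and> info x (past \<Phi> \<one> \<inter> T) \<le> C"
    "\<And>x \<Phi>. x \<in> Conf \<Longrightarrow> \<one> \<notin> past \<Phi> \<one> \<Longrightarrow> 0 \<le> limit_info x \<Phi> \<and> limit_info x \<Phi> \<le> C"
    using info_uniform_bound by metis
  have bound: "0 \<le> integral\<^sup>L \<nu> f \<and> integral\<^sup>L \<nu> f \<le> C"
    if f: "integrable \<nu> f" and b: "\<And>\<Phi>. \<one> \<notin> past \<Phi> \<one> \<Longrightarrow> 0 \<le> f \<Phi> \<and> f \<Phi> \<le> C" for f
  proof
    show "0 \<le> integral\<^sup>L \<nu> f"
      using one_not_past b by (intro integral_nonneg_AE) (auto elim!: eventually_mono)
    have "integral\<^sup>L \<nu> f \<le> (\<integral>_. C \<partial>\<nu>)"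
      using one_not_past b by (intro integral_mono_AE f) (auto elim!: eventually_mono)
    then show "integral\<^sup>L \<nu> f \<le> C" by (simp add: prob_space)
  qed
  show ?thesis
  proof (rule that[OF C(1)])
    show "0 \<le> mean_info x \<and> mean_info x \<le> C" if "x \<in> Conf" for x
      unfolding mean_info_def using that by (intro bound limit_info_integrable C(3))
    show "0 \<le> finite_info T x \<and> finite_info T x \<le> C" if "x \<in> Conf" "finite T" "T \<subseteq> carrier G" for x T
      unfolding finite_info_def using that by (intro bound past_pattern_integrable one_closed C(2))
  qed
qed

lemma mean_info_approx:
  assumes "0 < \<epsilon>"
  obtains S where "finite S" "S \<subseteq> carrier G"
    "\<And>x T. x \<in> Conf \<Longrightarrow> finite T \<Longrightarrow> T \<subseteq> carrier G \<Longrightarrow> S \<subseteq> T \<Longrightarrow> \<bar>finite_info T x - mean_info x\<bar> \<le> \<epsilon>"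
proof -
  interpret prob_space \<nu> by (rule prob_nu)
  obtain S where S: "finite S" "S \<subseteq> carrier G"
    "\<And>x \<Phi> T. x \<in> Conf \<Longrightarrow> \<one> \<notin> past \<Phi> \<one> \<Longrightarrow> finite T \<Longrightarrow> T \<subseteq> carrier G \<Longrightarrow> S \<subseteq> T \<Longrightarrow>
      \<bar>info x (past \<Phi> \<one> \<inter> T) - limit_info x \<Phi>\<bar> \<le> \<epsilon>"
    using limit_info_approx[OF assms] by metis
  show ?thesis
  proof (rule that[OF S(1,2)])
    fix x T assume x: "x \<in> Conf" and T: "finite T" "T \<subseteq> carrier G" "S \<subseteq> T"
    have i: "integrable \<nu> (\<lambda>\<Phi>. info x (past \<Phi> \<one> \<inter> T))" by (intro past_pattern_integrable one_closed T)
    have j: "integrable \<nu> (limit_info x)" by (rule limit_info_integrable[OF x])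
    have "\<bar>finite_info T x - mean_info x\<bar> = \<bar>\<integral>\<Phi>. info x (past \<Phi> \<one> \<inter> T) - limit_info x \<Phi> \<partial>\<nu>\<bar>"
      unfolding finite_info_def mean_info_def using i j by simp
    also have "\<dots> \<le> (\<integral>\<Phi>. \<bar>info x (past \<Phi> \<one> \<inter> T) - limit_info x \<Phi>\<bar> \<partial>\<nu>)"
      by (rule integral_abs_bound)
    also have "\<dots> \<le> (\<integral>_. \<epsilon> \<partial>\<nu>)"
      using one_not_past i j S(3)[OF x _ T]
      by (intro integral_mono_AE) (auto elim!: eventually_mono)
    finally show "\<bar>finite_info T x - mean_info x\<bar> \<le> \<epsilon>" by (simp add: prob_space)
  qed
qed

text \<open>Only the coordinates in a finite set matter, so the configuration may be replaced by the indicator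
  function of its ones in that set.\<close>

lemma finite_info_measurable:
  assumes M: "sets M = sets (config_space V E)" and T: "finite T" "T \<subseteq> carrier G"
  shows "finite_info T \<in> borel_measurable M"
proof -
  let ?W = "U\<^sub>0 \<union> tr T"
  have W: "finite ?W" "?W \<subseteq> V" using T tr_finite tr_V finite_U0 U0_V by auto
  have sp: "space M = Conf" using sets_eq_imp_space_eq[OF M] space_config_space by simp
  let ?h = "\<lambda>B. finite_info T (\<lambda>v. of_bool (v \<in> B))"
  have "(\<lambda>x. ?h {v \<in> ?W. x v = 1}) \<in> borel_measurable M"
    using W coordinate_measurable[of _ 1]
    by (intro measurable_finite_pattern) (auto simp: M sp)
  moreover have "?h {v \<in> ?W. x v = 1} = finite_info T x" if "x \<in> space M" for x
  proof -
    have eq: "of_bool (v \<in> {v \<in> ?W. x v = 1}) = x v" if "v \<in> ?W" for v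
      using config_cases[of x v] \<open>x \<in> space M\<close> that W sp by auto
    have "info (\<lambda>v. of_bool (v \<in> {v \<in> ?W. x v = 1})) (past \<Phi> \<one> \<inter> T) = info x (past \<Phi> \<one> \<inter> T)" for \<Phi>
    proof -
      have "tr (past \<Phi> \<one> \<inter> T) \<subseteq> tr T" by (rule tr_mono) simp
      then show ?thesis
        unfolding info_def cpr_def using eq
        by (intro arg_cong[where f = uminus] arg_cong[where f = ln] arg_cong2[where f = "(/)"] pr_cong) blast+
    qed
    then show ?thesis by (simp only: finite_info_def)
  qed
  ultimately show ?thesis by (simp cong: measurable_cong)
qed

lemma mean_info_measurable:
  assumes M: "sets M = sets (config_space V E)"
  shows "mean_info \<in> borel_measurable M"
proof (rule borel_measurable_LIMSEQ_real)
  show "finite_info (En n) \<in> borel_measurable M" for n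
    by (rule finite_info_measurable[OF M En(2,3)])
  fix x assume "x \<in> space M"
  then have x: "x \<in> Conf" using sets_eq_imp_space_eq[OF M] space_config_space by simp
  show "(\<lambda>n. finite_info (En n) x) \<longlonglongrightarrow> mean_info x"
  proof (rule LIMSEQ_I)
    fix r :: real assume "0 < r"
    then have "0 < r / 2" by simp
    then obtain S where S: "finite S" "S \<subseteq> carrier G"
      "\<And>x T. x \<in> Conf \<Longrightarrow> finite T \<Longrightarrow> T \<subseteq> carrier G \<Longrightarrow> S \<subseteq> T \<Longrightarrow> \<bar>finite_info T x - mean_info x\<bar> \<le> r / 2"
      using mean_info_approx by metis
    obtain N where N: "\<And>n. N \<le> n \<Longrightarrow> S \<subseteq> En n" using En_covers[OF S(1,2)] by metis
    have "norm (finite_info (En n) x - mean_info x) < r" if "N \<le> n" for n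
      using S(3)[OF x En(2,3) N[OF that]] \<open>0 < r\<close> by simp
    then show "\<exists>no. \<forall>n\<ge>no. norm (finite_info (En n) x - mean_info x) < r" by blast
  qed
qed

lemma expected_information_eq:
  assumes x: "x \<in> Conf"
  shows "expected_information G V E act U\<^sub>0 En P \<nu> x = ennreal (1 / real (card U\<^sub>0) * mean_info x)"
proof -
  let ?c = "1 / real (card U\<^sub>0)"
  obtain C where C: "\<And>x \<Phi>. x \<in> Conf \<Longrightarrow> \<one> \<notin> past \<Phi> \<one> \<Longrightarrow> 0 \<le> limit_info x \<Phi> \<and> limit_info x \<Phi> \<le> C"
    using info_uniform_bound by metis
  have cond: "cond_prob P (\<lambda>x'. x' \<in> cylinder V E x U\<^sub>0) (\<lambda>x'. x' \<in> cylinder V E x W) = cpr x U\<^sub>0 W" for W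
  proof -
    have "{x' \<in> space P. x' \<in> cylinder V E x U\<^sub>0 \<and> x' \<in> cylinder V E x W} = cylinder V E x (U\<^sub>0 \<union> W)"
      "{x' \<in> space P. x' \<in> cylinder V E x W} = cylinder V E x W"
      by (auto simp: space_P cylinder_def)
    then show ?thesis by (simp add: cond_prob_def cpr_def)
  qed
  have "AE \<Phi> in \<nu>. e2ennreal (information G V E act U\<^sub>0 En P x \<Phi>) = ennreal (?c * limit_info x \<Phi>)"
    using one_not_past
  proof eventually_elim
    case (elim \<Phi>)
    have "(\<lambda>n. ereal (?c * info x (past \<Phi> \<one> \<inter> En n))) \<longlonglongrightarrow> ereal (?c * limit_info x \<Phi>)"
      by (intro tendsto_intros limit_info_LIMSEQ x elim) 
    then have "information G V E act U\<^sub>0 En P x \<Phi> = ereal (?c * limit_info x \<Phi>)"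
      unfolding information_def cond card_U0[symmetric] info_def
      by (intro lim_imp_Limsup) (auto simp: info_def)
    then show ?case by simp
  qed
  then have "expected_information G V E act U\<^sub>0 En P \<nu> x = (\<integral>\<^sup>+\<Phi>. ennreal (?c * limit_info x \<Phi>) \<partial>\<nu>)"
    unfolding expected_information_def by (rule nn_integral_cong_AE)
  also have "\<dots> = ennreal (\<integral>\<Phi>. ?c * limit_info x \<Phi> \<partial>\<nu>)"
    using one_not_past C[OF x]
    by (intro nn_integral_eq_integral integrable_mult_right limit_info_integrable x)
      (auto elim!: eventually_mono intro!: mult_nonneg_nonneg)
  finally show ?thesis by (simp add: mean_info_def)
qed

end

section \<open>The free energy formula\<close>

context hardcore_past
begin

text \<open>The heart of the argument. Taking the mean over the random past in the chain rule and using the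
  invariance of the past and of the Gibbs measure gives
  \<open>- ln (pr x (tr F)) = (\<Sum>g\<in>F. finite_info (g\<inverse>F) (shift g x))\<close>. For \<open>g\<close> away from the boundary of \<open>F\<close> the set
  \<open>g\<inverse>F\<close> contains any given finite set, so \<open>finite_info\<close> is close to \<open>mean_info\<close>; the left
  hand side is compared with the partition function.\<close>

lemma average_info_energy:
  assumes eps: "0 < \<epsilon>"
  obtains S c where "finite S" "S \<subseteq> carrier G"
    "\<And>x F. x \<in> Conf \<Longrightarrow> finite F \<Longrightarrow> F \<subseteq> carrier G \<Longrightarrow>
      \<bar>(\<Sum>g\<in>F. mean_info (shift g x) + energy (shift g x)) - ln (Z (tr F))\<bar>
        \<le> \<epsilon> * real (card F) + c * real (card (right_boundary F S))"
proof -
  \<comment> \<open>\<open>S1\<close> controls the comparison with the partition function, \<open>S2\<close> the truncation of the past.\<close>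
  obtain S1 c where S1: "finite S1" "S1 \<subseteq> carrier G" and cyl:
    "\<And>x F. x \<in> Conf \<Longrightarrow> finite F \<Longrightarrow> F \<subseteq> carrier G \<Longrightarrow>
      \<bar>- ln (pr x (tr F)) + (\<Sum>g\<in>F. energy (shift g x)) - ln (Z (tr F))\<bar> \<le> c * real (card (right_boundary F S1))"
    using cylinder_energy by metis
  obtain S2 where S2: "finite S2" "S2 \<subseteq> carrier G" and app:
    "\<And>x T. x \<in> Conf \<Longrightarrow> finite T \<Longrightarrow> T \<subseteq> carrier G \<Longrightarrow> S2 \<subseteq> T \<Longrightarrow> \<bar>finite_info T x - mean_info x\<bar> \<le> \<epsilon>"
    using mean_info_approx[OF eps] by metis
  obtain C where C: "0 \<le> C" "\<And>x. x \<in> Conf \<Longrightarrow> 0 \<le> mean_info x \<and> mean_info x \<le> C"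
    "\<And>x T. x \<in> Conf \<Longrightarrow> finite T \<Longrightarrow> T \<subseteq> carrier G \<Longrightarrow> 0 \<le> finite_info T x \<and> finite_info T x \<le> C"
    using mean_info_bounds by metis
  interpret nu: prob_space \<nu> by (rule prob_nu)
  show ?thesis
  proof (rule that[of "S1 \<union> S2" "\<bar>c\<bar> + C"])
    fix x F assume x: "x \<in> Conf" and F: "finite F" "F \<subseteq> carrier G"
    let ?T = "\<lambda>g. (\<lambda>h. inv g \<otimes> h) ` F"
    let ?B = "right_boundary F (S1 \<union> S2)"
    have T: "finite (?T g)" "?T g \<subseteq> carrier G" if "g \<in> F" for g using that F by auto
    have fB: "finite ?B" using F by (auto simp: right_boundary_def)
    \<comment> \<open>Moving \<open>g\<close> to the identity turns the past of \<open>g\<close> in \<open>F\<close> into the past of the identity in \<open>g\<inverse>F\<close>.\<close>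
    have pattern: "(\<lambda>h. inv g \<otimes> h) ` ((g <# A) \<inter> F) = A \<inter> ?T g" if g: "g \<in> F" and A: "A \<subseteq> carrier G" for g A
    proof -
      have gG: "g \<in> carrier G" using g F by auto
      have inv_g: "inv g \<otimes> (g \<otimes> a) = a" if "a \<in> A" for a
        using that A gG by (simp add: m_assoc[symmetric] subset_iff)
      have g_inv: "g \<otimes> (inv g \<otimes> h) = h" if "h \<in> F" for h
        using that F gG by (simp add: m_assoc[symmetric] subset_iff)
      show ?thesis
      proof
        show "(\<lambda>h. inv g \<otimes> h) ` ((g <# A) \<inter> F) \<subseteq> A \<inter> ?T g"
          using inv_g by (auto simp: l_coset_def)
        show "A \<inter> ?T g \<subseteq> (\<lambda>h. inv g \<otimes> h) ` ((g <# A) \<inter> F)"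
        proof
          fix a assume "a \<in> A \<inter> ?T g"
          then obtain h where h: "a \<in> A" "h \<in> F" "a = inv g \<otimes> h" by auto
          have "h = g \<otimes> a" using g_inv[OF h(2)] h(3) by simp
          then have "h \<in> (g <# A) \<inter> F" using h by (auto simp: l_coset_def)
          then show "a \<in> (\<lambda>h. inv g \<otimes> h) ` ((g <# A) \<inter> F)" using h(3) by (rule rev_image_eqI)
        qed
      qed
    qed
    have expect: "(\<integral>\<Phi>. info (shift g x) ((\<lambda>h. inv g \<otimes> h) ` (past \<Phi> g \<inter> F)) \<partial>\<nu>) = finite_info (?T g) (shift g x)"
      if g: "g \<in> F" for g
      using past_shift_expectation[of g F "\<lambda>A. info (shift g x) ((\<lambda>h. inv g \<otimes> h) ` A)"] g F pattern[OF g past_G]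
      by (simp add: finite_info_def subset_iff)
    have "AE \<Phi> in \<nu>. - ln (pr x (tr F)) = (\<Sum>g\<in>F. info (shift g x) ((\<lambda>h. inv g \<otimes> h) ` (past \<Phi> g \<inter> F)))"
      using past_order
    proof eventually_elim
      case (elim \<Phi>)
      have "- ln (pr x (tr F)) = (\<Sum>g\<in>F. - ln (cpr x (tr {g}) (tr (past \<Phi> g \<inter> F))))"
        using elim by (intro chain_rule x F) auto
      also have "\<dots> = (\<Sum>g\<in>F. info (shift g x) ((\<lambda>h. inv g \<otimes> h) ` (past \<Phi> g \<inter> F)))"
        using F by (intro sum.cong refl cpr_translate x) auto
      finally show ?case .
    qed
    then have "(\<integral>\<Phi>. - ln (pr x (tr F)) \<partial>\<nu>) = (\<integral>\<Phi>. (\<Sum>g\<in>F. info (shift g x) ((\<lambda>h. inv g \<otimes> h) ` (past \<Phi> g \<inter> F))) \<partial>\<nu>)"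
    proof (rule integral_cong_AE[rotated 2])
      show "(\<lambda>\<Phi>. \<Sum>g\<in>F. info (shift g x) ((\<lambda>h. inv g \<otimes> h) ` (past \<Phi> g \<inter> F))) \<in> borel_measurable \<nu>"
      proof (rule borel_measurable_sum)
        fix g assume "g \<in> F"
        then show "(\<lambda>\<Phi>. info (shift g x) ((\<lambda>h. inv g \<otimes> h) ` (past \<Phi> g \<inter> F))) \<in> borel_measurable \<nu>"
          using F by (intro past_pattern_measurable[where f = "\<lambda>A. info (shift g x) ((\<lambda>h. inv g \<otimes> h) ` A)"]) auto
      qed
    qed simp
    also have "\<dots> = (\<Sum>g\<in>F. \<integral>\<Phi>. info (shift g x) ((\<lambda>h. inv g \<otimes> h) ` (past \<Phi> g \<inter> F)) \<partial>\<nu>)"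
    proof (rule Bochner_Integration.integral_sum)
      fix g assume "g \<in> F"
      then show "integrable \<nu> (\<lambda>\<Phi>. info (shift g x) ((\<lambda>h. inv g \<otimes> h) ` (past \<Phi> g \<inter> F)))"
        using F by (intro past_pattern_integrable[where f = "\<lambda>A. info (shift g x) ((\<lambda>h. inv g \<otimes> h) ` A)"]) auto
    qed
    also have "\<dots> = (\<Sum>g\<in>F. finite_info (?T g) (shift g x))"
      by (rule sum.cong[OF refl expect])
    finally have chain: "- ln (pr x (tr F)) = (\<Sum>g\<in>F. finite_info (?T g) (shift g x))"
      by (simp add: nu.prob_space)
    have pointwise: "\<bar>finite_info (?T g) (shift g x) - mean_info (shift g x)\<bar> \<le> \<epsilon> + C * of_bool (g \<in> ?B)" if g: "g \<in> F" for g
    proof (cases "S2 \<subseteq> ?T g")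
      case True
      have "shift g x \<in> Conf" using g F by (intro shift_config x) auto
      then have "\<bar>finite_info (?T g) (shift g x) - mean_info (shift g x)\<bar> \<le> \<epsilon>"
        using T[OF g] True by (rule app)
      then show ?thesis using C(1) by (simp add: add_increasing2)
    next
      case False
      then obtain s where s: "s \<in> S2" "s \<notin> ?T g" by auto
      have "g \<otimes> s \<notin> F"
      proof
        assume "g \<otimes> s \<in> F"
        moreover have "s = inv g \<otimes> (g \<otimes> s)" using s S2 g F by (simp add: m_assoc[symmetric] subset_iff)
        ultimately show False using s by blast
      qed
      then have "g \<in> ?B" using g s by (auto simp: right_boundary_def)
      then show ?thesis
      proof -
        have y: "shift g x \<in> Conf" using g F by (intro shift_config x) auto
        have "\<bar>finite_info (?T g) (shift g x) - mean_info (shift g x)\<bar> \<le> \<epsilon> + C"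
          using C(2)[OF y] C(3)[OF y T[OF g]] eps by linarith
        then show ?thesis using \<open>g \<in> ?B\<close> by simp
      qed
    qed
    have "\<bar>(\<Sum>g\<in>F. finite_info (?T g) (shift g x)) - (\<Sum>g\<in>F. mean_info (shift g x))\<bar>
        \<le> (\<Sum>g\<in>F. \<epsilon> + C * of_bool (g \<in> ?B))"
      unfolding sum_subtractf[symmetric] by (rule order_trans[OF sum_abs sum_mono[OF pointwise]])
    also have "\<dots> = \<epsilon> * real (card F) + C * real (card ?B)"
    proof -
      have "(\<Sum>g\<in>F. of_bool (g \<in> ?B)) = real (card ?B)"
      proof -
        have "F \<inter> {g. g \<in> ?B} = ?B" by (auto simp: right_boundary_def)
        then show ?thesis using F by (simp add: sum_of_bool_eq)
      qed
      then show ?thesis by (simp add: sum.distrib sum_distrib_left[symmetric])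
    qed
    finally have 1: "\<bar>- ln (pr x (tr F)) - (\<Sum>g\<in>F. mean_info (shift g x))\<bar> \<le> \<epsilon> * real (card F) + C * real (card ?B)"
      unfolding chain .
    have "right_boundary F S1 \<subseteq> ?B" by (auto simp: right_boundary_def)
    then have "real (card (right_boundary F S1)) \<le> real (card ?B)" using fB by (simp add: card_mono)
    then have "c * real (card (right_boundary F S1)) \<le> \<bar>c\<bar> * real (card ?B)"
      by (intro mult_mono) auto
    then have 2: "\<bar>- ln (pr x (tr F)) + (\<Sum>g\<in>F. energy (shift g x)) - ln (Z (tr F))\<bar> \<le> \<bar>c\<bar> * real (card ?B)"
      using cyl[OF x F] by linarith
    show "\<bar>(\<Sum>g\<in>F. mean_info (shift g x) + energy (shift g x)) - ln (Z (tr F))\<bar>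
        \<le> \<epsilon> * real (card F) + (\<bar>c\<bar> + C) * real (card ?B)"
      using 1 2 unfolding sum.distrib distrib_right by linarith
  qed (use S1 S2 in auto)
qed

lemma shift_measurable:
  assumes g: "g \<in> carrier G" and Q: "sets Q = sets (config_space V E)"
  shows "config_act G V act g \<in> measurable Q Q"
proof -
  let ?T = "subtopology (cube_topology V) Conf"
  have "continuous_map ?T ?T (config_act G V act g)"
  proof (rule continuous_map_into_subtopology)
    show "continuous_map ?T (cube_topology V) (config_act G V act g)"
      unfolding cube_topology_def[of V] continuous_map_componentwise
    proof (intro conjI ballI)
      show "config_act G V act g ` topspace (subtopology (product_topology (\<lambda>_. discrete_topology {0, 1}) V) Conf) \<subseteq> extensional V"
        by (auto simp: config_act_def)
      fix v assume v: "v \<in> V"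
      then show "continuous_map (subtopology (product_topology (\<lambda>_. discrete_topology {0, 1}) V) Conf) (discrete_topology {0, 1})
          (\<lambda>x. config_act G V act g x v)"
      proof -
        have "act (inv g) v \<in> V" using act_V v g by simp
        then have "continuous_map (subtopology (cube_topology V) Conf) (discrete_topology {0, 1}) (\<lambda>x. x (act (inv g) v))"
          by (intro continuous_map_from_subtopology continuous_map_cube_coordinate)
        moreover have "(\<lambda>x. x (act (inv g) v)) = (\<lambda>x. config_act G V act g x v)"
          using v by (simp add: config_act_def)
        ultimately show ?thesis unfolding cube_topology_def by simp
      qed
    qed
    show "config_act G V act g \<in> topspace ?T \<rightarrow> Conf"
      using shift_config[of "inv g"] g by auto
  qed
  then have "config_act G V act g \<in> measurable (config_space V E) (config_space V E)"
    unfolding config_space_def by (rule continuous_map_measurable)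
  then show ?thesis using measurable_cong_sets[OF Q Q] by auto
qed

lemma energy_measurable:
  assumes "sets Q = sets (config_space V E)" shows "energy \<in> borel_measurable Q"
  unfolding energy_def
proof (intro borel_measurable_sum borel_measurable_times borel_measurable_const)
  fix u assume u: "u \<in> U\<^sub>0"
  have sp: "space Q = Conf" using sets_eq_imp_space_eq[OF assms] space_config_space by simp
  have "(\<lambda>x. if x u = 1 then 1 else 0) \<in> borel_measurable Q"
    using coordinate_measurable[of u 1] u U0_V by (intro measurable_If) (auto simp: sp assms)
  moreover have "(if x u = 1 then 1 else 0) = real (x u)" if "x \<in> space Q" for x
    using config_cases[of x u] that u U0_V sp by auto
  ultimately show "(\<lambda>x. real (x u)) \<in> borel_measurable Q" by (rule measurable_cong[THEN iffD1, rotated])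
qed

text \<open>Integrating the previous estimate over an invariant measure replaces each summand by its integral
  \<open>J\<close>. Along a Foelner sequence \<open>J\<close> is therefore the limit of \<open>ln (Z (tr F)) / card F\<close>, and the infimum
  rule shows that this limit is the infimum.\<close>

lemma info_energy_integral:
  assumes Q: "invariant_config_measure G V E act Q"
  defines "J \<equiv> \<integral>x. mean_info x + energy x \<partial>Q"
  shows info_energy_integrable: "integrable Q (\<lambda>x. mean_info x + energy x)"
    and "J / real (card U\<^sub>0) = free_energy G V E lam act U\<^sub>0"
proof -
  have sets_Q: "sets Q = sets (config_space V E)" and inv_Q: "\<And>g. g \<in> carrier G \<Longrightarrow> distr Q Q (config_act G V act g) = Q"
    and prob: "prob_space Q"
    using Q by (auto simp: invariant_config_measure_def)
  interpret prob_space Q by (rule prob)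
  have sp: "space Q = Conf" using sets_eq_imp_space_eq[OF sets_Q] space_config_space by simp
  let ?f = "\<lambda>x. mean_info x + energy x"
  have meas: "?f \<in> borel_measurable Q"
    by (intro borel_measurable_add mean_info_measurable energy_measurable sets_Q)
  obtain C where C: "\<And>x. x \<in> Conf \<Longrightarrow> 0 \<le> mean_info x \<and> mean_info x \<le> C"
    using mean_info_bounds by metis
  show int: "integrable Q ?f"
  proof (rule integrable_const_bound[of _ "C + (\<Sum>u\<in>U\<^sub>0. \<bar>ln (lam u)\<bar>)"])
    have "norm (?f x) \<le> C + (\<Sum>u\<in>U\<^sub>0. \<bar>ln (lam u)\<bar>)" if x: "x \<in> Conf" for x
    proof -
      have "\<bar>energy x\<bar> \<le> (\<Sum>u\<in>U\<^sub>0. \<bar>real (x u) * ln (lam u)\<bar>)"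
        unfolding energy_def by (rule sum_abs)
      also have "\<dots> \<le> (\<Sum>u\<in>U\<^sub>0. \<bar>ln (lam u)\<bar>)"
      proof (rule sum_mono)
        fix u assume "u \<in> U\<^sub>0"
        then have "x u = 0 \<or> x u = 1" using config_cases[OF x] U0_V by auto
        then show "\<bar>real (x u) * ln (lam u)\<bar> \<le> \<bar>ln (lam u)\<bar>" by auto
      qed
      finally show ?thesis using C[OF x] unfolding real_norm_def by linarith
    qed
    then show "AE x in Q. norm (?f x) \<le> C + (\<Sum>u\<in>U\<^sub>0. \<bar>ln (lam u)\<bar>)" by (intro AE_I2) (simp add: sp)
  qed (rule meas)
  have shift_int: "integrable Q (\<lambda>x. ?f (shift g x))" "(\<integral>x. ?f (shift g x) \<partial>Q) = J" if g: "g \<in> carrier G" for g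
  proof -
    have ig: "inv g \<in> carrier G" using g by simp
    note m = shift_measurable[OF ig sets_Q]
    show "integrable Q (\<lambda>x. ?f (shift g x))"
      using integrable_distr_eq[OF m meas] int unfolding inv_Q[OF ig] by simp
    show "(\<integral>x. ?f (shift g x) \<partial>Q) = J"
      using integral_distr[OF m meas] unfolding inv_Q[OF ig] J_def by simp
  qed
  have estimate: "\<exists>S c. finite S \<and> S \<subseteq> carrier G \<and> (\<forall>F. finite F \<longrightarrow> F \<subseteq> carrier G \<longrightarrow>
      \<bar>real (card F) * J - ln (Z (tr F))\<bar> \<le> \<epsilon> * real (card F) + c * real (card (right_boundary F S)))"
    if eps: "0 < \<epsilon>" for \<epsilon>
  proof -
    obtain S c where S: "finite S" "S \<subseteq> carrier G" and b: "\<And>x F. x \<in> Conf \<Longrightarrow> finite F \<Longrightarrow> F \<subseteq> carrier G \<Longrightarrow>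
      \<bar>(\<Sum>g\<in>F. ?f (shift g x)) - ln (Z (tr F))\<bar> \<le> \<epsilon> * real (card F) + c * real (card (right_boundary F S))"
      using average_info_energy[OF eps] by blast
    have "\<bar>real (card F) * J - ln (Z (tr F))\<bar> \<le> \<epsilon> * real (card F) + c * real (card (right_boundary F S))"
      if F: "finite F" "F \<subseteq> carrier G" for F
    proof -
      let ?s = "\<lambda>x. \<Sum>g\<in>F. ?f (shift g x)"
      have i: "integrable Q ?s"
        using F shift_int(1) by (intro Bochner_Integration.integrable_sum) auto
      have "(\<integral>x. ?s x \<partial>Q) = (\<Sum>g\<in>F. \<integral>x. ?f (shift g x) \<partial>Q)"
        using F shift_int(1) by (intro Bochner_Integration.integral_sum) auto
      also have "\<dots> = (\<Sum>g\<in>F. J)"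
        using F shift_int(2) by (intro sum.cong) auto
      finally have "(\<integral>x. ?s x \<partial>Q) = (\<Sum>g\<in>F. J)" .
      then have diff: "real (card F) * J - ln (Z (tr F)) = (\<integral>x. ?s x - ln (Z (tr F)) \<partial>Q)"
        using i by (simp add: prob_space)
      have "\<bar>\<integral>x. ?s x - ln (Z (tr F)) \<partial>Q\<bar> \<le> (\<integral>x. \<bar>?s x - ln (Z (tr F))\<bar> \<partial>Q)" by (rule integral_abs_bound)
      also have "\<dots> \<le> (\<integral>x. \<epsilon> * real (card F) + c * real (card (right_boundary F S)) \<partial>Q)"
      proof (rule integral_mono)
        show "integrable Q (\<lambda>x. \<bar>?s x - ln (Z (tr F))\<bar>)"
          by (intro integrable_abs Bochner_Integration.integrable_diff i integrable_const)
        show "\<bar>?s x - ln (Z (tr F))\<bar> \<le> \<epsilon> * real (card F) + c * real (card (right_boundary F S))" if "x \<in> space Q" for x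
          using that unfolding sp by (rule b[OF _ F])
      qed simp
      finally show ?thesis unfolding diff by (simp add: prob_space)
    qed
    then show ?thesis using S by blast
  qed
  obtain F :: "nat \<Rightarrow> 'g set" where F: "\<And>n. finite (F n)" "\<And>n. F n \<subseteq> carrier G" "\<And>n. F n \<noteq> {}"
    and foelner: "\<And>S. finite S \<Longrightarrow> S \<subseteq> carrier G \<Longrightarrow> (\<lambda>n. real (card (right_boundary (F n) S)) / real (card (F n))) \<longlonglongrightarrow> 0"
    using that by (rule right_foelner)
  have cF: "0 < real (card (F n))" for n using F by (simp add: card_gt_0_iff)
  have lim: "(\<lambda>n. ln (Z (tr (F n))) / real (card (F n))) \<longlonglongrightarrow> J"
  proof (rule LIMSEQ_I)
    fix r :: real assume r: "0 < r"
    then have "0 < r / 2" by simp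
    from estimate[OF this] obtain S c where S: "finite S" "S \<subseteq> carrier G" and b: "\<And>F. finite F \<Longrightarrow> F \<subseteq> carrier G \<Longrightarrow>
      \<bar>real (card F) * J - ln (Z (tr F))\<bar> \<le> r / 2 * real (card F) + c * real (card (right_boundary F S))" by blast
    have "(\<lambda>n. c * (real (card (right_boundary (F n) S)) / real (card (F n)))) \<longlonglongrightarrow> c * 0"
      by (intro tendsto_intros foelner S)
    then have "\<forall>\<^sub>F n in sequentially. c * (real (card (right_boundary (F n) S)) / real (card (F n))) < r / 2"
      using r by (intro order_tendstoD(2)) auto
    then obtain N where N: "\<And>n. N \<le> n \<Longrightarrow> c * (real (card (right_boundary (F n) S)) / real (card (F n))) < r / 2"
      by (auto simp: eventually_sequentially)
    have "norm (ln (Z (tr (F n))) / real (card (F n)) - J) < r" if n: "N \<le> n" for n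
    proof -
      have "norm (ln (Z (tr (F n))) / real (card (F n)) - J)
          = \<bar>real (card (F n)) * J - ln (Z (tr (F n)))\<bar> / real (card (F n))"
      proof -
        have "ln (Z (tr (F n))) / real (card (F n)) - J = - ((real (card (F n)) * J - ln (Z (tr (F n)))) / real (card (F n)))"
          using cF[of n] by (simp add: field_simps)
        then show ?thesis using cF[of n] by (simp only: real_norm_def abs_minus_cancel abs_divide abs_of_pos)
      qed
      also have "\<dots> \<le> (r / 2 * real (card (F n)) + c * real (card (right_boundary (F n) S))) / real (card (F n))"
        using cF[of n] by (intro divide_right_mono b F) auto
      also have "\<dots> = r / 2 + c * (real (card (right_boundary (F n) S)) / real (card (F n)))"
        using cF[of n] by (simp add: add_divide_distrib)
      also have "\<dots> < r" using N[OF n] by linarith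
      finally show ?thesis .
    qed
    then show "\<exists>no. \<forall>n\<ge>no. norm (ln (Z (tr (F n))) / real (card (F n)) - J) < r" by blast
  qed
  define m where "m = real (card U\<^sub>0)"
  \<comment> \<open>If \<open>V\<close> is empty then \<open>m = 0\<close>, and all quotients by \<open>m\<close> below are 0, as is the free energy.\<close>
  let ?A = "{F. F \<subseteq> carrier G \<and> finite F \<and> F \<noteq> {}}"
  let ?q = "\<lambda>F. ln (Z (tr F)) / real (card (tr F))"
  have q: "?q K = ln (Z (tr K)) / real (card K) / m" if "K \<in> ?A" for K
    using that by (simp add: tr_card m_def)
  have lower: "J / m \<le> ?q K" if K: "K \<in> ?A" for K
  proof -
    have cK: "0 < real (card K)" using K by (simp add: card_gt_0_iff)
    let ?S = "{inv k \<otimes> k' | k k'. k \<in> K \<and> k' \<in> K}"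
    have S: "finite ?S" "?S \<subseteq> carrier G"
    proof -
      have "?S = (\<lambda>(k, k'). inv k \<otimes> k') ` (K \<times> K)" by auto
      then show "finite ?S" using K by simp
      show "?S \<subseteq> carrier G" using K by auto
    qed
    let ?a = "real (card K) * real (card K) * log_activity_sum"
    have "real (card K) * (ln (Z (tr (F n))) / real (card (F n)))
        \<le> ln (Z (tr K)) + ?a * (real (card (right_boundary (F n) ?S)) / real (card (F n)))" for n
    proof -
      have "real (card K) * ln (Z (tr (F n))) / real (card (F n))
          \<le> (real (card (F n)) * ln (Z (tr K)) + ?a * real (card (right_boundary (F n) ?S))) / real (card (F n))"
        using K infimum_rule[of K "F n"] F by (intro divide_right_mono) auto
      also have "\<dots> = ln (Z (tr K)) + ?a * (real (card (right_boundary (F n) ?S)) / real (card (F n)))"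
        using cF[of n] by (simp add: add_divide_distrib)
      finally show ?thesis by simp
    qed
    moreover have "(\<lambda>n. real (card K) * (ln (Z (tr (F n))) / real (card (F n)))) \<longlonglongrightarrow> real (card K) * J"
      by (intro tendsto_intros lim)
    moreover have "(\<lambda>n. ln (Z (tr K)) + ?a * (real (card (right_boundary (F n) ?S)) / real (card (F n)))) \<longlonglongrightarrow> ln (Z (tr K)) + ?a * 0"
      by (intro tendsto_intros foelner S)
    ultimately have "real (card K) * J \<le> ln (Z (tr K)) + ?a * 0"
      by (intro LIMSEQ_le) auto
    then have "J \<le> ln (Z (tr K)) / real (card K)" using cK by (simp add: field_simps)
    then show ?thesis unfolding q[OF K] by (rule divide_right_mono) (simp add: m_def)
  qed
  have bdd: "bdd_below (?q ` ?A)" using lower by (intro bdd_belowI2[of _ "J / m"])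
  have "free_energy G V E lam act U\<^sub>0 \<le> J / m"
  proof (rule LIMSEQ_le_const)
    show "(\<lambda>n. ln (Z (tr (F n))) / real (card (F n)) / m) \<longlonglongrightarrow> J / m"
    proof (cases "m = 0")
      case False
      then show ?thesis by (intro tendsto_divide lim tendsto_const)
    qed simp
    have FA: "F n \<in> ?A" for n using F by auto
    have "free_energy G V E lam act U\<^sub>0 \<le> ?q (F n)" for n
      unfolding free_energy_def by (rule cINF_lower[OF bdd FA])
    then show "\<exists>N. \<forall>n\<ge>N. free_energy G V E lam act U\<^sub>0 \<le> ln (Z (tr (F n))) / real (card (F n)) / m"
      using q[OF FA] by auto
  qed
  moreover have "J / m \<le> free_energy G V E lam act U\<^sub>0"
    unfolding free_energy_def using F by (intro cINF_greatest lower) auto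
  ultimately show "J / real (card U\<^sub>0) = free_energy G V E lam act U\<^sub>0"
    unfolding m_def by simp
qed

lemma free_energy_formula:
  assumes Q: "invariant_config_measure G V E act Q"
  shows "AE x in Q. expected_information G V E act U\<^sub>0 En P \<nu> x < \<infinity>"
    and "has_bochner_integral Q
      (\<lambda>x. enn2real (expected_information G V E act U\<^sub>0 En P \<nu> x) + energy_fun G V lam act U\<^sub>0 x)
      (free_energy G V E lam act U\<^sub>0)"
proof -
  have sets_Q: "sets Q = sets (config_space V E)" using Q by (simp add: invariant_config_measure_def)
  have sp: "space Q = Conf" using sets_eq_imp_space_eq[OF sets_Q] space_config_space by simp
  show "AE x in Q. expected_information G V E act U\<^sub>0 En P \<nu> x < \<infinity>"
    by (rule AE_I2) (simp add: sp expected_information_eq)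
  obtain C where C: "\<And>x. x \<in> Conf \<Longrightarrow> 0 \<le> mean_info x \<and> mean_info x \<le> C"
    using mean_info_bounds by metis
  let ?m = "real (card U\<^sub>0)"
  have eq: "enn2real (expected_information G V E act U\<^sub>0 En P \<nu> x) + energy_fun G V lam act U\<^sub>0 x
      = (mean_info x + energy x) / ?m" if "x \<in> space Q" for x
    using that C[of x] by (simp add: sp expected_information_eq energy_fun_def card_U0[symmetric] energy_def add_divide_distrib)
  have "has_bochner_integral Q (\<lambda>x. (mean_info x + energy x) / ?m) ((\<integral>x. mean_info x + energy x \<partial>Q) / ?m)"
    by (intro has_bochner_integral_divide_zero has_bochner_integral_integrable info_energy_integrable Q)
  then show "has_bochner_integral Q
      (\<lambda>x. enn2real (expected_information G V E act U\<^sub>0 En P \<nu> x) + energy_fun G V lam act U\<^sub>0 x)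
      (free_energy G V E lam act U\<^sub>0)"
    unfolding info_energy_integral(2)[OF Q] by (simp add: eq cong: has_bochner_integral_cong)
qed

lemma empty_config_invariant: "invariant_config_measure G V E act (return (config_space V E) (empty_config V))"
proof -
  let ?M = "config_space V E"
  have sp: "empty_config V \<in> space ?M" using zero_config by (simp add: space_config_space)
  have fix0: "config_act G V act g (empty_config V) = empty_config V" if "g \<in> carrier G" for g
    using act_V[of "inv g"] that by (auto simp: config_act_def empty_config_def)
  have "distr (return ?M (empty_config V)) (return ?M (empty_config V)) (config_act G V act g) = return ?M (empty_config V)"
    if g: "g \<in> carrier G" for g
  proof -
    have "config_act G V act g \<in> measurable ?M (return ?M (empty_config V))"
      using shift_measurable[OF g refl] measurable_cong_sets[OF refl, of "return ?M (empty_config V)" ?M ?M] by simp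
    from distr_return[OF this sp] have "distr (return ?M (empty_config V)) (return ?M (empty_config V)) (config_act G V act g)
      = return (return ?M (empty_config V)) (empty_config V)" by (simp add: fix0[OF g])
    also have "\<dots> = return ?M (empty_config V)" by (rule return_cong) simp
    finally show ?thesis .
  qed
  then show ?thesis
    using prob_space_return[OF sp] by (simp add: invariant_config_measure_def)
qed

text \<open>The unit mass at the empty configuration is invariant and has energy 0.\<close>

lemma free_energy_formula_empty:
  "expected_information G V E act U\<^sub>0 En P \<nu> (empty_config V) = ennreal (free_energy G V E lam act U\<^sub>0)"
proof -
  let ?Q = "return (config_space V E) (empty_config V)"
  let ?e = "expected_information G V E act U\<^sub>0 En P \<nu> (empty_config V)"
  let ?f = "\<lambda>x. mean_info x + energy x"
  have sp: "empty_config V \<in> space (config_space V E)" using zero_config by (simp add: space_config_space)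
  have meas: "?f \<in> borel_measurable (config_space V E)"
    by (intro borel_measurable_add mean_info_measurable energy_measurable refl)
  have "energy (empty_config V) = 0"
    unfolding energy_def empty_config_def using U0_V by (intro sum.neutral) auto
  then have "(\<integral>x. ?f x \<partial>?Q) = mean_info (empty_config V)"
    using integral_return[OF sp meas] by simp
  then have "mean_info (empty_config V) / real (card U\<^sub>0) = free_energy G V E lam act U\<^sub>0"
    using info_energy_integral(2)[OF empty_config_invariant] by simp
  then show ?thesis by (simp add: expected_information_eq[OF zero_config])
qed

end

theorem theorem7p5:
  fixes G :: "('g, 'm) monoid_scheme"
    and V :: "'v set" and E :: "'v rel" and lam :: "'v \<Rightarrow> real"
    and act :: "'g \<Rightarrow> 'v \<Rightarrow> 'v" and U\<^sub>0 :: "'v set"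
    and En :: "nat \<Rightarrow> 'g set" and P :: "('v \<Rightarrow> nat) measure"
  assumes amenable: "amenable_group G"
    and model: "hardcore_class G V E lam act"
    and domain: "fundamental_domain G V act U\<^sub>0"
    and exhaust: "exhaustion G En"
    and ssm: "strong_spatial_mixing V E lam"
    and gibbs: "gibbs_measure V E lam P"
  shows "(\<forall>Q \<nu>. invariant_config_measure G V E act Q \<longrightarrow> invariant_random_past G \<nu> \<longrightarrow>
            (AE x in Q. expected_information G V E act U\<^sub>0 En P \<nu> x < \<infinity>) \<and>
            has_bochner_integral Q
              (\<lambda>x. enn2real (expected_information G V E act U\<^sub>0 En P \<nu> x)
                     + energy_fun G V lam act U\<^sub>0 x)
              (free_energy G V E lam act U\<^sub>0)) \<and>
         (\<forall>\<nu>. invariant_random_past G \<nu> \<longrightarrow>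
            expected_information G V E act U\<^sub>0 En P \<nu> (empty_config V)
              = ennreal (free_energy G V E lam act U\<^sub>0))"
proof -
  have setting: "hardcore_past V E lam P G act U\<^sub>0 En \<nu>" if "invariant_random_past G \<nu>" for \<nu>
    using assms that by unfold_locales (auto simp: hardcore_class_def)
  show ?thesis
    using hardcore_past.free_energy_formula[OF setting] hardcore_past.free_energy_formula_empty[OF setting]
    by blast
qed

end
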